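(* Let $G$ be a locally finite connected graph and $k\in\mathbb N$. Then $\mathcal T(N^{\le k}(G))$ is a tree-of-tangles of $G$ of resolution $k$.
   Context: Graphs are simple. A separation of $G$ is a set $\{A,B\}$ with $A\cup B=V(G)$ and no edge of $G$ between $A\setminus B$ and $B\setminus A$; separator $A\cap B$, order $|A\cap B|$. Oriented separations $(A,B)$; $(A,B)\ge(C,D)$ iff $A\subseteq C$ and $B\supseteq D$. Nested: some orientations are $\ge$-comparable; otherwise cross. A component $K$ of $G-X$ is tight if $N(K)=X$; $\{A,B\}$ is tight if $G-(A\cap B)$ has tight components with vertex sets in $A$ and in $B$, respectively. $\top$-star: three distinct oriented separations $(A_i,B_i)$, separators $X_i$, with the $A_i\setminus B_i$ pairwise disjoint with union $V(G)\setminus\bigcup X_i$, and every vertex of some $X_i$ in another $X_j$; constituents $\{A_i,B_i\}$; centre $Z=\bigcap X_i$; $X_{ij}=(X_i\cap X_j)\setminus Z$. Relevant with base $\{A_1,B_1\}$: $\{A_1,B_1\}$ tight and for all $x\in X_{23}$, $i\in\{2,3\}$, there is an $x$–$X_{1i}$ edge or some $y\in X_{1i}\cup Z$ and a component $K$ of $G[A_i\setminus B_i]$ with $x,y\in N(K)$. A $k$-bottleneck is a non-empty set $\beta$ of tight $k$-separations such that whenever $\beta$ contains the base of a relevant $\top$-star of order $\le k$ (all constituents of order $\le k$), $\beta$ contains another constituent of it. Let $\mathcal B^k(G)$ be the set of $k$-bottlenecks, $X^k=\bigcup\mathcal B^k(G)$, $x^k(s)$ the number of elements of $X^k$ crossing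 $s$. Recursively, $N^{<k}(G)=\bigcup_{j<k}N^j(G)$, $N^k(G,\beta)$ = the $s\in\beta$ nested with all of $N^{<k}(G)$ having minimal $x^k(s)$ among those, $N^k(G)=\bigcup_\beta N^k(G,\beta)$, and $N^{\le k}(G)=\bigcup_{j\le k}N^j(G)$. For a nested set $N$ of separations: a star is a set $\sigma$ of oriented separations with $(A,B)\ge(D,C)$ for distinct $(A,B),(C,D)\in\sigma$. A splitting star of $N$ is a star $\sigma$ such that $\{A,B\}\in N$ and $(B,A)\notin\sigma$ for all $(A,B)\in\sigma$, and every $\{C,D\}\in N$ has an orientation $(C,D)\ge(A,B)$ for some $(A,B)\in\sigma$. $\mathcal T(N)=(T,\mathcal V)$: nodes of $T$ are the splitting stars of $N$, edges are the elements $\{A,B\}\in N$, joining the nodes $t_1\ni(A,B)$ and $t_2\ni(B,A)$; the part of node $t$ is $V_t=G[\bigcap_{(A,B)\in t}B]$. A tree-decomposition (parts induced subgraphs) induces for each edge $t_1t_2$ of $T$ the separation $\{A_1,A_2\}$ with $A_i$ the union of the vertex sets of the parts at nodes in the component of $T-t_1t_2$ containing $t_i$. Tangles are as in Robertson–Seymour (e.g. Diestel's Graph Theory). A separation distinguishes two tangles if they orient it differently, efficiently if it has minimum order among separations distinguishing them; tangles are $(\le k)$-distinguishable if some separation of order $\le k$ distinguishes them. A tree-decomposition is a tree-of-tangles of resolution $k$ if for every pair of $(\le k)$-distinguishable tangles some separation induced by an edge of its tree distinguishes them efficiently (in particular it is a tree-decomposition). *)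

theory Defs
  imports Complex_Main "HOL-Library.Extended_Nat"
begin

section \<open>Graphs\<close>

record 'a graph =
  verts :: "'a set"
  edges :: "'a set set"

definition simple_graph :: "'a graph \<Rightarrow> bool" where
  "simple_graph G \<longleftrightarrow>
     (\<forall>e\<in>edges G. \<exists>u v. u \<in> verts G \<and> v \<in> verts G \<and> u \<noteq> v \<and> e = {u, v})"

definition adj :: "'a graph \<Rightarrow> 'a \<Rightarrow> 'a \<Rightarrow> bool" where
  "adj G u v \<longleftrightarrow> {u, v} \<in> edges G"

definition locally_finite :: "'a graph \<Rightarrow> bool" where
  "locally_finite G \<longleftrightarrow> (\<forall>v\<in>verts G. finite {u \<in> verts G. adj G v u})"

definition induced :: "'a graph \<Rightarrow> 'a set \<Rightarrow> 'a graph" where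
  "induced G U = \<lparr>verts = verts G \<inter> U, edges = {e \<in> edges G. e \<subseteq> U}\<rparr>"

definition is_path :: "'a graph \<Rightarrow> 'a list \<Rightarrow> bool" where
  "is_path G p \<longleftrightarrow> p \<noteq> [] \<and> distinct p \<and> set p \<subseteq> verts G \<and> successively (adj G) p"

definition linked :: "'a graph \<Rightarrow> 'a \<Rightarrow> 'a \<Rightarrow> bool" where
  "linked G u v \<longleftrightarrow> (\<exists>p. is_path G p \<and> hd p = u \<and> last p = v)"

definition connected_graph :: "'a graph \<Rightarrow> bool" where
  "connected_graph G \<longleftrightarrow> verts G \<noteq> {} \<and> (\<forall>u\<in>verts G. \<forall>v\<in>verts G. linked G u v)"

definition is_tree :: "'a graph \<Rightarrow> bool" where
  "is_tree T \<longleftrightarrow> simple_graph T \<and> connected_graph T \<and>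
     (\<nexists>c. is_path T c \<and> 3 \<le> length c \<and> adj T (last c) (hd c))"

text \<open>Components are represented by their vertex sets.\<close>

definition component_of :: "'a graph \<Rightarrow> 'a \<Rightarrow> 'a set" where
  "component_of G v = {w \<in> verts G. linked G v w}"

definition components :: "'a graph \<Rightarrow> 'a set set" where
  "components G = component_of G ` verts G"

definition nbhd :: "'a graph \<Rightarrow> 'a set \<Rightarrow> 'a set" where
  "nbhd G K = {v \<in> verts G - K. \<exists>u\<in>K. adj G u v}"

text \<open>Cardinality with infinite sets sent to \<open>\<infinity>\<close> (\<^const>\<open>card\<close> would send them to 0).\<close>

definition ecard :: "'b set \<Rightarrow> enat" where
  "ecard S = (if finite S then enat (card S) else \<infinity>)"


section \<open>Separations\<close>

type_synonym 'a osep = "'a set \<times> 'a set"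
type_synonym 'a sep = "'a set set"

definition is_osep :: "'a graph \<Rightarrow> 'a osep \<Rightarrow> bool" where
  "is_osep G = (\<lambda>(A, B). A \<union> B = verts G \<and> (\<forall>u\<in>A - B. \<forall>v\<in>B - A. \<not> adj G u v))"

definition unor :: "'a osep \<Rightarrow> 'a sep" where
  "unor = (\<lambda>(A, B). {A, B})"

definition is_sep :: "'a graph \<Rightarrow> 'a sep \<Rightarrow> bool" where
  "is_sep G s \<longleftrightarrow> (\<exists>p. is_osep G p \<and> s = unor p)"

text \<open>For \<open>s = {A, B}\<close> the separator \<open>A \<inter> B\<close> is \<open>\<Inter>s\<close>.\<close>

definition sep_order :: "'a sep \<Rightarrow> enat" where
  "sep_order s = ecard (\<Inter>s)"

definition sep_ge :: "'a osep \<Rightarrow> 'a osep \<Rightarrow> bool" where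
  "sep_ge = (\<lambda>(A, B) (C, D). A \<subseteq> C \<and> B \<supseteq> D)"

definition nested :: "'a sep \<Rightarrow> 'a sep \<Rightarrow> bool" where
  "nested s s' \<longleftrightarrow> (\<exists>p q. s = unor p \<and> s' = unor q \<and> (sep_ge p q \<or> sep_ge q p))"

abbreviation crosses :: "'a sep \<Rightarrow> 'a sep \<Rightarrow> bool" where
  "crosses s s' \<equiv> \<not> nested s s'"

definition tight_component :: "'a graph \<Rightarrow> 'a set \<Rightarrow> 'a set \<Rightarrow> bool" where
  "tight_component G X K \<longleftrightarrow> K \<in> components (induced G (verts G - X)) \<and> nbhd G K = X"

definition tight :: "'a graph \<Rightarrow> 'a sep \<Rightarrow> bool" where
  "tight G s \<longleftrightarrow> (\<exists>A B. s = {A, B} \<and>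
     (\<exists>K. tight_component G (A \<inter> B) K \<and> K \<subseteq> A) \<and>
     (\<exists>L. tight_component G (A \<inter> B) L \<and> L \<subseteq> B))"


section \<open>Bottlenecks\<close>

definition top_star :: "'a graph \<Rightarrow> 'a osep \<Rightarrow> 'a osep \<Rightarrow> 'a osep \<Rightarrow> bool" where
  "top_star G = (\<lambda>(A1, B1) (A2, B2) (A3, B3).
     let X1 = A1 \<inter> B1; X2 = A2 \<inter> B2; X3 = A3 \<inter> B3 in
       is_osep G (A1, B1) \<and> is_osep G (A2, B2) \<and> is_osep G (A3, B3) \<and>
       distinct [(A1, B1), (A2, B2), (A3, B3)] \<and>
       (A1 - B1) \<inter> (A2 - B2) = {} \<and> (A1 - B1) \<inter> (A3 - B3) = {} \<and>
       (A2 - B2) \<inter> (A3 - B3) = {} \<and>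
       (A1 - B1) \<union> (A2 - B2) \<union> (A3 - B3) = verts G - (X1 \<union> X2 \<union> X3) \<and>
       X1 \<subseteq> X2 \<union> X3 \<and> X2 \<subseteq> X1 \<union> X3 \<and> X3 \<subseteq> X1 \<union> X2)"

text \<open>\<open>star_attached G x Y Z W\<close> is the condition on \<open>x \<in> X\<^sub>2\<^sub>3\<close> and \<open>i \<in> {2, 3}\<close>, where
  \<open>Y = X\<^sub>1\<^sub>i\<close>, \<open>Z\<close> is the centre and \<open>W = A\<^sub>i - B\<^sub>i\<close>.\<close>

definition star_attached ::
  "'a graph \<Rightarrow> 'a \<Rightarrow> 'a set \<Rightarrow> 'a set \<Rightarrow> 'a set \<Rightarrow> bool" where
  "star_attached G x Y Z W \<longleftrightarrow>
     (\<exists>y\<in>Y. adj G x y) \<or>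
     (\<exists>y\<in>Y \<union> Z. \<exists>K\<in>components (induced G W). x \<in> nbhd G K \<and> y \<in> nbhd G K)"

text \<open>The first of the three oriented separations gives the base.\<close>

definition relevant_top_star :: "'a graph \<Rightarrow> 'a osep \<Rightarrow> 'a osep \<Rightarrow> 'a osep \<Rightarrow> bool" where
  "relevant_top_star G = (\<lambda>(A1, B1) (A2, B2) (A3, B3).
     top_star G (A1, B1) (A2, B2) (A3, B3) \<and> tight G {A1, B1} \<and>
     (let X1 = A1 \<inter> B1; X2 = A2 \<inter> B2; X3 = A3 \<inter> B3;
          Z = X1 \<inter> X2 \<inter> X3;
          X12 = (X1 \<inter> X2) - Z; X13 = (X1 \<inter> X3) - Z; X23 = (X2 \<inter> X3) - Z
      in \<forall>x\<in>X23. star_attached G x X12 Z (A2 - B2) \<and> star_attached G x X13 Z (A3 - B3)))"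

text \<open>``Another constituent'' means the separation underlying another of the three oriented
  separations. As the star \<open>(A, B), (B, A), (\<emptyset>, V)\<close> is always relevant with base \<open>{A, B}\<close>
  when \<open>{A, B}\<close> is tight, insisting on a separation different from \<open>{A, B}\<close> would leave no
  bottlenecks at all.\<close>

definition bottleneck :: "'a graph \<Rightarrow> nat \<Rightarrow> 'a sep set \<Rightarrow> bool" where
  "bottleneck G k \<beta> \<longleftrightarrow> \<beta> \<noteq> {} \<and>
     (\<forall>s\<in>\<beta>. is_sep G s \<and> tight G s \<and> sep_order s = enat k) \<and>
     (\<forall>p1 p2 p3. relevant_top_star G p1 p2 p3 \<and>
        (\<forall>p\<in>{p1, p2, p3}. sep_order (unor p) \<le> enat k) \<and> unor p1 \<in> \<beta>
        \<longrightarrow> unor p2 \<in> \<beta> \<or> unor p3 \<in> \<beta>)"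

definition bottlenecks :: "'a graph \<Rightarrow> nat \<Rightarrow> 'a sep set set" where
  "bottlenecks G k = {\<beta>. bottleneck G k \<beta>}"

definition crossing_number :: "'a graph \<Rightarrow> nat \<Rightarrow> 'a sep \<Rightarrow> enat" where
  "crossing_number G k s = ecard {s' \<in> \<Union>(bottlenecks G k). crosses s' s}"

text \<open>\<open>select G k M \<beta>\<close> is \<open>N\<^sup>k(G, \<beta>)\<close> when \<open>M = N\<^sup><\<^sup>k(G)\<close>.\<close>

definition select :: "'a graph \<Rightarrow> nat \<Rightarrow> 'a sep set \<Rightarrow> 'a sep set \<Rightarrow> 'a sep set" where
  "select G k M \<beta> =
     (let C = {s \<in> \<beta>. \<forall>s'\<in>M. nested s s'}
      in {s \<in> C. \<forall>s'\<in>C. crossing_number G k s \<le> crossing_number G k s'})"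

context
  notes image_cong [fundef_cong]
begin

fun N_level :: "'a graph \<Rightarrow> nat \<Rightarrow> 'a sep set" where
  "N_level G k = (\<Union>\<beta>\<in>bottlenecks G k. select G k (\<Union>j\<in>{..<k}. N_level G j) \<beta>)"

end

text \<open>The defining equation loops as a rewrite rule.\<close>

declare N_level.simps [simp del]

definition N_upto :: "'a graph \<Rightarrow> nat \<Rightarrow> 'a sep set" where
  "N_upto G k = (\<Union>j\<in>{..k}. N_level G j)"


section \<open>Tree-decompositions\<close>

text \<open>The edges of the decomposition tree are kept abstract, so that separations themselves can
  serve as edges; \<open>joins D e t u\<close> says that the edge \<open>e\<close> joins the nodes \<open>t\<close> and \<open>u\<close>.\<close>

record ('t, 'e, 'a) decomp =
  nodes :: "'t set"
  links :: "'e set"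
  joins :: "'e \<Rightarrow> 't \<Rightarrow> 't \<Rightarrow> bool"
  part :: "'t \<Rightarrow> 'a graph"

definition decomp_graph :: "('t, 'e, 'a) decomp \<Rightarrow> 't graph" where
  "decomp_graph D =
     \<lparr>verts = nodes D, edges = {{t, u} |t u. \<exists>e\<in>links D. joins D e t u}\<rparr>"

text \<open>Every abstract edge has a well-defined pair of ends, and there are no parallel edges;
  hence the abstract edges correspond bijectively to the edges of \<^const>\<open>decomp_graph\<close>.\<close>

definition links_ok :: "('t, 'e, 'a) decomp \<Rightarrow> bool" where
  "links_ok D \<longleftrightarrow>
     (\<forall>e\<in>links D. \<exists>t\<in>nodes D. \<exists>u\<in>nodes D. t \<noteq> u \<and> joins D e t u \<and>
        (\<forall>t' u'. joins D e t' u' \<longrightarrow> {t', u'} = {t, u})) \<and>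
     (\<forall>e\<in>links D. \<forall>f\<in>links D. \<forall>t u. joins D e t u \<and> joins D f t u \<longrightarrow> e = f)"

definition tree_decomposition :: "'a graph \<Rightarrow> ('t, 'e, 'a) decomp \<Rightarrow> bool" where
  "tree_decomposition G D \<longleftrightarrow>
     links_ok D \<and> is_tree (decomp_graph D) \<and>
     (\<forall>t\<in>nodes D. \<exists>U\<subseteq>verts G. part D t = induced G U) \<and>
     (\<Union>t\<in>nodes D. verts (part D t)) = verts G \<and>
     (\<Union>t\<in>nodes D. edges (part D t)) = edges G \<and>
     (\<forall>p. is_path (decomp_graph D) p \<longrightarrow>
        (\<forall>t\<in>set p. verts (part D (hd p)) \<inter> verts (part D (last p)) \<subseteq> verts (part D t)))"

definition cut_side :: "('t, 'e, 'a) decomp \<Rightarrow> 't \<Rightarrow> 't \<Rightarrow> 'a set" where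
  "cut_side D t u =
     (let T = decomp_graph D; T' = T\<lparr>edges := edges T - {{t, u}}\<rparr>
      in \<Union>w\<in>component_of T' t. verts (part D w))"

definition induced_seps :: "('t, 'e, 'a) decomp \<Rightarrow> 'a sep set" where
  "induced_seps D = {{cut_side D t u, cut_side D u t} |t u. \<exists>e\<in>links D. joins D e t u}"

definition is_star :: "'a osep set \<Rightarrow> bool" where
  "is_star \<sigma> \<longleftrightarrow> (\<forall>(A, B)\<in>\<sigma>. \<forall>(C, D)\<in>\<sigma>. (A, B) \<noteq> (C, D) \<longrightarrow> sep_ge (A, B) (D, C))"

definition splitting_star :: "'a sep set \<Rightarrow> 'a osep set \<Rightarrow> bool" where
  "splitting_star N \<sigma> \<longleftrightarrow> is_star \<sigma> \<and>
     (\<forall>(A, B)\<in>\<sigma>. {A, B} \<in> N \<and> (B, A) \<notin> \<sigma>) \<and>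
     (\<forall>s\<in>N. \<exists>C D. s = {C, D} \<and> (\<exists>p\<in>\<sigma>. sep_ge (C, D) p))"

text \<open>\<open>\<T>(N)\<close>. The vertex set of a part is intersected with \<open>V(G)\<close> by \<^const>\<open>induced\<close>, so that
  the empty splitting star (the only node if \<open>N = \<emptyset>\<close>) has part \<open>G\<close>.\<close>

definition tree_of :: "'a graph \<Rightarrow> 'a sep set \<Rightarrow> ('a osep set, 'a sep, 'a) decomp" where
  "tree_of G N =
     \<lparr>nodes = {\<sigma>. splitting_star N \<sigma>},
      links = N,
      joins = (\<lambda>s t1 t2. splitting_star N t1 \<and> splitting_star N t2 \<and>
                 (\<exists>A B. s = {A, B} \<and> (A, B) \<in> t1 \<and> (B, A) \<in> t2)),
      part = (\<lambda>t. induced G (\<Inter>(A, B)\<in>t. B))\<rparr>"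


section \<open>Tangles\<close>

definition orientation_of :: "'a sep set \<Rightarrow> 'a osep set \<Rightarrow> bool" where
  "orientation_of S \<tau> \<longleftrightarrow> (\<forall>p\<in>\<tau>. unor p \<in> S) \<and>
     (\<forall>A B. {A, B} \<in> S \<longrightarrow> (A, B) \<in> \<tau> \<or> (B, A) \<in> \<tau>) \<and>
     (\<forall>A B. A \<noteq> B \<longrightarrow> \<not> ((A, B) \<in> \<tau> \<and> (B, A) \<in> \<tau>))"

text \<open>In a tangle \<open>\<tau>\<close>, \<open>(A, B) \<in> \<tau>\<close> means that \<open>A\<close> is the small side:
  no three small sides satisfy \<open>G[A\<^sub>1] \<union> G[A\<^sub>2] \<union> G[A\<^sub>3] = G\<close>.\<close>

definition tangle_of_order :: "'a graph \<Rightarrow> nat \<Rightarrow> 'a osep set \<Rightarrow> bool" where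
  "tangle_of_order G n \<tau> \<longleftrightarrow>
     orientation_of {s. is_sep G s \<and> sep_order s < enat n} \<tau> \<and>
     (\<forall>(A1, B1)\<in>\<tau>. \<forall>(A2, B2)\<in>\<tau>. \<forall>(A3, B3)\<in>\<tau>.
        \<not> (verts (induced G A1) \<union> verts (induced G A2) \<union> verts (induced G A3) = verts G \<and>
           edges (induced G A1) \<union> edges (induced G A2) \<union> edges (induced G A3) = edges G))"

definition is_tangle :: "'a graph \<Rightarrow> 'a osep set \<Rightarrow> bool" where
  "is_tangle G \<tau> \<longleftrightarrow> (\<exists>n. tangle_of_order G n \<tau>)"

definition distinguishes :: "'a sep \<Rightarrow> 'a osep set \<Rightarrow> 'a osep set \<Rightarrow> bool" where
  "distinguishes s \<tau> \<tau>' \<longleftrightarrow> (\<exists>A B. s = {A, B} \<and> A \<noteq> B \<and> (A, B) \<in> \<tau> \<and> (B, A) \<in> \<tau>')"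

definition distinguishes_efficiently :: "'a sep \<Rightarrow> 'a osep set \<Rightarrow> 'a osep set \<Rightarrow> bool" where
  "distinguishes_efficiently s \<tau> \<tau>' \<longleftrightarrow> distinguishes s \<tau> \<tau>' \<and>
     (\<forall>s'. distinguishes s' \<tau> \<tau>' \<longrightarrow> sep_order s \<le> sep_order s')"

definition distinguishable_upto :: "nat \<Rightarrow> 'a osep set \<Rightarrow> 'a osep set \<Rightarrow> bool" where
  "distinguishable_upto k \<tau> \<tau>' \<longleftrightarrow> (\<exists>s. sep_order s \<le> enat k \<and> distinguishes s \<tau> \<tau>')"

definition tree_of_tangles :: "'a graph \<Rightarrow> nat \<Rightarrow> ('t, 'e, 'a) decomp \<Rightarrow> bool" where
  "tree_of_tangles G k D \<longleftrightarrow> tree_decomposition G D \<and>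
     (\<forall>\<tau> \<tau>'. is_tangle G \<tau> \<and> is_tangle G \<tau>' \<and> distinguishable_upto k \<tau> \<tau>' \<longrightarrow>
        (\<exists>s\<in>induced_seps D. distinguishes_efficiently s \<tau> \<tau>'))"

end

theory Submission
  imports Defs
begin

text \<open>
  If two tight separations cross, then cutting either of them along the other gives a relevant
  \<open>\<top>\<close>-star. Hence, by submodularity, for a separation \<open>s\<close> in a \<open>k\<close>-bottleneck crossing a separation
  \<open>t\<close> in an \<open>l\<close>-bottleneck with \<open>l < k\<close>, some corner of \<open>s\<close> and \<open>t\<close> lies in the bottleneck of \<open>s\<close>;
  so every bottleneck has an element nested with all lower levels. If \<open>l = k\<close>, suitable opposite
  corners lie in the two bottlenecks, and together they are crossed strictly less often than \<open>s\<close>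
  and \<open>t\<close>, which makes the selected separations nested. Local finiteness enters through Halin's
  observation that only finitely many minimal separators of bounded size separate two given
  vertices: crossing numbers are finite, and two vertices are separated by finitely many selected
  separations, so the splitting stars form a tree and every edge of \<open>G\<close> lies in a part.
  Finally, the separations that efficiently distinguish two given tangles form a bottleneck.
\<close>

section \<open>Reachability and components\<close>

text \<open>A bottleneck only reacts to relevant stars, so relevance has to be produced from
  crossing alone. Connectedness does this: if a tight component of one separation failed to attach,
  the separator of that separation would lie strictly on one side of the other, and the two would be
  nested. At equal order one opposite pair of corners need not suffice. If all corners have order
  \<open>k\<close>, one bottleneck may hold one opposite pair and the other bottleneck the other
  pair; then the crossing inequalities of both pairs are added. A node of the tree is handled
  through the orientation of all of \<open>N\<close> that it generates, with the star as its set of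
  maximal elements. Crossing an edge reverses exactly one separation, so acyclicity, the path axiom
  and the induced separations reduce to following one bit along a path. For tangles the hard point
  is tightness. Local finiteness enters there once more: the components on one side are absorbed
  into a small side one at a time, which needs them to be finite in number.\<close>

lemma adj_sym: "adj G u v \<longleftrightarrow> adj G v u"
  by (simp add: adj_def insert_commute)

lemma simple_graph_adjD:
  assumes "simple_graph G" "adj G u v"
  shows "u \<in> verts G" "v \<in> verts G" "u \<noteq> v"
  using assms unfolding simple_graph_def adj_def by (auto simp: doubleton_eq_iff dest!: bspec)

lemma successively_imp_rtranclp:
  assumes "successively (adj G) p" "p \<noteq> []" "set p \<subseteq> verts G"
  shows "(\<lambda>x y. y \<in> verts G \<and> adj G x y)\<^sup>*\<^sup>* (hd p) (last p)"
  using assms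
proof (induction p rule: induct_list012)
  case (3 x y zs)
  then have "(\<lambda>x y. y \<in> verts G \<and> adj G x y)\<^sup>*\<^sup>* y (last (y # zs))" by simp
  moreover have "y \<in> verts G \<and> adj G x y" using 3 by simp
  ultimately show ?case by (simp add: converse_rtranclp_into_rtranclp)
qed auto

lemma rtranclp_imp_linked:
  assumes "(\<lambda>x y. y \<in> verts G \<and> adj G x y)\<^sup>*\<^sup>* u v" "u \<in> verts G"
  shows "linked G u v"
  using assms
proof (induction rule: rtranclp_induct)
  case base
  then have "is_path G [u]" by (simp add: is_path_def)
  then show ?case unfolding linked_def by force
next
  case (step y z)
  then obtain p where p: "is_path G p" "hd p = u" "last p = y" by (auto simp: linked_def)
  show ?case
  proof (cases "z \<in> set p")
    \<comment> \<open>\<open>is_path\<close> demands distinct vertices, so when \<open>z\<close> is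
      already on the path, the path is truncated there.\<close>
    case True
    then obtain xs ys where s: "p = xs @ z # ys" by (meson split_list)
    have "is_path G (xs @ [z])" using p(1) unfolding is_path_def s
      by (auto simp: successively_append_iff)
    moreover have "hd (xs @ [z]) = u" using p(2) s by (cases xs) auto
    ultimately show ?thesis unfolding linked_def by force
  next
    case False
    then have "is_path G (p @ [z])" using p step.hyps unfolding is_path_def
      by (auto simp: successively_append_iff)
    moreover have "hd (p @ [z]) = u" using p by (auto simp: is_path_def)
    ultimately show ?thesis unfolding linked_def by force
  qed
qed

text \<open>Trades lists for a reflexive transitive closure, so that transitivity, symmetry and
  invariants become inductions. The relation checks only its target for membership in the graph,
  hence the separate clause for \<open>u\<close>.\<close>

lemma linked_iff_rtranclp:
  "linked G u v \<longleftrightarrow> u \<in> verts G \<and> (\<lambda>x y. y \<in> verts G \<and> adj G x y)\<^sup>*\<^sup>* u v"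
proof
  assume "linked G u v"
  then obtain p where "is_path G p" "hd p = u" "last p = v" by (auto simp: linked_def)
  then show "u \<in> verts G \<and> (\<lambda>x y. y \<in> verts G \<and> adj G x y)\<^sup>*\<^sup>* u v"
    using successively_imp_rtranclp[of G p] by (auto simp: is_path_def)
qed (auto intro: rtranclp_imp_linked)

lemma linked_refl: "u \<in> verts G \<Longrightarrow> linked G u u"
  by (simp add: linked_iff_rtranclp)

lemma linked_trans: "linked G u v \<Longrightarrow> linked G v w \<Longrightarrow> linked G u w"
  unfolding linked_iff_rtranclp by (meson rtranclp_trans)

lemma linked_step: "linked G u v \<Longrightarrow> w \<in> verts G \<Longrightarrow> adj G v w \<Longrightarrow> linked G u w"
  unfolding linked_iff_rtranclp by (metis (mono_tags, lifting) rtranclp.rtrancl_into_rtrancl)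

lemma linked_verts: "linked G u v \<Longrightarrow> u \<in> verts G \<and> v \<in> verts G"
  unfolding linked_def is_path_def by auto

lemma linked_sym:
  assumes "linked G u v" shows "linked G v u"
proof -
  have u: "u \<in> verts G" and r: "(\<lambda>x y. y \<in> verts G \<and> adj G x y)\<^sup>*\<^sup>* u v"
    using assms by (auto simp: linked_iff_rtranclp)
  from r show ?thesis
  proof (induction rule: rtranclp_induct)
    case base
    then show ?case using u by (rule linked_refl)
  next
    case (step y z)
    then have "linked G z y"
      using linked_verts[OF step.IH] linked_step[OF linked_refl, of z G y] adj_sym[of G y z] by blast
    then show ?case using step.IH linked_trans by metis
  qed
qed

text \<open>The invariant principle behind most connectivity arguments below: instead of following a
  path, one exhibits a set that no edge leaves.\<close>

lemma linked_closed_set: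
  assumes "linked G u v" "u \<in> S"
    and "\<And>x y. x \<in> S \<Longrightarrow> y \<in> verts G \<Longrightarrow> adj G x y \<Longrightarrow> y \<in> S"
  shows "v \<in> S"
proof -
  have "(\<lambda>x y. y \<in> verts G \<and> adj G x y)\<^sup>*\<^sup>* u v" using assms(1) by (simp add: linked_iff_rtranclp)
  then show ?thesis by (induction rule: rtranclp_induct) (use assms in auto)
qed

lemma connected_graph_closed_set:
  assumes "connected_graph G" "S \<inter> verts G \<noteq> {}"
    and "\<And>x y. x \<in> S \<Longrightarrow> y \<in> verts G \<Longrightarrow> adj G x y \<Longrightarrow> y \<in> S"
  shows "verts G \<subseteq> S"
  using assms linked_closed_set[of G _ _ S] unfolding connected_graph_def by blast

lemma verts_induced [simp]: "verts (induced G U) = verts G \<inter> U"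
  by (simp add: induced_def)

lemma adj_induced [simp]: "adj (induced G U) u v \<longleftrightarrow> adj G u v \<and> u \<in> U \<and> v \<in> U"
  by (auto simp: induced_def adj_def)

lemma in_some_component:
  assumes "x \<in> verts G" shows "component_of G x \<in> components G" "x \<in> component_of G x"
  using assms linked_refl[of x G] by (auto simp: components_def component_of_def)

lemma component_nonempty: "K \<in> components G \<Longrightarrow> K \<noteq> {}"
  using in_some_component(2)[of _ G] by (auto simp: components_def)

lemma component_subset: "K \<in> components G \<Longrightarrow> K \<subseteq> verts G"
  by (auto simp: components_def component_of_def)

lemma component_adj_closed:
  "K \<in> components G \<Longrightarrow> x \<in> K \<Longrightarrow> y \<in> verts G \<Longrightarrow> adj G x y \<Longrightarrow> y \<in> K"
  by (auto simp: components_def component_of_def intro: linked_step)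

lemma component_connected:
  assumes K: "K \<in> components G" and x: "x \<in> K" "x \<in> S"
    and cl: "\<And>x y. x \<in> K \<Longrightarrow> x \<in> S \<Longrightarrow> y \<in> K \<Longrightarrow> adj G x y \<Longrightarrow> y \<in> S"
  shows "K \<subseteq> S"
proof
  fix w assume w: "w \<in> K"
  obtain v where v: "K = component_of G v" using K by (auto simp: components_def)
  have "linked G x w" using x(1) w unfolding v component_of_def
    by (auto intro: linked_trans linked_sym)
  then have "w \<in> K \<inter> S"
    by (rule linked_closed_set) (use x cl component_adj_closed[OF K] in auto)
  then show "w \<in> S" by simp
qed

lemma component_linked:
  assumes "K \<in> components G" "x \<in> K" "y \<in> K" shows "linked G x y"
  using assms by (auto simp: components_def component_of_def intro: linked_trans linked_sym)

section \<open>Tight separations\<close>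

lemma is_osep_swap: "is_osep G (A, B) \<longleftrightarrow> is_osep G (B, A)"
  using adj_sym[of G] unfolding is_osep_def by blast

lemma is_osepI:
  assumes "A \<union> B = verts G" "\<And>u v. u \<in> A - B \<Longrightarrow> v \<in> B - A \<Longrightarrow> \<not> adj G u v"
  shows "is_osep G (A, B)"
  using assms by (simp add: is_osep_def)

lemma is_osepD:
  assumes "is_osep G (A, B)"
  shows "A \<union> B = verts G"
    and "\<And>u v. u \<in> A \<Longrightarrow> u \<notin> B \<Longrightarrow> v \<in> verts G \<Longrightarrow> adj G u v \<Longrightarrow> v \<in> A"
    and "\<And>u v. u \<in> B \<Longrightarrow> u \<notin> A \<Longrightarrow> v \<in> verts G \<Longrightarrow> adj G u v \<Longrightarrow> v \<in> B"
  using assms adj_sym[of G] unfolding is_osep_def by blast+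

lemma is_osep_corner:
  assumes "is_osep G (A, B)" "is_osep G (C, D)"
  shows "is_osep G (A \<inter> C, B \<union> D)"
proof -
  have "A \<inter> C \<union> (B \<union> D) = verts G"
    using assms unfolding is_osep_def by blast
  moreover have "\<not> adj G u v" if "u \<in> A \<inter> C - (B \<union> D)" "v \<in> B \<union> D - A \<inter> C" for u v
    using assms that unfolding is_osep_def by blast
  ultimately show ?thesis unfolding is_osep_def by blast
qed

lemma is_sep_doubleton: "is_sep G {A, B} \<longleftrightarrow> is_osep G (A, B)"
  using is_osep_swap[of G A B]
  by (auto simp: is_sep_def unor_def doubleton_eq_iff)

text \<open>Swapping both orientations reverses the order, so the eight possible comparisons
  collapse to these four. Nestedness arguments thereby become case checks on inclusions.\<close>

lemma nested_doubleton:
  "nested {E, F} {A, B} \<longleftrightarrow>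
     E \<subseteq> A \<and> B \<subseteq> F \<or> E \<subseteq> B \<and> A \<subseteq> F \<or> F \<subseteq> A \<and> B \<subseteq> E \<or> F \<subseteq> B \<and> A \<subseteq> E"
  (is "?l = ?r")
proof
  assume ?l
  then show ?r unfolding nested_def unor_def sep_ge_def
    by (auto simp: doubleton_eq_iff)
next
  have n: "nested s s'" if "s = unor p" "s' = unor q" "sep_ge p q" for s s' :: "'a sep" and p q
    using that unfolding nested_def by blast
  assume ?r
  then show ?l
    using n[of "{E,F}" "(E,F)" "{A,B}" "(A,B)"] n[of "{E,F}" "(E,F)" "{A,B}" "(B,A)"]
      n[of "{E,F}" "(F,E)" "{A,B}" "(A,B)"] n[of "{E,F}" "(F,E)" "{A,B}" "(B,A)"]
    unfolding unor_def sep_ge_def prod.case by (metis insert_commute)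
qed

lemma nested_sym: "nested s t \<longleftrightarrow> nested t s"
  by (auto simp: nested_def)

lemma tight_doubleton:
  "tight G {A, B} \<longleftrightarrow> (\<exists>K. tight_component G (A \<inter> B) K \<and> K \<subseteq> A) \<and>
     (\<exists>L. tight_component G (A \<inter> B) L \<and> L \<subseteq> B)"
  unfolding tight_def by (auto simp: doubleton_eq_iff Int_commute)

lemma tight_component_facts:
  assumes "tight_component G X K"
  shows "K \<noteq> {}" "K \<subseteq> verts G" "K \<inter> X = {}" "nbhd G K = X"
    "\<And>x. x \<in> X \<Longrightarrow> x \<in> verts G \<and> (\<exists>u\<in>K. adj G u x)"
  using assms component_nonempty component_subset
  by (fastforce simp: tight_component_def nbhd_def)+

lemma tight_sides_nonempty:
  assumes "tight G {A, B}" shows "A - B \<noteq> {}" "B - A \<noteq> {}"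
proof -
  obtain K L where "tight_component G (A \<inter> B) K" "K \<subseteq> A" "tight_component G (A \<inter> B) L" "L \<subseteq> B"
    using assms unfolding tight_doubleton by blast
  then show "A - B \<noteq> {}" "B - A \<noteq> {}"
    using tight_component_facts(1,3)[of G "A \<inter> B" K] tight_component_facts(1,3)[of G "A \<inter> B" L]
    by blast+
qed

lemma component_one_side:
  assumes s: "is_osep G (C, D)" and K: "K \<in> components (induced G U)" "K \<inter> (C \<inter> D) = {}"
  shows "K \<subseteq> C - D \<or> K \<subseteq> D - C"
proof -
  obtain x where x: "x \<in> K" using component_nonempty[OF K(1)] by auto
  have V: "K \<subseteq> verts G" using component_subset[OF K(1)] by auto
  have "K \<subseteq> C - D" if "x \<in> C - D"
  proof (rule component_connected[OF K(1) x that])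
    fix u y assume "u \<in> K" "u \<in> C - D" "y \<in> K" "adj (induced G U) u y"
    then show "y \<in> C - D" using is_osepD(2)[OF s, of u y] K(2) V by auto
  qed
  moreover have "K \<subseteq> D - C" if "x \<in> D - C"
  proof (rule component_connected[OF K(1) x that])
    fix u y assume "u \<in> K" "u \<in> D - C" "y \<in> K" "adj (induced G U) u y"
    then show "y \<in> D - C" using is_osepD(3)[OF s, of u y] K(2) V by auto
  qed
  ultimately show ?thesis using x V K(2) is_osepD(1)[OF s] by blast
qed

text \<open>The tight component \<open>K\<close> in \<open>A\<close> has all of
  \<open>A \<inter> B\<close> as its neighbourhood, so it drags the separator to its own side of
  \<open>{C, D}\<close>. What remains of \<open>A\<close> on the other side then has no edge leaving
  it, and connectedness of \<open>G\<close> empties it.\<close>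

lemma tight_side_avoiding_separator:
  assumes G: "connected_graph G" and s: "is_osep G (A, B)" "tight G {A, B}"
    and t: "is_osep G (C, D)" and av: "A \<inter> (C \<inter> D) = {}"
  shows "A \<subseteq> C - D \<or> A \<subseteq> D - C"
proof -
  obtain K where K: "tight_component G (A \<inter> B) K" "K \<subseteq> A"
    using s(2) by (auto simp: tight_doubleton)
  have main: "A \<subseteq> C - D" if t: "is_osep G (C, D)" and av: "A \<inter> (C \<inter> D) = {}" and KC: "K \<subseteq> C - D"
    for C D
  proof -
    have X: "A \<inter> B \<subseteq> C - D"
    proof
      fix x assume x: "x \<in> A \<inter> B"
      obtain u where "u \<in> K" "adj G u x" "x \<in> verts G" using tight_component_facts(5)[OF K(1) x] by auto
      then have "x \<in> C" using is_osepD(2)[OF t, of u x] KC by auto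
      then show "x \<in> C - D" using av x by auto
    qed
    have "A \<inter> D = {}"
    proof (rule ccontr)
      assume "A \<inter> D \<noteq> {}"
      then have ne: "A \<inter> D \<inter> verts G \<noteq> {}" using is_osepD(1)[OF s(1)] by auto
      \<comment> \<open>Leaving \<open>A\<close> needs a vertex of \<open>A \<inter> B\<close>, and
        leaving \<open>D\<close> needs a vertex of \<open>C \<inter> D\<close>; neither kind occurs
        in \<open>A \<inter> D\<close>.\<close>
      have "verts G \<subseteq> A \<inter> D"
      proof (rule connected_graph_closed_set[OF G ne])
        fix x y assume "x \<in> A \<inter> D" "y \<in> verts G" "adj G x y"
        then show "y \<in> A \<inter> D"
          using is_osepD(2)[OF s(1), of x y] is_osepD(3)[OF t, of x y] av X by auto
      qed
      then show False using tight_sides_nonempty[OF s(2)] is_osepD(1)[OF s(1)] by auto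
    qed
    then show ?thesis using is_osepD(1)[OF t] is_osepD(1)[OF s(1)] by auto
  qed
  have "K \<subseteq> C - D \<or> K \<subseteq> D - C"
    using component_one_side[OF t, of K "verts G - A \<inter> B"] K av by (auto simp: tight_component_def)
  then show ?thesis using main[OF t av] main[of D C] t av is_osep_swap[of G C D] by blast
qed

corollary tight_side_avoiding_separator_nested:
  assumes "connected_graph G" "is_osep G (A, B)" "tight G {A, B}" "is_osep G (C, D)"
    and "A \<inter> (C \<inter> D) = {}"
  shows "nested {A, B} {C, D}"
  using tight_side_avoiding_separator[OF assms] is_osepD(1)[OF assms(2)] is_osepD(1)[OF assms(4)]
  unfolding nested_doubleton by blast

text \<open>\<open>x\<close> has a neighbour \<open>k0\<close> in a tight component
  \<open>K'\<close> on the side \<open>C\<close>. Either \<open>k0\<close> lies in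
  \<open>A \<inter> B\<close> and gives the edge, or it lies in a component \<open>K\<close> of the
  corner. If \<open>K\<close> had no neighbour in \<open>A\<close>, then \<open>K'\<close> could not
  leave \<open>K\<close>, so \<open>C \<inter> D\<close>, being the neighbourhood of
  \<open>K'\<close>, would miss \<open>A\<close>; this forces nestedness.\<close>

lemma crossing_imp_star_attached:
  assumes G: "connected_graph G"
    and s: "is_osep G (A, B)" "tight G {A, B}" and t: "is_osep G (C, D)" "tight G {C, D}"
    and cr: "crosses {A, B} {C, D}" and x: "x \<in> C \<inter> D" "x \<in> B" "x \<notin> A"
  shows "star_attached G x (A \<inter> B \<inter> (C - D)) (A \<inter> B \<inter> (C \<inter> D)) ((B - A) \<inter> (C - D))"
proof (rule ccontr)
  assume no: "\<not> ?thesis"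
  let ?W = "(B - A) \<inter> (C - D)"
  obtain K' where K': "tight_component G (C \<inter> D) K'" "K' \<subseteq> C" using t(2) by (auto simp: tight_doubleton)
  note f = tight_component_facts[OF K'(1)]
  obtain k0 where k0: "k0 \<in> K'" "adj G k0 x" using f(5) x(1) by auto
  have VG: "verts G = A \<union> B" "verts G = C \<union> D" using is_osepD(1)[OF s(1)] is_osepD(1)[OF t(1)] by auto
  have k0V: "k0 \<in> verts G" "k0 \<in> C - D" using k0(1) f(2,3) K'(2) by auto
  have "k0 \<in> B" using is_osepD(3)[OF s(1) x(2,3) k0V(1)] k0(2) adj_sym[of G] by blast
  moreover have "k0 \<notin> A" using no k0 k0V \<open>k0 \<in> B\<close> adj_sym[of G] unfolding star_attached_def by blast
  ultimately have kW: "k0 \<in> ?W" using k0V by auto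
  define K where "K = component_of (induced G ?W) k0"
  have K: "K \<in> components (induced G ?W)" "k0 \<in> K"
    using in_some_component[of k0 "induced G ?W"] kW k0V(1) by (auto simp: K_def)
  have KW: "K \<subseteq> ?W" using component_subset[OF K(1)] by auto
  have xN: "x \<in> nbhd G K" using x k0 K KW VG unfolding nbhd_def by blast
  \<comment> \<open>A neighbour of \<open>K\<close> in \<open>A\<close> would lie in
    \<open>A \<inter> B \<inter> C\<close>, hence in the centre or in the link set of the star, and
    would attach \<open>x\<close> through \<open>K\<close>.\<close>
  have noX: "y \<notin> A" if "y \<in> verts G" "y \<notin> K" "u \<in> K" "adj G u y" for u y
  proof
    assume "y \<in> A"
    have "y \<in> B" "y \<in> C"
      using is_osepD(3)[OF s(1), of u y] is_osepD(2)[OF t(1), of u y] that KW by auto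
    moreover have "y \<in> nbhd G K" using that by (auto simp: nbhd_def)
    ultimately show False using no xN K(1) \<open>y \<in> A\<close> unfolding star_attached_def by blast
  qed
  have K'K: "K' \<subseteq> K"
  proof (rule component_connected[where G = "induced G (verts G - C \<inter> D)" and x = k0])
    show "K' \<in> components (induced G (verts G - C \<inter> D))" using K'(1) by (simp add: tight_component_def)
    fix u y assume a: "u \<in> K'" "u \<in> K" "y \<in> K'" "adj (induced G (verts G - C \<inter> D)) u y"
    show "y \<in> K"
    proof (rule ccontr)
      assume yK: "y \<notin> K"
      have yV: "y \<in> verts G" "adj G u y" using a by auto
      have "y \<notin> A" using noX[OF yV(1) yK a(2) yV(2)] .
      then have "y \<in> ?W" using VG yV a f(3) K'(2) by auto
      then show False using component_adj_closed[OF K(1) a(2), of y] a(2) KW yV yK by auto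
    qed
  qed (use k0 K in auto)
  have "A \<inter> (C \<inter> D) = {}"
  proof (rule ccontr)
    assume "A \<inter> (C \<inter> D) \<noteq> {}"
    then obtain y where y: "y \<in> A" "y \<in> C \<inter> D" by auto
    then obtain u where "u \<in> K'" "adj G u y" "y \<in> verts G" using f(5) by blast
    then show False using noX[of y u] K'K KW y by blast
  qed
  then show False using tight_side_avoiding_separator_nested[OF G s t(1)] cr by blast
qed

text \<open>\<open>{A, B}\<close> is kept and only its far side \<open>B\<close> is cut along
  \<open>{C, D}\<close>. Here \<open>X\<^sub>2\<^sub>3\<close> is the part of
  \<open>C \<inter> D\<close> in \<open>B - A\<close>, which is where
  \<open>crossing_imp_star_attached\<close> applies; exchanging \<open>C\<close> and
  \<open>D\<close> serves the second index.\<close>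

lemma relevant_top_star_corners:
  assumes G: "connected_graph G"
    and s: "is_osep G (A, B)" "tight G {A, B}" and t: "is_osep G (C, D)" "tight G {C, D}"
    and cr: "crosses {A, B} {C, D}"
  shows "relevant_top_star G (A, B) (B \<inter> C, A \<union> D) (B \<inter> D, A \<union> C)"
proof -
  have VG: "A \<union> B = verts G" "C \<union> D = verts G" using is_osepD(1)[OF s(1)] is_osepD(1)[OF t(1)] by auto
  have o: "is_osep G (B \<inter> C, A \<union> D)" "is_osep G (B \<inter> D, A \<union> C)"
    using is_osep_corner[of G B A] s(1) t(1) is_osep_swap[of G] by blast+
  have "(A, B) \<noteq> (B \<inter> C, A \<union> D)" "(A, B) \<noteq> (B \<inter> D, A \<union> C)"
    using tight_sides_nonempty[OF s(2)] by auto
  \<comment> \<open>The two corners coincide only if \<open>B\<close> lies inside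
    \<open>C \<inter> D\<close>. But then a vertex of \<open>B - A\<close> has a neighbour in a
    tight component of \<open>{C, D}\<close>, and this neighbour is in \<open>B\<close> yet outside
    \<open>C \<inter> D\<close>.\<close>
  moreover have "(B \<inter> C, A \<union> D) \<noteq> (B \<inter> D, A \<union> C)"
  proof
    assume e: "(B \<inter> C, A \<union> D) = (B \<inter> D, A \<union> C)"
    then have BY: "B \<subseteq> C \<inter> D" using VG by blast
    obtain x where x: "x \<in> B" "x \<notin> A" using tight_sides_nonempty[OF s(2)] by auto
    obtain K where K: "tight_component G (C \<inter> D) K" "K \<subseteq> C" using t(2) by (auto simp: tight_doubleton)
    obtain u where "u \<in> K" "adj G u x" using tight_component_facts(5)[OF K(1)] BY x by blast
    moreover have "u \<in> B"
      using is_osepD(3)[OF s(1) x, of u] calculation adj_sym[of G] tight_component_facts(2)[OF K(1)] by blast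
    ultimately show False using BY tight_component_facts(3)[OF K(1)] by blast
  qed
  moreover have "(A - B) \<inter> (B \<inter> C - (A \<union> D)) = {}" "(A - B) \<inter> (B \<inter> D - (A \<union> C)) = {}"
    "(B \<inter> C - (A \<union> D)) \<inter> (B \<inter> D - (A \<union> C)) = {}" by blast+
  moreover have "A - B \<union> (B \<inter> C - (A \<union> D)) \<union> (B \<inter> D - (A \<union> C)) =
      verts G - (A \<inter> B \<union> B \<inter> C \<inter> (A \<union> D) \<union> B \<inter> D \<inter> (A \<union> C))"
    "A \<inter> B \<subseteq> B \<inter> C \<inter> (A \<union> D) \<union> B \<inter> D \<inter> (A \<union> C)" using VG by blast+
  moreover have "B \<inter> C \<inter> (A \<union> D) \<subseteq> A \<inter> B \<union> B \<inter> D \<inter> (A \<union> C)"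
    "B \<inter> D \<inter> (A \<union> C) \<subseteq> A \<inter> B \<union> B \<inter> C \<inter> (A \<union> D)" by blast+
  ultimately have "top_star G (A, B) (B \<inter> C, A \<union> D) (B \<inter> D, A \<union> C)"
    unfolding top_star_def Let_def prod.case using s(1) o
    by (simp only: distinct.simps list.set insert_iff empty_iff simp_thms)
  moreover have "star_attached G x (A \<inter> B \<inter> (C - D)) (A \<inter> B \<inter> (C \<inter> D)) ((B - A) \<inter> (C - D))"
    "star_attached G x (A \<inter> B \<inter> (D - C)) (A \<inter> B \<inter> (C \<inter> D)) ((B - A) \<inter> (D - C))"
    if "x \<in> C \<inter> D" "x \<in> B" "x \<notin> A" for x
    using crossing_imp_star_attached[OF G s t cr that]
      crossing_imp_star_attached[OF G s, of D C x] t cr that is_osep_swap[of G]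
    by (auto simp: insert_commute Int_commute)
  moreover have "A \<inter> B \<inter> (B \<inter> C \<inter> (A \<union> D)) - A \<inter> B \<inter> (B \<inter> C \<inter> (A \<union> D)) \<inter> (B \<inter> D \<inter> (A \<union> C)) = A \<inter> B \<inter> (C - D)"
    "A \<inter> B \<inter> (B \<inter> D \<inter> (A \<union> C)) - A \<inter> B \<inter> (B \<inter> C \<inter> (A \<union> D)) \<inter> (B \<inter> D \<inter> (A \<union> C)) = A \<inter> B \<inter> (D - C)"
    "A \<inter> B \<inter> (B \<inter> C \<inter> (A \<union> D)) \<inter> (B \<inter> D \<inter> (A \<union> C)) = A \<inter> B \<inter> (C \<inter> D)"
    "B \<inter> C - (A \<union> D) = (B - A) \<inter> (C - D)" "B \<inter> D - (A \<union> C) = (B - A) \<inter> (D - C)" by blast+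
  ultimately show ?thesis
    unfolding relevant_top_star_def Let_def prod.case using s(2) by auto
qed

section \<open>Finiteness\<close>

lemma linked_induced_mono:
  assumes "linked (induced G U) u v" "U \<subseteq> U'"
  shows "linked (induced G U') u v"
proof -
  have "u \<in> verts G \<inter> U" using linked_verts[OF assms(1)] by simp
  then have "linked (induced G U') u u" using assms(2) by (intro linked_refl) auto
  then have "u \<in> {w \<in> U. linked (induced G U') u w}" using \<open>u \<in> verts G \<inter> U\<close> by blast
  then have "v \<in> {w \<in> U. linked (induced G U') u w}"
  proof (rule linked_closed_set[OF assms(1)])
    fix x y assume "x \<in> {w \<in> U. linked (induced G U') u w}" "y \<in> verts (induced G U)"
      "adj (induced G U) x y"
    then show "y \<in> {w \<in> U. linked (induced G U') u w}"
      using linked_step[of "induced G U'" u x y] assms(2) by auto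
  qed
  then show ?thesis by simp
qed

text \<open>\<open>W\<close> is the part of the separator fixed so far, and \<open>n\<close> bounds
  what may still be added. If \<open>u\<close> and \<open>v\<close> are linked outside
  \<open>W\<close>, every candidate meets one fixed path, which leaves finitely many ways to enlarge
  \<open>W\<close>; otherwise minimality forces \<open>X = W\<close>. Minimality is demanded only
  outside \<open>W\<close> so that it survives the enlargement.\<close>

lemma finite_minimal_separators:
  assumes "finite W"
  shows "finite {X. W \<subseteq> X \<and> finite X \<and> card X \<le> card W + n \<and>
    \<not> linked (induced G (verts G - X)) u v \<and>
    (\<forall>x\<in>X - W. linked (induced G (verts G - (X - {x}))) u v)}"
  (is "finite (?S W n)")
  using assms
proof (induction n arbitrary: W)
  case 0
  have "X = W" if "X \<in> ?S W 0" for X using that card_seteq[of X W] by auto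
  then have "?S W 0 \<subseteq> {W}" by blast
  then show ?case using finite_subset by blast
next
  case (Suc n)
  show ?case
  proof (cases "linked (induced G (verts G - W)) u v")
    case False
    have "X = W" if X: "X \<in> ?S W (Suc n)" for X
    proof (rule ccontr)
      assume "X \<noteq> W"
      then obtain x where x: "x \<in> X - W" using X by blast
      then have "linked (induced G (verts G - (X - {x}))) u v" using X by blast
      moreover have "verts G - (X - {x}) \<subseteq> verts G - W" using X x by blast
      ultimately have "linked (induced G (verts G - W)) u v" by (rule linked_induced_mono)
      then show False using False by contradiction
    qed
    then have "?S W (Suc n) \<subseteq> {W}" by blast
    then show ?thesis using finite_subset by blast
  next
    case True
    then obtain p where p: "is_path (induced G (verts G - W)) p" "hd p = u" "last p = v"
      by (auto simp: linked_def)
    have pW: "set p \<inter> W = {}" using p(1) by (auto simp: is_path_def)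
    have "?S W (Suc n) \<subseteq> (\<Union>x\<in>set p. ?S (insert x W) n)"
    proof
      fix X assume X: "X \<in> ?S W (Suc n)"
      have "set p \<inter> X \<noteq> {}"
      proof
        assume "set p \<inter> X = {}"
        then have "successively (adj (induced G (verts G - X))) p"
          using p(1) unfolding is_path_def by (auto elim!: successively_mono)
        then have "is_path (induced G (verts G - X)) p"
          using p(1) \<open>set p \<inter> X = {}\<close> by (auto simp: is_path_def)
        then show False using X p by (auto simp: linked_def)
      qed
      then obtain x where x: "x \<in> set p" "x \<in> X" by blast
      have "x \<notin> W" using x pW by blast
      then have "card (insert x W) + n = card W + Suc n" using Suc.prems by simp
      then have "X \<in> ?S (insert x W) n" using X x by auto
      then show "X \<in> (\<Union>x\<in>set p. ?S (insert x W) n)" using x by blast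
    qed
    moreover have "finite (\<Union>x\<in>set p. ?S (insert x W) n)" using Suc by blast
    ultimately show ?thesis using finite_subset by blast
  qed
qed

lemma sep_order_doubleton_le_iff: "sep_order {A, B} \<le> enat k \<longleftrightarrow> finite (A \<inter> B) \<and> card (A \<inter> B) \<le> k"
  by (auto simp: sep_order_def ecard_def)

lemma sep_order_doubleton_less_iff: "sep_order {A, B} < enat k \<longleftrightarrow> finite (A \<inter> B) \<and> card (A \<inter> B) < k"
  by (auto simp: sep_order_def ecard_def)

lemma sep_order_doubleton_eq_iff: "sep_order {A, B} = enat k \<longleftrightarrow> finite (A \<inter> B) \<and> card (A \<inter> B) = k"
  by (auto simp: sep_order_def ecard_def)

text \<open>Finiteness rests on tightness and bounded order only, so it is established for this set,
  which contains every \<open>l\<close>-bottleneck with \<open>l \<le> k\<close>.\<close>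

definition tight_seps :: "'a graph \<Rightarrow> nat \<Rightarrow> 'a sep set" where
  "tight_seps G k = {s. is_sep G s \<and> tight G s \<and> sep_order s \<le> enat k}"

lemma is_sep_cases:
  assumes "is_sep G s" obtains A B where "s = {A, B}" "is_osep G (A, B)"
  using assms by (auto simp: is_sep_def unor_def)

lemma tight_seps_doubleton:
  "{A, B} \<in> tight_seps G k \<longleftrightarrow>
     is_osep G (A, B) \<and> tight G {A, B} \<and> finite (A \<inter> B) \<and> card (A \<inter> B) \<le> k"
  unfolding tight_seps_def by (simp add: is_sep_doubleton sep_order_doubleton_le_iff)

lemma tight_seps_cases:
  assumes "s \<in> tight_seps G k"
  obtains A B where "s = {A, B}" "is_osep G (A, B)" "tight G {A, B}" "finite (A \<inter> B)" "card (A \<inter> B) \<le> k"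
  using assms by (metis is_sep_cases mem_Collect_eq tight_seps_def tight_seps_doubleton)

text \<open>Every vertex of the separator has neighbours in both components, so giving back a single
  one reconnects them. This is the minimality that \<open>finite_minimal_separators\<close> asks for
  with \<open>W = {}\<close>.\<close>

lemma tight_separator_minimal:
  assumes K: "tight_component G X K" and L: "tight_component G X L"
    and d: "K \<inter> L = {}" and uv: "u \<in> K" "v \<in> L"
  shows "\<not> linked (induced G (verts G - X)) u v"
    and "\<forall>x\<in>X. linked (induced G (verts G - (X - {x}))) u v"
proof -
  have c: "K \<in> components (induced G (verts G - X))" "L \<in> components (induced G (verts G - X))"
    using K L by (auto simp: tight_component_def)
  show "\<not> linked (induced G (verts G - X)) u v"
  proof
    assume "linked (induced G (verts G - X)) u v"
    then have "v \<in> K" using uv(1) component_adj_closed[OF c(1)] by (rule linked_closed_set)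
    then show False using d uv by blast
  qed
  show "\<forall>x\<in>X. linked (induced G (verts G - (X - {x}))) u v"
  proof
    fix x assume x: "x \<in> X"
    let ?H = "induced G (verts G - (X - {x}))"
    have mono: "linked ?H a b" if "linked (induced G (verts G - X)) a b" for a b
      using that by (rule linked_induced_mono) auto
    obtain u' where u': "u' \<in> K" "adj G u' x" using tight_component_facts(5)[OF K x] by blast
    obtain v' where v': "v' \<in> L" "adj G v' x" using tight_component_facts(5)[OF L x] by blast
    have xV: "x \<in> verts G" using tight_component_facts(5)[OF K x] by blast
    have "linked ?H u u'" "linked ?H v v'"
      using mono component_linked c uv u' v' by metis+
    moreover have "linked ?H u' x" "linked ?H v' x"
      using calculation linked_verts[of ?H] u' v' xV
      by (auto intro!: linked_step[OF linked_refl])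
    ultimately show "linked ?H u v" using linked_trans linked_sym by metis
  qed
qed

text \<open>Both tight components contain a neighbour of \<open>x\<close>. Local finiteness leaves
  finitely many pairs of neighbours, and each pair has finitely many minimal separators of size at
  most \<open>k\<close>.\<close>

lemma finite_tight_separators_through:
  assumes G: "simple_graph G" "locally_finite G"
  shows "finite {X. finite X \<and> card X \<le> k \<and> x \<in> X \<and>
    (\<exists>K L. tight_component G X K \<and> tight_component G X L \<and> K \<inter> L = {})}" (is "finite ?T")
proof -
  let ?N = "{w \<in> verts G. adj G x w}"
  define S where "S = (\<lambda>u v. {X. {} \<subseteq> X \<and> finite X \<and> card X \<le> card ({}::'a set) + k \<and>
    \<not> linked (induced G (verts G - X)) u v \<and>
    (\<forall>x\<in>X - {}. linked (induced G (verts G - (X - {x}))) u v)})"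
  have "?T \<subseteq> (\<Union>u\<in>?N. \<Union>v\<in>?N. S u v)"
  proof
    fix X assume "X \<in> ?T"
    then obtain K L where X: "finite X" "card X \<le> k" "x \<in> X"
      and KL: "tight_component G X K" "tight_component G X L" "K \<inter> L = {}" by blast
    obtain u where u: "u \<in> K" "adj G u x" using tight_component_facts(5)[OF KL(1) X(3)] by blast
    obtain v where v: "v \<in> L" "adj G v x" using tight_component_facts(5)[OF KL(2) X(3)] by blast
    have "X \<in> S u v" using tight_separator_minimal[OF KL u(1) v(1)] X unfolding S_def by simp
    moreover have "u \<in> ?N" "v \<in> ?N" using u v simple_graph_adjD[OF G(1)] adj_sym[of G] by blast+
    ultimately show "X \<in> (\<Union>u\<in>?N. \<Union>v\<in>?N. S u v)" by blast
  qed
  moreover have "finite (S u v)" for u v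
    unfolding S_def by (rule finite_minimal_separators) simp
  moreover have "finite ?N"
  proof (cases "x \<in> verts G")
    case True
    then show ?thesis using G(2) unfolding locally_finite_def by blast
  next
    case False
    then have "?N = {}" using simple_graph_adjD(1)[OF G(1)] by blast
    then show ?thesis by (metis finite.emptyI)
  qed
  ultimately show ?thesis by (meson finite_UN_I finite_subset)
qed

text \<open>The separator does not determine the separation, since the components of
  \<open>G - X\<close> can be distributed over the two sides. By connectedness each of them has a
  vertex in the finite set \<open>N\<close> of neighbours of \<open>X\<close>, so the trace of
  \<open>A\<close> on \<open>N\<close> decides the distribution.\<close>

lemma finite_seps_with_separator:
  assumes G: "simple_graph G" "locally_finite G" "connected_graph G"
    and X: "finite X" "X \<noteq> {}"
  shows "finite {A. \<exists>B. is_osep G (A, B) \<and> A \<inter> B = X}" (is "finite ?S")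
proof (cases "X \<subseteq> verts G")
  case False
  then have "?S = {}" using is_osepD(1)[of G] by blast
  then show ?thesis by (metis finite.emptyI)
next
  case True
  define N where "N = (\<Union>x\<in>X. {w \<in> verts G. adj G x w})"
  have "finite N" using X(1) True G(2) unfolding N_def locally_finite_def by blast
  have sub: "A \<subseteq> A'" if A: "is_osep G (A, B)" "A \<inter> B = X" and A': "is_osep G (A', B')" "A' \<inter> B' = X"
    and e: "A \<inter> N = A' \<inter> N" for A B A' B'
  proof (rule ccontr)
    assume "\<not> A \<subseteq> A'"
    then have ne: "(A - A') \<inter> verts G \<noteq> {}" using is_osepD(1)[OF A(1)] by blast
    \<comment> \<open>An edge could leave \<open>A - A'\<close> only into \<open>X\<close>, hence
      only from a vertex of \<open>N\<close>, and there \<open>A\<close> and \<open>A'\<close>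
      agree.\<close>
    have "verts G \<subseteq> A - A'"
    proof (rule connected_graph_closed_set[OF G(3) ne])
      fix x y assume xy: "x \<in> A - A'" "y \<in> verts G" "adj G x y"
      have x: "x \<in> verts G" "x \<in> B'" "x \<notin> B"
        using xy(1) is_osepD(1)[OF A(1)] is_osepD(1)[OF A'(1)] A(2) A'(2) by blast+
      then have "y \<in> A" "y \<in> B'"
        using is_osepD(2)[OF A(1), of x y] is_osepD(3)[OF A'(1), of x y] xy by blast+
      moreover have "y \<notin> A'"
      proof
        assume "y \<in> A'"
        then have "y \<in> X" using A'(2) calculation by blast
        then have "x \<in> N" using xy x adj_sym[of G] unfolding N_def by blast
        then show False using xy(1) e by blast
      qed
      ultimately show "y \<in> A - A'" by blast
    qed
    then show False using X(2) A'(2) True by blast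
  qed
  have "inj_on (\<lambda>A. A \<inter> N) ?S"
  proof (rule inj_onI)
    fix A A' assume a: "A \<in> ?S" "A' \<in> ?S" "A \<inter> N = A' \<inter> N"
    then obtain B B' where "is_osep G (A, B)" "A \<inter> B = X" "is_osep G (A', B')" "A' \<inter> B' = X" by blast
    then show "A = A'" using sub[of A B A' B'] sub[of A' B' A B] a(3) by blast
  qed
  then show ?thesis using \<open>finite N\<close>
    by (elim inj_on_finite[where B = "Pow N"]) auto
qed

lemma finite_tight_seps_through:
  assumes G: "simple_graph G" "locally_finite G" "connected_graph G"
  shows "finite {s \<in> tight_seps G k. x \<in> \<Inter>s}"
proof -
  define \<X> where "\<X> = {X. finite X \<and> card X \<le> k \<and> x \<in> X \<and>
    (\<exists>K L. tight_component G X K \<and> tight_component G X L \<and> K \<inter> L = {})}"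
  define S where "S = (\<lambda>X. {A. \<exists>B. is_osep G (A, B) \<and> A \<inter> B = X})"
  have "{s \<in> tight_seps G k. x \<in> \<Inter>s} \<subseteq> (\<Union>X\<in>\<X>. \<Union>A\<in>S X. {{A, verts G - A \<union> X}})"
  proof
    fix s assume s: "s \<in> {s \<in> tight_seps G k. x \<in> \<Inter>s}"
    then obtain A B where AB: "s = {A, B}" "is_osep G (A, B)" "tight G {A, B}" "finite (A \<inter> B)"
      "card (A \<inter> B) \<le> k" by (blast elim: tight_seps_cases)
    obtain K L where "tight_component G (A \<inter> B) K" "K \<subseteq> A" "tight_component G (A \<inter> B) L" "L \<subseteq> B"
      using AB(3) unfolding tight_doubleton by blast
    moreover have "K \<inter> L = {}" using calculation tight_component_facts(3)[of G "A \<inter> B"] by blast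
    ultimately have "A \<inter> B \<in> \<X>" using AB s unfolding \<X>_def by blast
    moreover have "A \<in> S (A \<inter> B)" using AB(2) unfolding S_def by blast
    moreover have "B = verts G - A \<union> A \<inter> B" using is_osepD(1)[OF AB(2)] by blast
    ultimately show "s \<in> (\<Union>X\<in>\<X>. \<Union>A\<in>S X. {{A, verts G - A \<union> X}})" using AB(1) by blast
  qed
  moreover have "finite \<X>" unfolding \<X>_def by (rule finite_tight_separators_through[OF G(1,2)])
  moreover have "finite (S X)" if "X \<in> \<X>" for X
    using that unfolding S_def \<X>_def by (intro finite_seps_with_separator[OF G]) auto
  ultimately show ?thesis by (meson finite.intros finite_UN_I finite_subset)
qed

lemma path_avoiding_separator:
  assumes "is_osep G (C, D)" "is_path G p" "hd p \<in> C - D" "set p \<inter> (C \<inter> D) = {}"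
  shows "set p \<subseteq> C - D"
proof -
  have "set p \<subseteq> C - D" if "successively (adj G) p" "p \<noteq> []" "set p \<subseteq> verts G" "hd p \<in> C - D"
    "set p \<inter> (C \<inter> D) = {}" using that
  proof (induction p rule: induct_list012)
    case (3 x y zs)
    then have "y \<in> C" using is_osepD(2)[OF assms(1), of x y] by auto
    then show ?case using 3 by auto
  qed auto
  then show ?thesis using assms by (auto simp: is_path_def)
qed

lemma finite_tight_seps_separating:
  assumes G: "simple_graph G" "locally_finite G" "connected_graph G"
  shows "finite {s \<in> tight_seps G k. \<exists>A B. s = {A, B} \<and> u \<in> A - B \<and> v \<in> B - A}" (is "finite ?S")
proof (cases "u \<in> verts G \<and> v \<in> verts G")
  case False
  have "?S = {}"
  proof (rule ccontr)
    assume "?S \<noteq> {}"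
    then obtain A B where "{A, B} \<in> tight_seps G k" "u \<in> A" "v \<in> B" by blast
    then show False using False is_osepD(1)[of G A B] unfolding tight_seps_doubleton by blast
  qed
  then show ?thesis by (metis finite.emptyI)
next
  case True
  then obtain p where p: "is_path G p" "hd p = u" "last p = v"
    using G(3) unfolding connected_graph_def linked_def by blast
  have "?S \<subseteq> (\<Union>x\<in>set p. {s \<in> tight_seps G k. x \<in> \<Inter>s})"
  proof
    fix s assume "s \<in> ?S"
    then obtain A B where s: "s \<in> tight_seps G k" "s = {A, B}" "u \<in> A - B" "v \<in> B - A" by blast
    have o: "is_osep G (A, B)" using s tight_seps_doubleton by blast
    have "v \<in> set p" using p by (auto simp: is_path_def)
    then have "set p \<inter> (A \<inter> B) \<noteq> {}"
      using path_avoiding_separator[OF o p(1)] p(2) s by blast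
    then show "s \<in> (\<Union>x\<in>set p. {s \<in> tight_seps G k. x \<in> \<Inter>s})" using s by blast
  qed
  then show ?thesis using finite_tight_seps_through[OF G] by (meson List.finite_set finite_UN_I finite_subset)
qed

text \<open>Paths from \<open>x0\<close> join all of \<open>A \<inter> B\<close> within a finite set
  \<open>P\<close>. A separation whose separator misses \<open>P\<close> has
  \<open>A \<inter> B\<close> strictly on one side; its other side avoids
  \<open>A \<inter> B\<close> and, by tightness, the two are nested. So the crossing separations all
  pass through one of finitely many vertices.\<close>

lemma finite_tight_seps_crossing:
  assumes G: "simple_graph G" "locally_finite G" "connected_graph G"
    and s: "is_osep G (A, B)" "finite (A \<inter> B)"
  shows "finite {t \<in> tight_seps G k. crosses t {A, B}}" (is "finite ?S")
proof -
  have n: "nested t {A, B}"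
    if t: "t = {C, D}" "is_osep G (C, D)" "tight G {C, D}" and d: "D \<inter> (A \<inter> B) = {}" for t C D
    using tight_side_avoiding_separator_nested[OF G(3), of D C A B] t d s is_osep_swap[of G C D]
    by (simp add: insert_commute)
  show ?thesis
  proof (cases "A \<inter> B = {}")
    case True
    have "?S = {}" using n True by (auto elim!: tight_seps_cases)
    then show ?thesis by (metis finite.emptyI)
  next
    case False
    then obtain x0 where x0: "x0 \<in> A \<inter> B" by blast
    have "\<forall>x\<in>A \<inter> B. \<exists>p. is_path G p \<and> hd p = x0 \<and> last p = x"
      using G(3) x0 is_osepD(1)[OF s(1)] unfolding connected_graph_def linked_def by blast
    then obtain p where p: "\<And>x. x \<in> A \<inter> B \<Longrightarrow> is_path G (p x) \<and> hd (p x) = x0 \<and> last (p x) = x" by metis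
    define P where "P = (\<Union>x\<in>A \<inter> B. set (p x))"
    have "finite P" using s(2) unfolding P_def by blast
    have X: "A \<inter> B \<subseteq> C - D" if "is_osep G (C, D)" "P \<inter> (C \<inter> D) = {}" "x0 \<in> C - D" for C D
    proof
      fix x assume x: "x \<in> A \<inter> B"
      then have "set (p x) \<subseteq> C - D"
        using that p[OF x] by (intro path_avoiding_separator) (auto simp: P_def)
      moreover have "x \<in> set (p x)" using p[OF x] by (metis is_path_def last_in_set)
      ultimately show "x \<in> C - D" by blast
    qed
    have "?S \<subseteq> (\<Union>x\<in>P. {s \<in> tight_seps G k. x \<in> \<Inter>s})"
    proof
      fix t assume t: "t \<in> ?S"
      then obtain C D where CD: "t = {C, D}" "is_osep G (C, D)" "tight G {C, D}"
        by (blast elim: tight_seps_cases)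
      have "P \<inter> (C \<inter> D) \<noteq> {}"
      proof
        assume a: "P \<inter> (C \<inter> D) = {}"
        have DC: "t = {D, C}" "is_osep G (D, C)" "tight G {D, C}"
          using CD is_osep_swap[of G C D] by (auto simp: insert_commute)
        have "x0 \<in> P" using p[OF x0] x0 unfolding P_def by (metis UN_I is_path_def last_in_set)
        then consider "x0 \<in> C - D" | "x0 \<in> D - C"
          using a x0 is_osepD(1)[OF CD(2)] is_osepD(1)[OF s(1)] by blast
        then show False
        proof cases
          case 1
          then show False using n[OF CD] X[OF CD(2) a] t by blast
        next
          case 2
          then show False using n[OF DC] X[OF DC(2)] a t by blast
        qed
      qed
      then show "t \<in> (\<Union>x\<in>P. {s \<in> tight_seps G k. x \<in> \<Inter>s})" using t CD by blast
    qed
    then show ?thesis using finite_tight_seps_through[OF G] \<open>finite P\<close>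
      by (meson finite_UN_I finite_subset)
  qed
qed

section \<open>Corners and bottlenecks\<close>

definition corner :: "'a set \<Rightarrow> 'a set \<Rightarrow> 'a set \<Rightarrow> 'a set \<Rightarrow> 'a sep" where
  "corner A B C D = {A \<inter> C, B \<union> D}"

definition corner_order :: "'a set \<Rightarrow> 'a set \<Rightarrow> 'a set \<Rightarrow> 'a set \<Rightarrow> nat" where
  "corner_order A B C D = card (A \<inter> C \<inter> (B \<union> D))"

lemma corner_commute: "corner A B C D = corner C D A B"
  and corner_order_commute: "corner_order A B C D = corner_order C D A B"
  by (simp_all add: corner_def corner_order_def Int_commute Un_commute)

text \<open>The separators of opposite corners have union
  \<open>A \<inter> B \<union> C \<inter> D\<close> and intersection
  \<open>A \<inter> B \<inter> (C \<inter> D)\<close>, so submodularity is an equality: a large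
  corner forces its opposite to be small.\<close>

lemma corner_order_add:
  assumes "is_osep G (A, B)" "is_osep G (C, D)" "finite (A \<inter> B)" "finite (C \<inter> D)"
  shows "corner_order A B C D + corner_order B A D C = card (A \<inter> B) + card (C \<inter> D)"
proof -
  have VG: "A \<union> B = C \<union> D" using is_osepD(1)[OF assms(1)] is_osepD(1)[OF assms(2)] by simp
  let ?P = "A \<inter> C \<inter> (B \<union> D)" and ?Q = "B \<inter> D \<inter> (A \<union> C)"
  have "?P \<union> ?Q = A \<inter> B \<union> C \<inter> D" "?P \<inter> ?Q = A \<inter> B \<inter> (C \<inter> D)" using VG by blast+
  moreover have "finite ?P" "finite ?Q"
    by (rule finite_subset[of _ "A \<inter> B \<union> C \<inter> D"]; use assms in blast)+
  ultimately show ?thesis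
    unfolding corner_order_def using card_Un_Int[of ?P ?Q] card_Un_Int[OF assms(3,4)] by simp
qed

lemma sep_order_corner:
  assumes "finite (A \<inter> B)" "finite (C \<inter> D)"
  shows "sep_order (corner A B C D) = enat (corner_order A B C D)"
proof -
  have "finite (A \<inter> C \<inter> (B \<union> D))"
    by (rule finite_subset[of _ "A \<inter> B \<union> C \<inter> D"]) (use assms in blast)+
  then show ?thesis unfolding corner_def corner_order_def sep_order_doubleton_eq_iff by simp
qed

lemma nested_corner_self: "nested {A, B} (corner A B C D)" "nested {C, D} (corner A B C D)"
  unfolding corner_def nested_doubleton by blast+

text \<open>Crossing rules out that \<open>{E, F}\<close> lies between the two separations, which
  would make them nested; all other positions are compatible with the corner. Swapping arguments
  covers the other three corners.\<close>

lemma nested_corner: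
  assumes "crosses {A, B} {C, D}" "nested {E, F} {A, B}" "nested {E, F} {C, D}"
  shows "nested {E, F} (corner A B C D)"
  using assms unfolding nested_doubleton corner_def
  by (elim disjE conjE) blast+

text \<open>If \<open>E \<subseteq> A\<close> and \<open>B \<subseteq> F\<close>, then the corner
  cut out of \<open>B\<close> is nested with \<open>{E, F}\<close> whatever \<open>C\<close> and
  \<open>D\<close> are; the other positions are symmetric. Used in contraposition: crossing both
  opposite corners means crossing \<open>{A, B}\<close>.\<close>

lemma nested_opposite_corner:
  assumes "nested {E, F} {A, B}"
  shows "nested {E, F} (corner A B C D) \<or> nested {E, F} (corner B A D C)"
proof -
  have "E \<subseteq> A \<Longrightarrow> E \<subseteq> A \<union> C" "B \<subseteq> F \<Longrightarrow> B \<inter> D \<subseteq> F" "E \<subseteq> B \<Longrightarrow> E \<subseteq> B \<union> D" "A \<subseteq> F \<Longrightarrow> A \<inter> C \<subseteq> F"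
    "F \<subseteq> A \<Longrightarrow> F \<subseteq> A \<union> C" "B \<subseteq> E \<Longrightarrow> B \<inter> D \<subseteq> E" "F \<subseteq> B \<Longrightarrow> F \<subseteq> B \<union> D" "A \<subseteq> E \<Longrightarrow> A \<inter> C \<subseteq> E" by blast+
  then show ?thesis using assms unfolding nested_doubleton corner_def by argo
qed

section \<open>Corners forced into bottlenecks\<close>

lemma bottleneckD:
  assumes "bottleneck G k \<beta>"
  shows "\<beta> \<noteq> {}" "\<And>s. s \<in> \<beta> \<Longrightarrow> is_sep G s" "\<And>s. s \<in> \<beta> \<Longrightarrow> tight G s"
    "\<And>s. s \<in> \<beta> \<Longrightarrow> sep_order s = enat k" "\<beta> \<subseteq> tight_seps G k"
  using assms unfolding bottleneck_def tight_seps_def by auto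

lemma bottleneck_elem_cases:
  assumes "bottleneck G k \<beta>" "s \<in> \<beta>"
  obtains A B where "s = {A, B}" "is_osep G (A, B)" "tight G {A, B}" "finite (A \<inter> B)" "card (A \<inter> B) = k"
proof -
  obtain A B where AB: "s = {A, B}" "is_osep G (A, B)"
    using bottleneckD(2)[OF assms] by (rule is_sep_cases)
  then show thesis
    using that[of A B] bottleneckD(3,4)[OF assms] by (simp add: sep_order_doubleton_eq_iff)
qed

text \<open>The star of \<open>relevant_top_star_corners\<close> has base \<open>{A, B}\<close> and
  the two corners inside \<open>B\<close> as its other constituents; the order bounds are what the
  bottleneck condition still asks for.\<close>

lemma bottleneck_corner:
  assumes G: "connected_graph G"
    and \<beta>: "bottleneck G k \<beta>" "{A, B} \<in> \<beta>"
    and t: "is_osep G (C, D)" "tight G {C, D}" "finite (C \<inter> D)"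
    and cr: "crosses {A, B} {C, D}"
    and le: "corner_order B A C D \<le> k" "corner_order B A D C \<le> k"
  shows "corner B A C D \<in> \<beta> \<or> corner B A D C \<in> \<beta>"
proof -
  have s: "is_osep G (A, B)" "tight G {A, B}" "sep_order {A, B} = enat k"
    using bottleneckD(2-4)[OF \<beta>] by (auto simp: is_sep_doubleton)
  then have fin: "finite (B \<inter> A)" "finite (D \<inter> C)" using t(3) by (auto simp: sep_order_doubleton_eq_iff Int_commute)
  have rel: "relevant_top_star G (A, B) (B \<inter> C, A \<union> D) (B \<inter> D, A \<union> C)"
    by (rule relevant_top_star_corners[OF G s(1,2) t(1,2) cr])
  have u: "unor (A, B) = {A, B}" "unor (B \<inter> C, A \<union> D) = corner B A C D"
    "unor (B \<inter> D, A \<union> C) = corner B A D C" by (simp_all add: unor_def corner_def)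
  have "\<forall>p\<in>{(A, B), (B \<inter> C, A \<union> D), (B \<inter> D, A \<union> C)}. sep_order (unor p) \<le> enat k"
    using s(3) le sep_order_corner[OF fin(1) t(3)] sep_order_corner[OF fin] u by simp
  moreover have "unor (A, B) \<in> \<beta>" using \<beta>(2) u by simp
  ultimately have "unor (B \<inter> C, A \<union> D) \<in> \<beta> \<or> unor (B \<inter> D, A \<union> C) \<in> \<beta>"
    using \<beta>(1) rel unfolding bottleneck_def by blast
  then show ?thesis using u by simp
qed

lemma bottleneck_corner_order:
  assumes "bottleneck G k \<beta>" "corner A B C D \<in> \<beta>" "finite (A \<inter> B)" "finite (C \<inter> D)"
  shows "corner_order A B C D = k"
  using bottleneckD(4)[OF assms(1,2)] sep_order_corner[OF assms(3,4)] by simp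

context
  fixes G :: "'a graph" and A B C D :: "'a set" and k l :: nat and \<beta> \<gamma> :: "'a sep set"
  assumes G: "connected_graph G"
    and \<beta>: "bottleneck G k \<beta>" "{A, B} \<in> \<beta>" and \<gamma>: "bottleneck G l \<gamma>" "{C, D} \<in> \<gamma>"
    and cr: "crosses {A, B} {C, D}"
begin

private lemma sides: "is_osep G (A, B)" "tight G {A, B}" "finite (A \<inter> B)" "card (A \<inter> B) = k"
    "is_osep G (C, D)" "tight G {C, D}" "finite (C \<inter> D)" "card (C \<inter> D) = l"
  using bottleneckD(2-4)[OF \<beta>] bottleneckD(2-4)[OF \<gamma>]
  by (auto simp: is_sep_doubleton sep_order_doubleton_eq_iff)

private lemma swapped: "is_osep G (B, A)" "tight G {B, A}" "finite (B \<inter> A)"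
    "is_osep G (D, C)" "tight G {D, C}" "finite (D \<inter> C)" "{B, A} \<in> \<beta>" "{D, C} \<in> \<gamma>"
  using sides \<beta>(2) \<gamma>(2) is_osep_swap[of G] by (simp_all add: insert_commute Int_commute)

private lemma orders:
  "corner_order A B C D + corner_order B A D C = k + l"
  "corner_order A B D C + corner_order B A C D = k + l"
  using corner_order_add[OF sides(1,5,3,7)] corner_order_add[OF sides(1) swapped(4) sides(3) swapped(6)] sides
  by (simp_all add: Int_commute)

private lemma beta_corners:
  "corner_order B A C D \<le> k \<Longrightarrow> corner_order B A D C \<le> k \<Longrightarrow>
     corner B A C D \<in> \<beta> \<or> corner B A D C \<in> \<beta>"
  "corner_order A B C D \<le> k \<Longrightarrow> corner_order A B D C \<le> k \<Longrightarrow>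
     corner A B C D \<in> \<beta> \<or> corner A B D C \<in> \<beta>"
  using bottleneck_corner[OF G \<beta> sides(5-7) cr] bottleneck_corner[OF G \<beta>(1) swapped(7) sides(5-7)] cr
  by (simp_all add: insert_commute)

private lemma gamma_corners:
  "corner_order A B D C \<le> l \<Longrightarrow> corner_order B A D C \<le> l \<Longrightarrow>
     corner A B D C \<in> \<gamma> \<or> corner B A D C \<in> \<gamma>"
  "corner_order A B C D \<le> l \<Longrightarrow> corner_order B A C D \<le> l \<Longrightarrow>
     corner A B C D \<in> \<gamma> \<or> corner B A C D \<in> \<gamma>"
  using bottleneck_corner[OF G \<gamma> sides(1-3)] bottleneck_corner[OF G \<gamma>(1) swapped(8) sides(1-3)] cr
  by (simp_all add: insert_commute nested_sym[of "{A, B}"]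
      corner_commute[of D C] corner_commute[of C D] corner_order_commute[of D C] corner_order_commute[of C D])

private lemma corner_orders_in:
  "corner A B C D \<in> \<beta> \<Longrightarrow> corner_order A B C D = k" "corner A B D C \<in> \<beta> \<Longrightarrow> corner_order A B D C = k"
  "corner B A C D \<in> \<beta> \<Longrightarrow> corner_order B A C D = k" "corner B A D C \<in> \<beta> \<Longrightarrow> corner_order B A D C = k"
  "corner A B C D \<in> \<gamma> \<Longrightarrow> corner_order A B C D = l" "corner A B D C \<in> \<gamma> \<Longrightarrow> corner_order A B D C = l"
  "corner B A C D \<in> \<gamma> \<Longrightarrow> corner_order B A C D = l" "corner B A D C \<in> \<gamma> \<Longrightarrow> corner_order B A D C = l"
  using bottleneck_corner_order[OF \<beta>(1)] bottleneck_corner_order[OF \<gamma>(1)] sides swapped by blast+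

text \<open>If \<open>\<beta>\<close> contains no corner, each of \<open>A\<close> and
  \<open>B\<close> has a corner of order above \<open>k\<close>. Their opposites have order below
  \<open>l\<close> and are the two corners on one side of \<open>{C, D}\<close>. So
  \<open>\<gamma>\<close> must contain one of these, although its elements have order exactly
  \<open>l\<close>.\<close>

lemma corner_in_bottleneck:
  assumes "l < k"
  shows "corner A B C D \<in> \<beta> \<or> corner A B D C \<in> \<beta> \<or> corner B A C D \<in> \<beta> \<or> corner B A D C \<in> \<beta>"
proof (rule ccontr)
  assume n: "\<not> ?thesis"
  have "corner_order B A C D > k \<or> corner_order B A D C > k" using beta_corners(1) n by linarith
  moreover have "corner_order A B C D > k \<or> corner_order A B D C > k" using beta_corners(2) n by linarith
  \<comment> \<open>The two large corners are not opposite to each other, since opposite orders add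
    up to \<open>k + l\<close>, which is less than \<open>2 * k\<close>.\<close>
  ultimately consider "corner_order A B C D < l" "corner_order B A C D < l"
    | "corner_order A B D C < l" "corner_order B A D C < l"
    using orders assms by linarith
  then show False
  proof cases
    case 1
    then show False using gamma_corners(2) corner_orders_in by (metis less_imp_le less_irrefl)
  next
    case 2
    then show False using gamma_corners(1) corner_orders_in by (metis less_imp_le less_irrefl)
  qed
qed

text \<open>If all corners have order \<open>k\<close>, the sides \<open>A\<close> and
  \<open>B\<close> each put a corner into \<open>\<beta>\<close>, and \<open>C\<close> and
  \<open>D\<close> each put one into \<open>\<gamma>\<close>; the last two alternatives arise when
  each bottleneck takes an opposite pair. If some corner is smaller than \<open>k\<close>, neither
  it nor its opposite lies in a bottleneck, and the remaining opposite pair is split between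
  \<open>\<beta>\<close> and \<open>\<gamma>\<close>.\<close>

lemma opposite_corners_in_bottlenecks:
  assumes "l = k"
  shows "corner A B C D \<in> \<beta> \<and> corner B A D C \<in> \<gamma> \<or> corner A B C D \<in> \<gamma> \<and> corner B A D C \<in> \<beta> \<or>
    corner A B D C \<in> \<beta> \<and> corner B A C D \<in> \<gamma> \<or> corner A B D C \<in> \<gamma> \<and> corner B A C D \<in> \<beta> \<or>
    corner A B C D \<in> \<beta> \<and> corner B A D C \<in> \<beta> \<and> corner A B D C \<in> \<gamma> \<and> corner B A C D \<in> \<gamma> \<or>
    corner A B C D \<in> \<gamma> \<and> corner B A D C \<in> \<gamma> \<and> corner A B D C \<in> \<beta> \<and> corner B A C D \<in> \<beta>"
proof -
  define a b c d where d: "a = corner_order A B C D" "b = corner_order A B D C"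
    "c = corner_order B A C D" "d = corner_order B A D C"
  have sum: "a + d = 2 * k" "b + c = 2 * k" using orders assms unfolding d by simp_all
  note r = beta_corners gamma_corners corner_orders_in
  note r = r[folded d, unfolded assms]
  consider "a = k" "b = k" "c = k" "d = k" | "a < k" "d > k" | "a > k" "d < k"
    | "b < k" "c > k" | "b > k" "c < k"
    using sum by linarith
  then show ?thesis
  proof cases
    case 1
    then show ?thesis using r(1-4) by blast
  next
    case 2
    then have "a \<le> k" "corner A B C D \<notin> \<beta>" "corner A B C D \<notin> \<gamma>" using r by auto
    \<comment> \<open>If \<open>c\<close> were below \<open>k\<close> as well, both corners on the
      side \<open>C\<close> would be too small for \<open>\<gamma>\<close>, which must contain one
      of them. The remaining cases repeat this with the corners permuted.\<close>
    moreover have "\<not> c < k" using calculation 2 r by (metis less_imp_le less_irrefl)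
    moreover have "b \<le> k" using calculation sum by linarith
    ultimately have "corner A B D C \<in> \<beta>" using r(1,2) by blast
    then have "c \<le> k" using r(5-8) sum by force
    then have "corner B A C D \<in> \<gamma>" using r(3,4) \<open>a \<le> k\<close> \<open>corner A B C D \<notin> \<gamma>\<close> by blast
    then show ?thesis using \<open>corner A B D C \<in> \<beta>\<close> by blast
  next
    case 3
    then have "d \<le> k" "corner B A D C \<notin> \<beta>" "corner B A D C \<notin> \<gamma>" using r by auto
    moreover have "\<not> b < k" using calculation 3 r by (metis less_imp_le less_irrefl)
    moreover have "c \<le> k" using calculation sum by linarith
    ultimately have "corner B A C D \<in> \<beta>" using r(1,2) by blast
    then have "b \<le> k" using r(5-8) sum by force
    then have "corner A B D C \<in> \<gamma>" using r(3,4) \<open>d \<le> k\<close> \<open>corner B A D C \<notin> \<gamma>\<close> by blast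
    then show ?thesis using \<open>corner B A C D \<in> \<beta>\<close> by blast
  next
    case 4
    then have "b \<le> k" "corner A B D C \<notin> \<beta>" "corner A B D C \<notin> \<gamma>" using r by auto
    moreover have "\<not> d < k" using calculation 4 r by (metis less_imp_le less_irrefl)
    moreover have "a \<le> k" using calculation sum by linarith
    ultimately have "corner A B C D \<in> \<beta>" using r(1,2) by blast
    then have "d \<le> k" using r(5-8) sum by force
    then have "corner B A D C \<in> \<gamma>" using r(3,4) \<open>b \<le> k\<close> \<open>corner A B D C \<notin> \<gamma>\<close> by blast
    then show ?thesis using \<open>corner A B C D \<in> \<beta>\<close> by blast
  next
    case 5
    then have "c \<le> k" "corner B A C D \<notin> \<beta>" "corner B A C D \<notin> \<gamma>" using r by auto
    moreover have "\<not> a < k" using calculation 5 r by (metis less_imp_le less_irrefl)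
    moreover have "d \<le> k" using calculation sum by linarith
    ultimately have "corner B A D C \<in> \<beta>" using r(1,2) by blast
    then have "a \<le> k" using r(5-8) sum by force
    then have "corner A B C D \<in> \<gamma>" using r(3,4) \<open>c \<le> k\<close> \<open>corner B A C D \<notin> \<gamma>\<close> by blast
    then show ?thesis using \<open>corner B A D C \<in> \<beta>\<close> by blast
  qed
qed

end

text \<open>Take \<open>s\<close> in \<open>\<beta>\<close> crossed by the fewest elements of
  \<open>M\<close>. If \<open>t\<close> in \<open>M\<close> crosses \<open>s\<close>, some corner
  lies in \<open>\<beta>\<close>. As all of \<open>M\<close> is nested with \<open>t\<close>, the
  corner is nested with whatever in \<open>M\<close> is nested with \<open>s\<close>, and with
  \<open>t\<close> in addition, so it is crossed by strictly fewer.\<close>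

lemma bottleneck_nested_with_lower:
  assumes G: "simple_graph G" "locally_finite G" "connected_graph G"
    and \<beta>: "bottleneck G k \<beta>"
    and low: "\<And>t. t \<in> M \<Longrightarrow> \<exists>l<k. \<exists>\<gamma>. bottleneck G l \<gamma> \<and> t \<in> \<gamma>"
    and M: "\<And>t t'. t \<in> M \<Longrightarrow> t' \<in> M \<Longrightarrow> nested t t'"
  shows "\<exists>s\<in>\<beta>. \<forall>t\<in>M. nested s t"
proof -
  define f where "f s = {t \<in> M. crosses t s}" for s
  have M_tight: "M \<subseteq> tight_seps G k"
  proof
    fix t assume "t \<in> M"
    then obtain l \<gamma> where l: "l < k" "bottleneck G l \<gamma>" "t \<in> \<gamma>" using low by blast
    then have "sep_order t \<le> enat k" using bottleneckD(4)[OF l(2,3)] by simp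
    then show "t \<in> tight_seps G k" using bottleneckD(2,3)[OF l(2,3)] by (simp add: tight_seps_def)
  qed
  obtain s where s: "s \<in> \<beta>" "\<And>s'. s' \<in> \<beta> \<Longrightarrow> card (f s) \<le> card (f s')"
    using ex_has_least_nat[of "\<lambda>s. s \<in> \<beta>" _ "\<lambda>s. card (f s)"] bottleneckD(1)[OF \<beta>] by blast
  obtain A B where AB: "s = {A, B}" "is_osep G (A, B)" "tight G {A, B}" "finite (A \<inter> B)" "card (A \<inter> B) = k"
    using \<beta> s(1) by (rule bottleneck_elem_cases)
  have "finite (f s)"
    by (rule finite_subset[OF _ finite_tight_seps_crossing[OF G AB(2,4), of k]])
      (use M_tight AB(1) in \<open>auto simp: f_def\<close>)
  have "nested s t" if t: "t \<in> M" for t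
  proof (rule ccontr)
    assume cr: "crosses s t"
    obtain l \<gamma> where l: "l < k" "bottleneck G l \<gamma>" "t \<in> \<gamma>" using low t by blast
    obtain C D where CD: "t = {C, D}" "is_osep G (C, D)"
      using l(2,3) by (rule bottleneck_elem_cases)
    have cr': "crosses {A, B} {C, D}" using cr AB CD by simp
    have "corner A B C D \<in> \<beta> \<or> corner A B D C \<in> \<beta> \<or> corner B A C D \<in> \<beta> \<or> corner B A D C \<in> \<beta>"
      using corner_in_bottleneck[OF G(3) \<beta> _ l(2) _ cr' l(1)] s(1) l(3) AB CD by simp
    then obtain A' B' C' D' where c: "corner A' B' C' D' \<in> \<beta>" "s = {A', B'}" "t = {C', D'}"
      using AB CD by (metis insert_commute)
    have "f (corner A' B' C' D') \<subseteq> f s"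
    proof
      fix r assume r: "r \<in> f (corner A' B' C' D')"
      then have "r \<in> M" by (simp add: f_def)
      then have "is_sep G r" using M_tight by (auto simp: tight_seps_def)
      then obtain E F where EF: "r = {E, F}" by (rule is_sep_cases)
      have "crosses r s"
        using nested_corner[of A' B' C' D' E F] cr M[OF \<open>r \<in> M\<close> t] r unfolding f_def c(2,3) EF by blast
      then show "r \<in> f s" using \<open>r \<in> M\<close> by (simp add: f_def)
    qed
    moreover have "t \<in> f s" using t cr nested_sym[of s t] by (simp add: f_def)
    moreover have "t \<notin> f (corner A' B' C' D')" using nested_corner_self(2)[of C' D' A' B'] c(3) by (simp add: f_def)
    ultimately have "card (f (corner A' B' C' D')) < card (f s)"
      using \<open>finite (f s)\<close> by (intro psubset_card_mono) auto
    then show False using s(2)[OF c(1)] by simp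
  qed
  then show ?thesis using s(1) by blast
qed

section \<open>Crossing numbers and selection\<close>

lemma bottleneck_elem_in_tight_seps: "s \<in> \<Union>(bottlenecks G k) \<Longrightarrow> s \<in> tight_seps G k"
  using bottleneckD(5)[of G k] by (auto simp: bottlenecks_def)

lemma crossing_number_finite:
  assumes "simple_graph G" "locally_finite G" "connected_graph G" "s \<in> \<Union>(bottlenecks G k)"
  shows "finite {r \<in> \<Union>(bottlenecks G k). crosses r s}"
proof -
  obtain A B where AB: "s = {A, B}" "is_osep G (A, B)" "finite (A \<inter> B)"
    using bottleneck_elem_in_tight_seps[OF assms(4)] by (blast elim: tight_seps_cases)
  show ?thesis
    by (rule finite_subset[OF _ finite_tight_seps_crossing[OF assms(1-3) AB(2,3), of k]])
      (use AB(1) bottleneck_elem_in_tight_seps in blast)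
qed

text \<open>A double count: whatever crosses one corner crosses one of the two separations, and
  whatever crosses both corners crosses both separations. Strictness comes from
  \<open>{A, B}\<close>, which crosses \<open>{C, D}\<close> but neither corner.\<close>

lemma crossing_number_opposite_corners:
  assumes G: "simple_graph G" "locally_finite G" "connected_graph G"
    and s: "{A, B} \<in> \<Union>(bottlenecks G k)" and t: "{C, D} \<in> \<Union>(bottlenecks G k)"
    and cr: "crosses {A, B} {C, D}"
  shows "crossing_number G k (corner A B C D) + crossing_number G k (corner B A D C)
    < crossing_number G k {A, B} + crossing_number G k {C, D}"
proof -
  define f where "f s = {r \<in> \<Union>(bottlenecks G k). crosses r s}" for s
  let ?c = "corner A B C D" and ?d = "corner B A D C"
  have cr': "crosses {B, A} {D, C}" using cr by (simp add: insert_commute)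
  have dbl: "\<exists>E F. r = {E, F}" if "r \<in> \<Union>(bottlenecks G k)" for r
    using bottleneck_elem_in_tight_seps[OF that] by (metis tight_seps_cases)
  have un: "f ?c \<subseteq> f {A, B} \<union> f {C, D}" "f ?d \<subseteq> f {A, B} \<union> f {C, D}"
  proof -
    have "crosses r {A, B} \<or> crosses r {C, D}"
      if r: "r \<in> \<Union>(bottlenecks G k)" "crosses r ?c \<or> crosses r ?d" for r
    proof -
      obtain E F where EF: "r = {E, F}" using dbl[OF r(1)] by blast
      show ?thesis using r(2) nested_corner[OF cr, of E F] nested_corner[OF cr', of E F]
        unfolding EF insert_commute[of B A] insert_commute[of D C] by blast
    qed
    then show "f ?c \<subseteq> f {A, B} \<union> f {C, D}" "f ?d \<subseteq> f {A, B} \<union> f {C, D}" unfolding f_def by blast+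
  qed
  have int: "f ?c \<inter> f ?d \<subseteq> f {A, B} \<inter> f {C, D}"
  proof
    fix r assume r: "r \<in> f ?c \<inter> f ?d"
    then obtain E F where EF: "r = {E, F}" using dbl unfolding f_def by blast
    have "crosses r {A, B}" using r nested_opposite_corner[of E F A B C D] unfolding f_def EF by blast
    moreover have "crosses r {C, D}" using r nested_opposite_corner[of E F C D A B] unfolding f_def EF
      by (auto simp: corner_commute)
    ultimately show "r \<in> f {A, B} \<inter> f {C, D}" using r unfolding f_def by blast
  qed
  have fin: "finite (f {A, B})" "finite (f {C, D})"
    unfolding f_def using crossing_number_finite[OF G] s t by blast+
  have fin': "finite (f ?c)" "finite (f ?d)" using un fin finite_subset by blast+
  have "{A, B} \<in> f {C, D}" using s cr by (simp add: f_def)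
  moreover have "{A, B} \<notin> f ?c" "{A, B} \<notin> f ?d"
    using nested_corner_self(1)[of A B C D] nested_corner_self(1)[of B A D C]
    by (simp_all add: f_def insert_commute)
  ultimately have "f ?c \<union> f ?d \<subset> f {A, B} \<union> f {C, D}" using un by blast
  then have "card (f ?c \<union> f ?d) < card (f {A, B} \<union> f {C, D})"
    using fin by (intro psubset_card_mono) auto
  moreover have "card (f ?c \<inter> f ?d) \<le> card (f {A, B} \<inter> f {C, D})" using int fin by (intro card_mono) auto
  ultimately have "card (f ?c) + card (f ?d) < card (f {A, B}) + card (f {C, D})"
    using card_Un_Int[OF fin'] card_Un_Int[OF fin] by linarith
  then show ?thesis using fin fin' unfolding crossing_number_def f_def ecard_def by simp
qed

lemma selectD:
  assumes "s \<in> select G k M \<beta>"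
  shows "s \<in> \<beta>" "\<And>t. t \<in> M \<Longrightarrow> nested s t"
    "\<And>s'. s' \<in> \<beta> \<Longrightarrow> (\<And>t. t \<in> M \<Longrightarrow> nested s' t) \<Longrightarrow> crossing_number G k s \<le> crossing_number G k s'"
  using assms unfolding select_def Let_def by auto

lemma select_nonempty:
  assumes "s \<in> \<beta>" "\<And>t. t \<in> M \<Longrightarrow> nested s t"
  shows "select G k M \<beta> \<noteq> {}"
proof -
  define C where "C = {s \<in> \<beta>. \<forall>t\<in>M. nested s t}"
  define m where "m = (LEAST m. m \<in> crossing_number G k ` C)"
  have "crossing_number G k s \<in> crossing_number G k ` C" using assms by (auto simp: C_def)
  then have "m \<in> crossing_number G k ` C" unfolding m_def by (rule LeastI)
  then obtain s' where s': "s' \<in> C" "m = crossing_number G k s'" by blast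
  moreover have "m \<le> crossing_number G k x" if "x \<in> C" for x
    unfolding m_def using that by (intro Least_le) blast
  ultimately have "s' \<in> select G k M \<beta>" unfolding select_def Let_def C_def by auto
  then show ?thesis by blast
qed

text \<open>By \<open>nested_corner\<close>, the corners of \<open>s\<close> and \<open>t\<close>
  are nested with \<open>M\<close>, so a corner in a bottleneck competes there with the selected
  separation and is crossed at least as often.\<close>

lemma select_nested:
  assumes G: "simple_graph G" "locally_finite G" "connected_graph G"
    and \<beta>: "bottleneck G k \<beta>" and \<gamma>: "bottleneck G k \<gamma>" and M: "\<And>t. t \<in> M \<Longrightarrow> is_sep G t"
    and s: "s \<in> select G k M \<beta>" and t: "t \<in> select G k M \<gamma>"
  shows "nested s t"
proof (rule ccontr)
  assume cr: "crosses s t"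
  obtain A B where AB: "s = {A, B}" using \<beta> selectD(1)[OF s] by (rule bottleneck_elem_cases)
  obtain C D where CD: "t = {C, D}" using \<gamma> selectD(1)[OF t] by (rule bottleneck_elem_cases)
  let ?x = "crossing_number G k"
  note in\<beta> = selectD(1)[OF s, unfolded AB] and in\<gamma> = selectD(1)[OF t, unfolded CD]
  have U: "{A, B} \<in> \<Union>(bottlenecks G k)" "{C, D} \<in> \<Union>(bottlenecks G k)"
    using in\<beta> in\<gamma> \<beta> \<gamma> by (auto simp: bottlenecks_def)
  have crs: "crosses {A, B} {C, D}" "crosses {A, B} {D, C}" "crosses {B, A} {C, D}" "crosses {B, A} {D, C}"
    using cr AB CD by (simp_all add: insert_commute)
  have lt: "?x (corner A B C D) + ?x (corner B A D C) < ?x s + ?x t"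
    "?x (corner A B D C) + ?x (corner B A C D) < ?x s + ?x t"
    using crossing_number_opposite_corners[OF G U crs(1)]
      crossing_number_opposite_corners[OF G, of A B k D C] U crs AB CD
    by (simp_all add: insert_commute)
  have nestM: "nested (corner A' B' C' D') r" if r: "r \<in> M" and e: "s = {A', B'}" "t = {C', D'}" for A' B' C' D' r
  proof -
    obtain E F where EF: "r = {E, F}" using M[OF r] by (rule is_sep_cases)
    show ?thesis
      using nested_corner[of A' B' C' D' E F] cr selectD(2)[OF s r] selectD(2)[OF t r] nested_sym[of r]
      unfolding e EF by (metis nested_sym)
  qed
  have minb: "?x s \<le> ?x (corner A' B' C' D')"
    if "corner A' B' C' D' \<in> \<beta>" "s = {A', B'}" "t = {C', D'}" for A' B' C' D'
    using selectD(3)[OF s that(1)] nestM that by blast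
  have minc: "?x t \<le> ?x (corner A' B' C' D')"
    if "corner A' B' C' D' \<in> \<gamma>" "s = {A', B'}" "t = {C', D'}" for A' B' C' D'
    using selectD(3)[OF t that(1)] nestM that by blast
  have sw: "s = {B, A}" "t = {D, C}" using AB CD by auto
  note m = minb[OF _ AB CD] minb[OF _ AB sw(2)] minb[OF _ sw(1) CD] minb[OF _ sw]
    minc[OF _ AB CD] minc[OF _ AB sw(2)] minc[OF _ sw(1) CD] minc[OF _ sw]
  have fin: "finite {r \<in> \<Union>(bottlenecks G k). crosses r s}" "finite {r \<in> \<Union>(bottlenecks G k). crosses r t}"
    using crossing_number_finite[OF G] U AB CD by blast+
  \<comment> \<open>All crossing numbers involved are finite, so the comparison moves to
    \<open>nat\<close>, where sums can be cancelled.\<close>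
  then obtain xs xt where x: "?x s = enat xs" "?x t = enat xt"
    unfolding crossing_number_def ecard_def by simp
  obtain a b c d where abcd: "?x (corner A B C D) = enat a" "?x (corner A B D C) = enat b"
    "?x (corner B A C D) = enat c" "?x (corner B A D C) = enat d"
    using lt x by (cases "?x (corner A B C D)"; cases "?x (corner A B D C)";
        cases "?x (corner B A C D)"; cases "?x (corner B A D C)") auto
  have "a + d < xs + xt" "b + c < xs + xt" using lt unfolding x abcd by simp_all
  moreover have "corner A B C D \<in> \<beta> \<Longrightarrow> xs \<le> a" "corner A B D C \<in> \<beta> \<Longrightarrow> xs \<le> b"
    "corner B A C D \<in> \<beta> \<Longrightarrow> xs \<le> c" "corner B A D C \<in> \<beta> \<Longrightarrow> xs \<le> d"
    "corner A B C D \<in> \<gamma> \<Longrightarrow> xt \<le> a" "corner A B D C \<in> \<gamma> \<Longrightarrow> xt \<le> b"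
    "corner B A C D \<in> \<gamma> \<Longrightarrow> xt \<le> c" "corner B A D C \<in> \<gamma> \<Longrightarrow> xt \<le> d"
    using m unfolding x abcd enat_ord_simps by blast+
  \<comment> \<open>Four alternatives contradict one of the strict sums directly. In the two where
    each bottleneck holds an opposite pair, the sums are added:
    \<open>2 * xs + 2 * xt \<le> a + b + c + d < 2 * xs + 2 * xt\<close>.\<close>
  ultimately show False
    using opposite_corners_in_bottlenecks[OF G(3) \<beta> in\<beta> \<gamma> in\<gamma> crs(1) refl] by linarith
qed

section \<open>Nestedness of the levels\<close>

lemma N_level_cases:
  assumes "s \<in> N_level G k"
  obtains \<beta> where "bottleneck G k \<beta>" "s \<in> select G k (\<Union>j\<in>{..<k}. N_level G j) \<beta>"
  using assms N_level.simps[of G k] by (auto simp: bottlenecks_def)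

lemma N_level_in_bottleneck:
  assumes "s \<in> N_level G k" obtains \<beta> where "bottleneck G k \<beta>" "s \<in> \<beta>"
  using assms selectD(1) by (metis N_level_cases)

lemma N_level_nested:
  assumes G: "simple_graph G" "locally_finite G" "connected_graph G"
    and s: "s \<in> N_level G i" and t: "t \<in> N_level G j"
  shows "nested s t"
proof -
  have less: "nested s t" if st: "s \<in> N_level G i" "t \<in> N_level G j" "i < j" for s t i j
  proof -
    obtain \<beta> where "t \<in> select G j (\<Union>i\<in>{..<j}. N_level G i) \<beta>" using st(2) by (rule N_level_cases)
    then have "nested t s" by (rule selectD(2)) (use st in blast)
    then show ?thesis using nested_sym by blast
  qed
  consider "i < j" | "j < i" | "i = j" by linarith
  then show ?thesis
  proof cases
    case 1
    then show ?thesis using less[OF s t] by simp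
  next
    case 2
    then show ?thesis using less[OF t s] nested_sym[of s t] by simp
  next
    case 3
    obtain \<beta> where \<beta>: "bottleneck G i \<beta>" "s \<in> select G i (\<Union>j\<in>{..<i}. N_level G j) \<beta>"
      using s by (rule N_level_cases)
    obtain \<gamma> where \<gamma>: "bottleneck G i \<gamma>" "t \<in> select G i (\<Union>j\<in>{..<i}. N_level G j) \<gamma>"
      using t 3 by (auto elim: N_level_cases)
    have "is_sep G r" if "r \<in> (\<Union>j\<in>{..<i}. N_level G j)" for r
      using that bottleneckD(2) by (blast elim: N_level_in_bottleneck)
    then show ?thesis using select_nested[OF G \<beta>(1) \<gamma>(1) _ \<beta>(2) \<gamma>(2)] by blast
  qed
qed

text \<open>\<open>bottleneck_nested_with_lower\<close> supplies a candidate, so the selection from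
  \<open>\<beta>\<close> is not empty. This is how every pair of tangles later obtains a separation
  in the nested set.\<close>

lemma N_level_meets_bottleneck:
  assumes G: "simple_graph G" "locally_finite G" "connected_graph G" and \<beta>: "bottleneck G k \<beta>"
  shows "\<beta> \<inter> N_level G k \<noteq> {}"
proof -
  let ?M = "\<Union>j\<in>{..<k}. N_level G j"
  have "\<exists>s\<in>\<beta>. \<forall>t\<in>?M. nested s t"
  proof (rule bottleneck_nested_with_lower[OF G \<beta>])
    fix t assume "t \<in> ?M"
    then show "\<exists>l<k. \<exists>\<gamma>. bottleneck G l \<gamma> \<and> t \<in> \<gamma>" by (blast elim: N_level_in_bottleneck)
  next
    fix t t' assume "t \<in> ?M" "t' \<in> ?M"
    then show "nested t t'" using N_level_nested[OF G] by blast
  qed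
  then obtain s0 where "s0 \<in> \<beta>" "\<forall>t\<in>?M. nested s0 t" by blast
  then have "select G k ?M \<beta> \<noteq> {}" by (intro select_nonempty[of s0]) auto
  then obtain s where s: "s \<in> select G k ?M \<beta>" by blast
  moreover have "select G k ?M \<beta> \<subseteq> N_level G k"
    using \<beta> by (subst N_level.simps[of G k]) (auto simp: bottlenecks_def)
  ultimately show ?thesis using selectD(1)[OF s] by blast
qed

lemma N_upto_subset_tight_seps: "N_upto G k \<subseteq> tight_seps G k"
proof
  fix s assume "s \<in> N_upto G k"
  then obtain j where j: "j \<le> k" "s \<in> N_level G j" by (auto simp: N_upto_def)
  obtain \<beta> where "bottleneck G j \<beta>" "s \<in> \<beta>" using j(2) by (rule N_level_in_bottleneck)
  then show "s \<in> tight_seps G k"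
    using bottleneckD(2-4)[of G j \<beta> s] j(1) by (simp add: tight_seps_def)
qed

lemma N_upto_nested:
  assumes "simple_graph G" "locally_finite G" "connected_graph G" "s \<in> N_upto G k" "t \<in> N_upto G k"
  shows "nested s t"
  using assms N_level_nested unfolding N_upto_def by blast

section \<open>The tree of a nested set of separations\<close>

lemma successively_flip:
  assumes "successively (adj T) p" "p \<noteq> []" "Q (hd p) \<noteq> Q (last p)"
    and "\<And>x y. adj T x y \<Longrightarrow> Q x \<noteq> Q y \<Longrightarrow> {x, y} = {a, b}"
  shows "a \<in> set p \<and> b \<in> set p"
  using assms(1-3)
proof (induction p rule: induct_list012)
  case (3 x y zs)
  show ?case
  proof (cases "Q x = Q y")
    case True
    then show ?thesis using 3 by auto
  next
    case False
    then have "{x, y} = {a, b}" using 3 assms(4) by simp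
    then show ?thesis by auto
  qed
qed auto

text \<open>A change and a change back would put both \<open>a\<close> and \<open>b\<close> on each
  of the two halves of the path at \<open>t\<close>, but these halves share only
  \<open>t\<close>.\<close>

lemma path_no_flip:
  assumes p: "is_path T p" "Q (hd p) = Q (last p)" and t: "t \<in> set p" and "a \<noteq> b"
    and flip: "\<And>x y. adj T x y \<Longrightarrow> Q x \<noteq> Q y \<Longrightarrow> {x, y} = {a, b}"
  shows "Q t = Q (hd p)"
proof (rule ccontr)
  assume n: "Q t \<noteq> Q (hd p)"
  obtain xs ys where s: "p = xs @ t # ys" using t by (meson split_list)
  have "successively (adj T) (xs @ [t])" "successively (adj T) (t # ys)"
    using p(1) unfolding is_path_def s by (auto simp: successively_append_iff)
  moreover have "hd (xs @ [t]) = hd p" "last (t # ys) = last p" by (auto simp: s hd_append)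
  ultimately have "a \<in> set (xs @ [t]) \<and> b \<in> set (xs @ [t])" "a \<in> set (t # ys) \<and> b \<in> set (t # ys)"
    using successively_flip[of T "xs @ [t]" Q a b] successively_flip[of T "t # ys" Q a b] n p(2) flip by auto
  then show False using p(1) \<open>a \<noteq> b\<close> unfolding is_path_def s by auto
qed

text \<open>Read upwards, the order makes the members of a splitting star the maximal elements of
  the orientation they generate.\<close>

abbreviation osep_le :: "'a osep \<Rightarrow> 'a osep \<Rightarrow> bool" (infix "\<sqsubseteq>" 50) where
  "p \<sqsubseteq> q \<equiv> sep_ge p q"

lemma osep_le_iff: "p \<sqsubseteq> q \<longleftrightarrow> fst p \<subseteq> fst q \<and> snd q \<subseteq> snd p"
  by (auto simp: sep_ge_def split: prod.splits)

lemma osep_le_refl: "p \<sqsubseteq> p"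
  and osep_le_trans: "p \<sqsubseteq> q \<Longrightarrow> q \<sqsubseteq> r \<Longrightarrow> p \<sqsubseteq> r"
  and osep_le_antisym: "p \<sqsubseteq> q \<Longrightarrow> q \<sqsubseteq> p \<Longrightarrow> p = q"
  and osep_le_swap: "p \<sqsubseteq> prod.swap q \<longleftrightarrow> q \<sqsubseteq> prod.swap p"
  and osep_le_swap2: "prod.swap p \<sqsubseteq> q \<longleftrightarrow> prod.swap q \<sqsubseteq> p"
  by (auto simp: osep_le_iff prod_eq_iff)

lemma unor_swap [simp]: "unor (prod.swap p) = unor p"
  by (auto simp: unor_def split: prod.splits)

lemma unor_eq_iff: "unor p = unor q \<longleftrightarrow> p = q \<or> p = prod.swap q"
  by (auto simp: unor_def doubleton_eq_iff split: prod.splits)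

text \<open>What the tree needs from the selected separations: \<open>finite_separating\<close>
  yields finite intervals, and \<open>proper\<close> keeps a separation from being comparable with
  its own inverse.\<close>

locale nested_seps =
  fixes G :: "'a graph" and N :: "'a sep set"
  assumes simple: "simple_graph G"
    and is_sep: "s \<in> N \<Longrightarrow> is_sep G s"
    and proper: "{A, B} \<in> N \<Longrightarrow> A - B \<noteq> {}"
    and nested: "s \<in> N \<Longrightarrow> t \<in> N \<Longrightarrow> nested s t"
    and finite_separating: "finite {s \<in> N. \<exists>A B. s = {A, B} \<and> u \<in> A - B \<and> v \<in> B - A}"
begin

definition oriented :: "'a osep set" where "oriented = {p. unor p \<in> N}"

lemma swap_oriented [simp]: "prod.swap p \<in> oriented \<longleftrightarrow> p \<in> oriented"
  by (simp add: oriented_def)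

lemma oriented_is_osep: "p \<in> oriented \<Longrightarrow> is_osep G p"
  using is_sep[of "unor p"] is_sep_doubleton[of G "fst p" "snd p"] by (cases p) (auto simp: oriented_def unor_def)

lemma oriented_proper:
  assumes "p \<in> oriented" shows "fst p - snd p \<noteq> {}" "snd p - fst p \<noteq> {}"
  using assms proper[of "fst p" "snd p"] proper[of "snd p" "fst p"]
  by (cases p; auto simp: oriented_def unor_def insert_commute)+

lemma not_le_swap:
  assumes "p \<in> oriented" shows "\<not> p \<sqsubseteq> prod.swap p" "\<not> prod.swap p \<sqsubseteq> p"
  using oriented_proper[OF assms] by (auto simp: osep_le_iff)

lemma oriented_nested:
  assumes "p \<in> oriented" "q \<in> oriented"
  shows "p \<sqsubseteq> q \<or> p \<sqsubseteq> prod.swap q \<or> prod.swap p \<sqsubseteq> q \<or> prod.swap p \<sqsubseteq> prod.swap q"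
proof -
  have "nested (unor p) (unor q)" using nested assms by (simp add: oriented_def)
  then have "nested {fst p, snd p} {fst q, snd q}" by (simp add: unor_def split: prod.splits)
  then show ?thesis unfolding nested_doubleton osep_le_iff by auto
qed

lemma finite_oriented_of_finite:
  assumes "finite S" "S \<subseteq> N" shows "finite {p. unor p \<in> S}"
proof (rule finite_subset)
  show "{p. unor p \<in> S} \<subseteq> (\<Union>s\<in>S. s \<times> s)" by (auto simp: unor_def split: prod.splits)
  have "finite s" if "s \<in> S" for s
  proof -
    have "is_sep G s" using that assms(2) is_sep by blast
    then obtain A B where "s = {A, B}" by (rule is_sep_cases)
    then show ?thesis by simp
  qed
  then show "finite (\<Union>s\<in>S. s \<times> s)" using assms(1) by blast
qed

lemma finite_oriented_separating: "finite {p \<in> oriented. u \<in> fst p - snd p \<and> v \<in> snd p - fst p}"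
  by (rule finite_subset[OF _ finite_oriented_of_finite[OF finite_separating[of u v]]])
    (auto simp: oriented_def unor_def split: prod.splits)

text \<open>Every \<open>r\<close> in the interval separates one fixed pair: a vertex strictly on
  the left of \<open>p\<close> from a vertex strictly on the right of \<open>q\<close>.\<close>

lemma finite_interval:
  assumes "p \<in> oriented" "q \<in> oriented" shows "finite {r \<in> oriented. p \<sqsubseteq> r \<and> r \<sqsubseteq> q}"
proof -
  obtain u v where "u \<in> fst p - snd p" "v \<in> snd q - fst q" using oriented_proper assms by blast
  then show ?thesis
    by (intro finite_subset[OF _ finite_oriented_separating[of u v]]) (auto simp: osep_le_iff)
qed

lemma splitting_star_iff:
  "splitting_star N \<sigma> \<longleftrightarrow> (\<forall>p\<in>\<sigma>. \<forall>q\<in>\<sigma>. p \<noteq> q \<longrightarrow> p \<sqsubseteq> prod.swap q) \<and> \<sigma> \<subseteq> oriented \<and>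
     (\<forall>p\<in>\<sigma>. prod.swap p \<notin> \<sigma>) \<and> (\<forall>r\<in>oriented. \<exists>p\<in>\<sigma>. r \<sqsubseteq> p \<or> prod.swap r \<sqsubseteq> p)"
proof -
  have 1: "is_star \<sigma> \<longleftrightarrow> (\<forall>p\<in>\<sigma>. \<forall>q\<in>\<sigma>. p \<noteq> q \<longrightarrow> p \<sqsubseteq> prod.swap q)"
    unfolding is_star_def Ball_def split_paired_All by simp
  have 2: "(\<forall>(A, B)\<in>\<sigma>. {A, B} \<in> N \<and> (B, A) \<notin> \<sigma>) \<longleftrightarrow> \<sigma> \<subseteq> oriented \<and> (\<forall>p\<in>\<sigma>. prod.swap p \<notin> \<sigma>)"
    unfolding oriented_def unor_def Ball_def subset_iff split_paired_All by auto
  have 3: "(\<forall>s\<in>N. \<exists>C D. s = {C, D} \<and> (\<exists>p\<in>\<sigma>. (C, D) \<sqsubseteq> p)) \<longleftrightarrow>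
      (\<forall>r\<in>oriented. \<exists>p\<in>\<sigma>. r \<sqsubseteq> p \<or> prod.swap r \<sqsubseteq> p)" (is "?l = ?r")
  proof
    assume l: ?l
    show ?r
    proof
      fix r assume "r \<in> oriented"
      then obtain C D p where "unor r = {C, D}" "p \<in> \<sigma>" "(C, D) \<sqsubseteq> p" using l by (auto simp: oriented_def)
      then show "\<exists>p\<in>\<sigma>. r \<sqsubseteq> p \<or> prod.swap r \<sqsubseteq> p" using unor_eq_iff[of "(C, D)" r] by (auto simp: unor_def)
    qed
  next
    assume r: ?r
    show ?l
    proof
      fix s assume s: "s \<in> N"
      obtain A B where AB: "s = {A, B}" using is_sep[OF s] by (rule is_sep_cases)
      then have "(A, B) \<in> oriented" using s by (simp add: oriented_def unor_def)
      then obtain p where "p \<in> \<sigma>" "(A, B) \<sqsubseteq> p \<or> (B, A) \<sqsubseteq> p" using r by fastforce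
      then show "\<exists>C D. s = {C, D} \<and> (\<exists>p\<in>\<sigma>. (C, D) \<sqsubseteq> p)" using AB by (metis insert_commute)
    qed
  qed
  show ?thesis unfolding splitting_star_def 1 2 3 by blast
qed

lemma splitting_starD:
  assumes "splitting_star N \<sigma>"
  shows "\<And>p q. p \<in> \<sigma> \<Longrightarrow> q \<in> \<sigma> \<Longrightarrow> p \<noteq> q \<Longrightarrow> p \<sqsubseteq> prod.swap q"
    and "\<And>p. p \<in> \<sigma> \<Longrightarrow> p \<in> oriented" and "\<And>p. p \<in> \<sigma> \<Longrightarrow> prod.swap p \<notin> \<sigma>"
    and "\<And>r. r \<in> oriented \<Longrightarrow> \<exists>p\<in>\<sigma>. r \<sqsubseteq> p \<or> prod.swap r \<sqsubseteq> p"
  using assms unfolding splitting_star_iff by blast+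

text \<open>All of \<open>N\<close> pointed towards the node: the part at a splitting star lies in
  the second component of every element. Nodes are compared through these down-closed sets.\<close>

definition orient :: "'a osep set \<Rightarrow> 'a osep set" where
  "orient \<sigma> = {r \<in> oriented. \<exists>p\<in>\<sigma>. r \<sqsubseteq> p}"

lemma orient_oriented: "r \<in> orient \<sigma> \<Longrightarrow> r \<in> oriented"
  by (simp add: orient_def)

lemma orient_down: "r \<in> orient \<sigma> \<Longrightarrow> r' \<in> oriented \<Longrightarrow> r' \<sqsubseteq> r \<Longrightarrow> r' \<in> orient \<sigma>"
  unfolding orient_def using osep_le_trans by blast

lemma star_subset_orient: "splitting_star N \<sigma> \<Longrightarrow> p \<in> \<sigma> \<Longrightarrow> p \<in> orient \<sigma>"
  unfolding orient_def using splitting_starD(2) osep_le_refl by blast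

lemma orient_swap:
  assumes \<sigma>: "splitting_star N \<sigma>" and r: "r \<in> oriented"
  shows "prod.swap r \<in> orient \<sigma> \<longleftrightarrow> r \<notin> orient \<sigma>"
proof
  assume "prod.swap r \<in> orient \<sigma>"
  then obtain q where q: "q \<in> \<sigma>" "prod.swap r \<sqsubseteq> q" by (auto simp: orient_def)
  show "r \<notin> orient \<sigma>"
  proof
    assume "r \<in> orient \<sigma>"
    then obtain p where p: "p \<in> \<sigma>" "r \<sqsubseteq> p" by (auto simp: orient_def)
    have "prod.swap q \<sqsubseteq> p" using q(2) p(2) osep_le_swap2 osep_le_trans by metis
    show False
    proof (cases "p = q")
      case True
      then show False using not_le_swap(2)[of p] splitting_starD(2)[OF \<sigma> p(1)] \<open>prod.swap q \<sqsubseteq> p\<close> by blast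
    next
      case False
      then have "p \<sqsubseteq> prod.swap q" using splitting_starD(1)[OF \<sigma> p(1) q(1)] by blast
      then have "p = prod.swap q" using \<open>prod.swap q \<sqsubseteq> p\<close> osep_le_antisym by blast
      then show False using splitting_starD(3)[OF \<sigma> q(1)] p(1) by blast
    qed
  qed
next
  assume "r \<notin> orient \<sigma>"
  then show "prod.swap r \<in> orient \<sigma>" using splitting_starD(4)[OF \<sigma> r] r by (auto simp: orient_def)
qed

lemma star_maximal:
  assumes \<sigma>: "splitting_star N \<sigma>" and p: "p \<in> \<sigma>" and r: "r \<in> orient \<sigma>" "p \<sqsubseteq> r"
  shows "r = p"
proof -
  obtain q where q: "q \<in> \<sigma>" "r \<sqsubseteq> q" using r(1) by (auto simp: orient_def)
  have pq: "p \<sqsubseteq> q" using r(2) q(2) osep_le_trans by blast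
  have "p = q"
  proof (rule ccontr)
    assume "p \<noteq> q"
    then have "q \<sqsubseteq> prod.swap p" using splitting_starD(1)[OF \<sigma> q(1) p] by blast
    then show False using pq osep_le_trans not_le_swap(1) splitting_starD(2)[OF \<sigma> p] by blast
  qed
  then show ?thesis using q(2) r(2) osep_le_antisym by blast
qed

text \<open>Both orientations choose exactly one direction of each separation, so inclusion is
  equality, and the star is recovered as the set of maximal elements.\<close>

lemma orient_subset_imp_eq:
  assumes \<sigma>: "splitting_star N \<sigma>" and \<tau>: "splitting_star N \<tau>" and sub: "orient \<sigma> \<subseteq> orient \<tau>"
  shows "\<sigma> = \<tau>"
proof -
  have eq: "orient \<sigma> = orient \<tau>"
    using sub orient_swap[OF \<sigma>] orient_swap[OF \<tau>] orient_oriented by blast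
  have max: "\<rho> = {p \<in> orient \<rho>. \<forall>r\<in>orient \<rho>. p \<sqsubseteq> r \<longrightarrow> r = p}" if \<rho>: "splitting_star N \<rho>" for \<rho>
  proof
    show "\<rho> \<subseteq> {p \<in> orient \<rho>. \<forall>r\<in>orient \<rho>. p \<sqsubseteq> r \<longrightarrow> r = p}"
      using star_maximal[OF \<rho>] star_subset_orient[OF \<rho>] by blast
    show "{p \<in> orient \<rho>. \<forall>r\<in>orient \<rho>. p \<sqsubseteq> r \<longrightarrow> r = p} \<subseteq> \<rho>"
    proof
      fix p assume p: "p \<in> {p \<in> orient \<rho>. \<forall>r\<in>orient \<rho>. p \<sqsubseteq> r \<longrightarrow> r = p}"
      then obtain q where q: "q \<in> \<rho>" "p \<sqsubseteq> q" by (auto simp: orient_def)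
      then have "q = p" using p star_subset_orient[OF \<rho>] by blast
      then show "p \<in> \<rho>" using q by simp
    qed
  qed
  have "\<sigma> = {p \<in> orient \<tau>. \<forall>r\<in>orient \<tau>. p \<sqsubseteq> r \<longrightarrow> r = p}" using max[OF \<sigma>] unfolding eq .
  also have "\<dots> = \<tau>" by (rule max[OF \<tau>, symmetric])
  finally show ?thesis .
qed

text \<open>The only possible orientation of a node containing \<open>p\<close>: whatever lies
  strictly above \<open>p\<close> must be reversed, and its reverse lies strictly below
  \<open>prod.swap p\<close>.\<close>

definition orient_at :: "'a osep \<Rightarrow> 'a osep set" where
  "orient_at p = {r \<in> oriented. r \<sqsubseteq> p \<or> r \<sqsubseteq> prod.swap p \<and> r \<noteq> prod.swap p}"

lemma orient_eq_orient_at: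
  assumes \<sigma>: "splitting_star N \<sigma>" and p: "p \<in> \<sigma>"
  shows "orient \<sigma> = orient_at p"
proof
  show "orient \<sigma> \<subseteq> orient_at p"
  proof
    fix r assume r: "r \<in> orient \<sigma>"
    then obtain q where q: "q \<in> \<sigma>" "r \<sqsubseteq> q" by (auto simp: orient_def)
    have "r \<noteq> prod.swap p"
      using r orient_swap[OF \<sigma> splitting_starD(2)[OF \<sigma> p]] star_subset_orient[OF \<sigma> p] by blast
    moreover have "r \<sqsubseteq> prod.swap p" if "q \<noteq> p"
      using splitting_starD(1)[OF \<sigma> q(1) p that] q(2) osep_le_trans by blast
    ultimately show "r \<in> orient_at p" using q orient_oriented[OF r] unfolding orient_at_def by blast
  qed
  show "orient_at p \<subseteq> orient \<sigma>"
  proof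
    fix r assume "r \<in> orient_at p"
    then have r: "r \<in> oriented" "r \<sqsubseteq> p \<or> r \<sqsubseteq> prod.swap p \<and> r \<noteq> prod.swap p" by (auto simp: orient_at_def)
    show "r \<in> orient \<sigma>"
    proof (rule ccontr)
      assume n: "r \<notin> orient \<sigma>"
      then have "\<not> r \<sqsubseteq> p" using p r(1) by (auto simp: orient_def)
      then have "p \<sqsubseteq> prod.swap r" "r \<noteq> prod.swap p" using r(2) osep_le_swap by blast+
      moreover have "prod.swap r \<in> orient \<sigma>" using orient_swap[OF \<sigma> r(1)] n by blast
      ultimately show False using star_maximal[OF \<sigma> p] by (metis swap_swap)
    qed
  qed
qed

lemma star_unique:
  "splitting_star N \<sigma> \<Longrightarrow> splitting_star N \<tau> \<Longrightarrow> p \<in> \<sigma> \<Longrightarrow> p \<in> \<tau> \<Longrightarrow> \<sigma> = \<tau>"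
  using orient_subset_imp_eq orient_eq_orient_at by (metis subset_refl)

text \<open>The maximal elements of \<open>orient_at p\<close> form the node. An element that is not
  below \<open>p\<close> is below \<open>prod.swap p\<close>, and so are all elements above it;
  intervals being finite, a maximal one lies above it.\<close>

lemma star_exists:
  assumes p: "p \<in> oriented" shows "\<exists>\<sigma>. splitting_star N \<sigma> \<and> p \<in> \<sigma>"
proof -
  define \<sigma> where "\<sigma> = {m \<in> orient_at p. \<forall>r\<in>orient_at p. m \<sqsubseteq> r \<longrightarrow> r = m}"
  have down: "r' \<in> orient_at p" if "r \<in> orient_at p" "r' \<in> oriented" "r' \<sqsubseteq> r" for r r'
    using that osep_le_trans osep_le_antisym unfolding orient_at_def by blast
  have cons: "prod.swap r \<notin> orient_at p" if r: "r \<in> orient_at p" for r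
  proof
    assume "prod.swap r \<in> orient_at p"
    then have a: "prod.swap p \<sqsubseteq> r \<or> p \<sqsubseteq> r \<and> r \<noteq> p"
      unfolding orient_at_def using osep_le_swap2 by (metis (mono_tags, lifting) mem_Collect_eq swap_swap)
    have b: "r \<sqsubseteq> p \<or> r \<sqsubseteq> prod.swap p \<and> r \<noteq> prod.swap p" using r by (simp add: orient_at_def)
    from a b show False using not_le_swap[OF p] osep_le_trans osep_le_antisym by metis
  qed
  have pm: "p \<in> \<sigma>"
    unfolding \<sigma>_def orient_at_def using p osep_le_refl osep_le_antisym osep_le_trans not_le_swap(1)[OF p] by blast
  have below: "\<exists>m\<in>\<sigma>. r \<sqsubseteq> m" if r: "r \<in> orient_at p" for r
  proof (cases "r \<sqsubseteq> p")
    case True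
    then show ?thesis using pm by blast
  next
    case False
    define I where "I = {x \<in> orient_at p. r \<sqsubseteq> x}"
    have "I \<subseteq> {x \<in> oriented. r \<sqsubseteq> x \<and> x \<sqsubseteq> prod.swap p}"
      using False osep_le_trans unfolding I_def orient_at_def by blast
    moreover have "finite {x \<in> oriented. r \<sqsubseteq> x \<and> x \<sqsubseteq> prod.swap p}"
      using r p by (intro finite_interval) (auto simp: orient_at_def)
    ultimately have fI: "finite I" by (rule finite_subset)
    have "r \<in> I" using r osep_le_refl by (simp add: I_def)
    then obtain m where m: "m \<in> I" "\<And>x. x \<in> I \<Longrightarrow> card {y \<in> I. m \<sqsubseteq> y} \<le> card {y \<in> I. x \<sqsubseteq> y}"
      using ex_has_least_nat[of "\<lambda>x. x \<in> I" r "\<lambda>x. card {y \<in> I. x \<sqsubseteq> y}"] by blast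
    have "x = m" if x: "x \<in> orient_at p" "m \<sqsubseteq> x" for x
    proof (rule ccontr)
      assume "x \<noteq> m"
      have xI: "x \<in> I" using x m(1) osep_le_trans unfolding I_def by blast
      have "{y \<in> I. x \<sqsubseteq> y} \<subset> {y \<in> I. m \<sqsubseteq> y}"
      proof
        show "{y \<in> I. x \<sqsubseteq> y} \<subseteq> {y \<in> I. m \<sqsubseteq> y}" using x(2) osep_le_trans by blast
        show "{y \<in> I. x \<sqsubseteq> y} \<noteq> {y \<in> I. m \<sqsubseteq> y}"
          using m(1) osep_le_refl[of m] \<open>x \<noteq> m\<close> x(2) osep_le_antisym by blast
      qed
      then have "card {y \<in> I. x \<sqsubseteq> y} < card {y \<in> I. m \<sqsubseteq> y}" using fI by (intro psubset_card_mono) auto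
      then show False using m(2)[OF xI] by simp
    qed
    then have "m \<in> \<sigma>" "r \<sqsubseteq> m" using m(1) unfolding \<sigma>_def I_def by blast+
    then show ?thesis by blast
  qed
  have "m \<sqsubseteq> prod.swap n" if m: "m \<in> \<sigma>" and n: "n \<in> \<sigma>" and "m \<noteq> n" for m n
  proof -
    have o: "m \<in> oriented" "n \<in> oriented" using m n by (auto simp: \<sigma>_def orient_at_def)
    \<comment> \<open>Of the four comparisons that nestedness allows, maximality excludes two, and
      down-closure together with \<open>cons\<close> a third.\<close>
    have "\<not> m \<sqsubseteq> n" "\<not> n \<sqsubseteq> m" using m n \<open>m \<noteq> n\<close> unfolding \<sigma>_def by blast+
    moreover have "\<not> prod.swap m \<sqsubseteq> n"
      using down[of n "prod.swap m"] cons[of m] m n o unfolding \<sigma>_def by auto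
    ultimately show ?thesis using oriented_nested[OF o] osep_le_swap2 by (metis swap_swap)
  qed
  moreover have "\<sigma> \<subseteq> oriented" unfolding \<sigma>_def orient_at_def by blast
  moreover have "prod.swap m \<notin> \<sigma>" if "m \<in> \<sigma>" for m using that cons unfolding \<sigma>_def by blast
  moreover have "\<exists>m\<in>\<sigma>. r \<sqsubseteq> m \<or> prod.swap r \<sqsubseteq> m" if r: "r \<in> oriented" for r
  proof (cases "r = p \<or> r = prod.swap p")
    case True
    then show ?thesis using pm osep_le_refl by (metis swap_swap)
  next
    case False
    then have ne: "r \<noteq> prod.swap p" "prod.swap r \<noteq> prod.swap p" by (metis swap_swap)+
    have "r \<in> orient_at p \<or> prod.swap r \<in> orient_at p"
      using oriented_nested[OF r p] ne r unfolding orient_at_def by auto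
    then show ?thesis using below by blast
  qed
  ultimately have "splitting_star N \<sigma>" unfolding splitting_star_iff by blast
  then show ?thesis using pm by blast
qed

text \<open>\<open>orient_at p\<close> and \<open>orient_at (prod.swap p)\<close> differ only in the
  direction of \<open>p\<close> itself, so an edge of the tree reverses exactly one
  separation.\<close>

lemma orient_flip:
  assumes \<sigma>: "splitting_star N \<sigma>" "p \<in> \<sigma>" and \<tau>: "splitting_star N \<tau>" "prod.swap p \<in> \<tau>"
  shows "orient \<tau> = insert (prod.swap p) (orient \<sigma> - {p})"
proof -
  have p: "p \<in> oriented" using splitting_starD(2) \<sigma> by blast
  have "orient \<sigma> = orient_at p" "orient \<tau> = orient_at (prod.swap p)"
    using orient_eq_orient_at \<sigma> \<tau> by blast+
  moreover have "p \<noteq> prod.swap p" using not_le_swap(1)[OF p] osep_le_refl[of p] by metis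
  moreover have "r \<in> orient_at (prod.swap p) \<longleftrightarrow> r = prod.swap p \<or> r \<in> orient_at p \<and> r \<noteq> p" for r
  proof -
    consider "r = p" | "r = prod.swap p" | "r \<noteq> p" "r \<noteq> prod.swap p" by blast
    then show ?thesis
    proof cases
      case 1
      then show ?thesis using not_le_swap(1)[OF p] \<open>p \<noteq> prod.swap p\<close> by (simp add: orient_at_def)
    next
      case 2
      then show ?thesis using osep_le_refl[of r] p by (simp add: orient_at_def)
    next
      case 3
      then show ?thesis unfolding orient_at_def swap_swap by blast
    qed
  qed
  ultimately show ?thesis by blast
qed

section \<open>The tree on the splitting stars\<close>

abbreviation T :: "'a osep set graph" where "T \<equiv> decomp_graph (tree_of G N)"

lemma verts_T [simp]: "verts T = {\<sigma>. splitting_star N \<sigma>}"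
  by (simp add: decomp_graph_def tree_of_def)

lemma joins_iff:
  "joins (tree_of G N) s t u \<longleftrightarrow> splitting_star N t \<and> splitting_star N u \<and>
     (\<exists>p. s = unor p \<and> p \<in> t \<and> prod.swap p \<in> u)"
  by (auto simp: tree_of_def unor_def)

lemma adj_T: "adj T t u \<longleftrightarrow> splitting_star N t \<and> splitting_star N u \<and> (\<exists>p. p \<in> t \<and> prod.swap p \<in> u)"
proof
  assume "adj T t u"
  then obtain t' u' s where "{t, u} = {t', u'}" "joins (tree_of G N) s t' u'"
    by (auto simp: adj_def decomp_graph_def)
  then show "splitting_star N t \<and> splitting_star N u \<and> (\<exists>p. p \<in> t \<and> prod.swap p \<in> u)"
    unfolding joins_iff doubleton_eq_iff by (metis swap_swap)
next
  assume a: "splitting_star N t \<and> splitting_star N u \<and> (\<exists>p. p \<in> t \<and> prod.swap p \<in> u)"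
  then obtain p where "p \<in> t" "prod.swap p \<in> u" by blast
  then have "joins (tree_of G N) (unor p) t u" "unor p \<in> N"
    using a splitting_starD(2) unfolding joins_iff oriented_def by blast+
  moreover have "links (tree_of G N) = N" by (simp add: tree_of_def)
  ultimately show "adj T t u" by (auto simp: adj_def decomp_graph_def)
qed

lemma edge_ends_distinct: "splitting_star N t \<Longrightarrow> p \<in> t \<Longrightarrow> prod.swap p \<in> u \<Longrightarrow> t \<noteq> u"
  using splitting_starD(3) by blast

text \<open>An edge reverses only its own separation, and each oriented separation lies in one node
  only. So the bit \<open>p \<in> orient w\<close> shows the edge at \<open>p\<close> to be a
  bridge.\<close>

lemma adj_T_flip:
  assumes t: "splitting_star N t" "p \<in> t" and u: "splitting_star N u" "prod.swap p \<in> u"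
    and xy: "adj T x y" "(p \<in> orient x) \<noteq> (p \<in> orient y)"
  shows "{x, y} = {t, u}"
proof -
  obtain q where q: "splitting_star N x" "splitting_star N y" "q \<in> x" "prod.swap q \<in> y"
    using xy(1) adj_T by blast
  have "orient y = insert (prod.swap q) (orient x - {q})" using orient_flip q by blast
  then have "p = q \<or> p = prod.swap q" using xy(2) by blast
  then show ?thesis
  proof
    assume "p = q"
    then have "x = t" "y = u" using star_unique t u q by blast+
    then show ?thesis by simp
  next
    assume "p = prod.swap q"
    then have "y = t" "x = u" using star_unique t u q by (metis swap_swap)+
    then show ?thesis by auto
  qed
qed

text \<open>With \<open>q\<close> in \<open>\<tau>\<close> above \<open>prod.swap p\<close>, every
  disagreement of the two nodes lies between \<open>prod.swap q\<close> and
  \<open>p\<close>.\<close>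

lemma finite_orient_diff:
  assumes \<sigma>: "splitting_star N \<sigma>" and \<tau>: "splitting_star N \<tau>" and p: "p \<in> \<sigma>" "p \<notin> orient \<tau>"
  shows "finite (orient \<sigma> - orient \<tau>)"
proof -
  have po: "p \<in> oriented" using splitting_starD(2)[OF \<sigma> p(1)] .
  have "prod.swap p \<in> orient \<tau>" using orient_swap[OF \<tau> po] p(2) by blast
  then obtain q where q: "q \<in> \<tau>" "prod.swap p \<sqsubseteq> q" by (auto simp: orient_def)
  have qo: "q \<in> oriented" using splitting_starD(2)[OF \<tau> q(1)] .
  have "prod.swap q \<sqsubseteq> r \<and> r \<sqsubseteq> p" if r: "r \<in> orient \<sigma>" "r \<notin> orient \<tau>" for r
  proof -
    have ro: "r \<in> oriented" using orient_oriented[OF r(1)] .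
    have sr: "prod.swap r \<in> orient \<tau>" using orient_swap[OF \<tau> ro] r(2) by blast
    have "\<not> r \<sqsubseteq> prod.swap p"
      using orient_down[OF sr po] p(2) osep_le_swap by blast
    then have rp: "r \<sqsubseteq> p" using r(1) unfolding orient_eq_orient_at[OF \<sigma> p(1)] orient_at_def by blast
    have "\<not> prod.swap r \<sqsubseteq> prod.swap q"
      using rp q(2) osep_le_trans osep_le_swap2 not_le_swap(2)[OF po] by (metis swap_swap)
    then have "prod.swap r \<sqsubseteq> q" using sr unfolding orient_eq_orient_at[OF \<tau> q(1)] orient_at_def by blast
    then show ?thesis using rp osep_le_swap2 by blast
  qed
  then have "orient \<sigma> - orient \<tau> \<subseteq> {r \<in> oriented. prod.swap q \<sqsubseteq> r \<and> r \<sqsubseteq> p}"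
    using orient_oriented by blast
  then show ?thesis using finite_interval[of "prod.swap q" p] po qo by (auto intro: finite_subset)
qed

text \<open>Crossing the edge of some \<open>p\<close> in \<open>\<sigma>\<close> that points the
  wrong way for \<open>\<tau>\<close> removes \<open>p\<close> from the finite set of disagreements
  and adds nothing.\<close>

lemma linked_T:
  assumes "splitting_star N \<sigma>" "splitting_star N \<tau>" shows "linked T \<sigma> \<tau>"
  using assms
proof (induction "card (orient \<sigma> - orient \<tau>)" arbitrary: \<sigma> rule: less_induct)
  case less
  show ?case
  proof (cases "\<sigma> = \<tau>")
    case True
    then show ?thesis using less.prems by (auto intro: linked_refl)
  next
    case False
    have "\<exists>p\<in>\<sigma>. p \<notin> orient \<tau>"
    proof (rule ccontr)
      assume "\<not> ?thesis"
      then have "orient \<sigma> \<subseteq> orient \<tau>" using orient_down unfolding orient_def[of \<sigma>] by blast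
      then show False using orient_subset_imp_eq[OF less.prems] False by blast
    qed
    then obtain p where p: "p \<in> \<sigma>" "p \<notin> orient \<tau>" by blast
    have po: "p \<in> oriented" using splitting_starD(2)[OF less.prems(1) p(1)] .
    then obtain \<rho> where \<rho>: "splitting_star N \<rho>" "prod.swap p \<in> \<rho>" using star_exists[of "prod.swap p"] by auto
    have "orient \<rho> - orient \<tau> \<subset> orient \<sigma> - orient \<tau>"
      using orient_flip[OF less.prems(1) p(1) \<rho>] orient_swap[OF less.prems(2) po] p(2)
        star_subset_orient[OF less.prems(1) p(1)] edge_ends_distinct[OF less.prems(1) p(1)]
        not_le_swap(1)[OF po] osep_le_refl[of p] by auto
    then have "card (orient \<rho> - orient \<tau>) < card (orient \<sigma> - orient \<tau>)"
      using finite_orient_diff[OF less.prems p] by (intro psubset_card_mono)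
    then have l: "linked T \<rho> \<tau>" using less \<rho> by blast
    have "adj T \<sigma> \<rho>" unfolding adj_T using less.prems \<rho> p(1) by blast
    then have "linked T \<sigma> \<rho>" using less.prems \<rho> by (intro linked_step[OF linked_refl]) auto
    then show ?thesis using l by (rule linked_trans)
  qed
qed

lemma T_nonempty: "\<exists>\<sigma>. splitting_star N \<sigma>"
proof (cases "oriented = {}")
  case True
  then have "splitting_star N {}" unfolding splitting_star_iff by simp
  then show ?thesis by blast
next
  case False
  then show ?thesis using star_exists by blast
qed

lemma is_tree_T: "is_tree T"
proof -
  have "simple_graph T"
    unfolding simple_graph_def
  proof
    fix e assume "e \<in> edges T"
    moreover from this obtain t u where e: "e = {t, u}" by (auto simp: decomp_graph_def)
    ultimately have "adj T t u" by (simp add: adj_def)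
    then have "splitting_star N t" "splitting_star N u" "t \<noteq> u" using adj_T edge_ends_distinct by blast+
    then show "\<exists>u v. u \<in> verts T \<and> v \<in> verts T \<and> u \<noteq> v \<and> e = {u, v}" using e by auto
  qed
  moreover have "connected_graph T" unfolding connected_graph_def using T_nonempty linked_T by auto
  \<comment> \<open>The first edge of a cycle reverses some \<open>p\<close>. The rest of the cycle
    avoids \<open>a\<close> and cannot reverse it back, so the closing edge must do so, and is then
    the first edge again by \<open>adj_T_flip\<close>.\<close>
  moreover have False if c: "is_path T c" "3 \<le> length c" "adj T (last c) (hd c)" for c
  proof -
    obtain a b zs where cs: "c = a # b # zs" "zs \<noteq> []"
      using c(2) by (cases c; cases "tl c"; cases "tl (tl c)") auto
    have "adj T a b" using c(1) cs by (simp add: is_path_def)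
    then obtain p where p: "splitting_star N a" "splitting_star N b" "p \<in> a" "prod.swap p \<in> b"
      using adj_T by blast
    note flip = adj_T_flip[OF p(1,3,2,4)]
    have "(p \<in> orient b) = (p \<in> orient (last c))"
    proof (rule ccontr)
      assume n: "\<not> ?thesis"
      have "successively (adj T) (b # zs)" using c(1) cs by (simp add: is_path_def)
      then have "a \<in> set (b # zs)"
        using successively_flip[of T "b # zs" "\<lambda>w. p \<in> orient w" a b] n cs flip by auto
      then show False using c(1) cs by (simp add: is_path_def)
    qed
    moreover have "p \<in> orient a" "p \<notin> orient b"
      using star_subset_orient p orient_swap[OF p(2) splitting_starD(2)[OF p(1,3)]] by blast+
    ultimately have "{last c, hd c} = {a, b}" using flip[OF c(3)] cs by simp
    then have "last zs = b" using cs c(1) by (auto simp: doubleton_eq_iff is_path_def)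
    then have "b \<in> set zs" using cs(2) last_in_set by blast
    then show False using c(1) cs by (simp add: is_path_def)
  qed
  ultimately show ?thesis unfolding is_tree_def by blast
qed

lemma links_ok_tree_of: "links_ok (tree_of G N)"
proof -
  have links: "links (tree_of G N) = N" and nodes: "nodes (tree_of G N) = {\<sigma>. splitting_star N \<sigma>}"
    by (simp_all add: tree_of_def)
  have ends: "\<exists>t\<in>nodes (tree_of G N). \<exists>u\<in>nodes (tree_of G N). t \<noteq> u \<and> joins (tree_of G N) e t u \<and>
        (\<forall>t' u'. joins (tree_of G N) e t' u' \<longrightarrow> {t', u'} = {t, u})" if e: "e \<in> N" for e
  proof -
    obtain p where p: "e = unor p" "p \<in> oriented"
      using is_sep[OF e] e by (auto simp: is_sep_def oriented_def)
    obtain t where t: "splitting_star N t" "p \<in> t" using star_exists[OF p(2)] by blast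
    obtain u where u: "splitting_star N u" "prod.swap p \<in> u" using star_exists[of "prod.swap p"] p(2) by auto
    have uniq: "{t', u'} = {t, u}" if j: "joins (tree_of G N) e t' u'" for t' u'
    proof -
      obtain q where q: "splitting_star N t'" "splitting_star N u'" "e = unor q" "q \<in> t'" "prod.swap q \<in> u'"
        using j unfolding joins_iff by blast
      then have "q = p \<or> q = prod.swap p" using p(1) unor_eq_iff by metis
      then show ?thesis
      proof
        assume "q = p"
        then have "t' = t" "u' = u" using star_unique q t u by blast+
        then show ?thesis by simp
      next
        assume "q = prod.swap p"
        then have "t' = u" "u' = t" using star_unique q t u by (metis swap_swap)+
        then show ?thesis by auto
      qed
    qed
    have "joins (tree_of G N) e t u" unfolding joins_iff using t u p by blast
    moreover have "t \<in> nodes (tree_of G N)" "u \<in> nodes (tree_of G N)" using t u nodes by simp_all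
    ultimately show ?thesis
      using edge_ends_distinct[OF t u(2)]
      by (intro bexI[of _ t] bexI[of _ u] conjI allI impI) (assumption+, rule uniq)
  qed
  have parallel: "e = f" if j: "joins (tree_of G N) e t u" "joins (tree_of G N) f t u" for e f t u
  proof -
    obtain p where p: "splitting_star N t" "splitting_star N u" "e = unor p" "p \<in> t" "prod.swap p \<in> u"
      using j(1) unfolding joins_iff by blast
    obtain q where q: "f = unor q" "q \<in> t" "prod.swap q \<in> u" using j(2) unfolding joins_iff by blast
    \<comment> \<open>If \<open>p\<close> and \<open>q\<close> differed, the star \<open>u\<close>
      would give \<open>prod.swap p \<sqsubseteq> q\<close> and the star \<open>t\<close> the
      converse, so \<open>t\<close> would contain \<open>p\<close> and its inverse.\<close>
    have "p = q"
    proof (rule ccontr)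
      assume "p \<noteq> q"
      then have "prod.swap p \<noteq> prod.swap q" by (metis swap_swap)
      then have "prod.swap p \<sqsubseteq> q" using splitting_starD(1)[OF p(2) p(5) q(3)] by simp
      moreover have "q \<sqsubseteq> prod.swap p" using splitting_starD(1)[OF p(1) q(2) p(4)] \<open>p \<noteq> q\<close> by blast
      ultimately have "q = prod.swap p" using osep_le_antisym by blast
      then show False using splitting_starD(3)[OF p(1,4)] q(2) by blast
    qed
    then show ?thesis using p q by simp
  qed
  show ?thesis unfolding links_ok_def links
  proof (intro conjI ballI allI impI)
    fix e f t u assume "joins (tree_of G N) e t u \<and> joins (tree_of G N) f t u"
    then show "e = f" by (elim conjE) (rule parallel)
  qed (rule ends)
qed

section \<open>Parts and induced separations\<close>

lemma verts_part:
  "verts (part (tree_of G N) t) = {v \<in> verts G. \<forall>p\<in>t. v \<in> snd p}"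
  by (auto simp: tree_of_def split: prod.splits)

text \<open>Below a star member the second component only grows. Membership in a part can thus be
  tested against any separation, not only those of the star.\<close>

lemma verts_part_orient:
  assumes "splitting_star N t"
  shows "verts (part (tree_of G N) t) = {v \<in> verts G. \<forall>p\<in>orient t. v \<in> snd p}"
  unfolding verts_part using star_subset_orient[OF assms] by (fastforce simp: orient_def osep_le_iff)

text \<open>\<open>W t\<close> collects the separations that point away from \<open>e\<close> at
  \<open>t\<close>. Where their number is least there are none, since crossing the edge of such a
  star member would remove it.\<close>

lemma part_containing:
  assumes e: "finite e" "e \<subseteq> verts G" and side: "\<And>A B. {A, B} \<in> N \<Longrightarrow> e \<subseteq> A \<or> e \<subseteq> B"
  shows "\<exists>t. splitting_star N t \<and> e \<subseteq> verts (part (tree_of G N) t)"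
proof -
  define W where "W t = {p \<in> orient t. \<not> e \<subseteq> snd p}" for t
  have side': "e \<subseteq> fst p" if "p \<in> oriented" "\<not> e \<subseteq> snd p" for p
    using that side[of "fst p" "snd p"] by (auto simp: oriented_def unor_def split: prod.splits)
  obtain t where t: "splitting_star N t" "\<And>u. splitting_star N u \<Longrightarrow> card (W t) \<le> card (W u)"
    using ex_has_least_nat[of "splitting_star N" _ "\<lambda>t. card (W t)"] T_nonempty by blast
  have "W t = {}"
  proof (rule ccontr)
    assume "W t \<noteq> {}"
    then obtain r0 where "r0 \<in> W t" by blast
    moreover from this obtain p where "p \<in> t" "r0 \<sqsubseteq> p" unfolding W_def orient_def by blast
    ultimately have p: "p \<in> t" "\<not> e \<subseteq> snd p" by (auto simp: W_def osep_le_iff)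
    have po: "p \<in> oriented" using splitting_starD(2)[OF t(1) p(1)] .
    obtain w where w: "w \<in> snd p - fst p" using oriented_proper[OF po] by blast
    \<comment> \<open>As \<open>card\<close> is 0 on infinite sets, the strict decrease needs
      \<open>W t\<close> to be finite. Its members lie below \<open>p\<close>, so each separates a
      vertex of the finite set \<open>e\<close> from the fixed vertex \<open>w\<close>.\<close>
    have "W t \<subseteq> (\<Union>u\<in>e. {r \<in> oriented. u \<in> fst r - snd r \<and> w \<in> snd r - fst r})"
    proof
      fix r assume r: "r \<in> W t"
      then have ro: "r \<in> oriented" and re: "\<not> e \<subseteq> snd r" using orient_oriented[of r t] by (auto simp: W_def)
      have "\<not> r \<sqsubseteq> prod.swap p" using side'[OF po p(2)] re by (auto simp: osep_le_iff)
      then have "r \<sqsubseteq> p" using r unfolding W_def orient_eq_orient_at[OF t(1) p(1)] orient_at_def by blast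
      then have "w \<in> snd r - fst r" using w by (auto simp: osep_le_iff)
      moreover obtain u where "u \<in> e" "u \<in> fst r - snd r" using re side'[OF ro re] by blast
      ultimately show "r \<in> (\<Union>u\<in>e. {r \<in> oriented. u \<in> fst r - snd r \<and> w \<in> snd r - fst r})" using ro by blast
    qed
    then have fW: "finite (W t)" by (rule finite_subset) (intro finite_UN_I e(1) finite_oriented_separating)
    obtain u where u: "splitting_star N u" "prod.swap p \<in> u" using star_exists[of "prod.swap p"] po by auto
    have "p \<noteq> prod.swap p" using not_le_swap(1)[OF po] osep_le_refl[of p] by metis
    then have "W u = W t - {p}"
      unfolding W_def orient_flip[OF t(1) p(1) u] using side'[OF po p(2)] by auto
    moreover have "p \<in> W t" using p star_subset_orient[OF t(1)] by (simp add: W_def)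
    ultimately have "card (W u) < card (W t)" using fW by (metis card_Diff1_less)
    then show False using t(2)[OF u(1)] by simp
  qed
  then have "e \<subseteq> verts (part (tree_of G N) t)"
    using e(2) unfolding verts_part_orient[OF t(1)] W_def by fast
  then show ?thesis using t(1) by (intro exI[of _ t] conjI)
qed

lemma tree_decomposition_tree_of: "tree_decomposition G (tree_of G N)"
proof -
  let ?D = "tree_of G N"
  have nodes: "nodes ?D = {\<sigma>. splitting_star N \<sigma>}" by (simp add: tree_of_def)
  have part: "part ?D t = induced G (\<Inter>(A, B)\<in>t. B)" for t by (simp add: tree_of_def)
  have eV: "e \<subseteq> verts G" if e: "e \<in> edges G" for e
  proof -
    obtain u v where "u \<in> verts G" "v \<in> verts G" "e = {u, v}"
      using simple e unfolding simple_graph_def by meson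
    then show ?thesis by simp
  qed
  \<comment> \<open>The intersection over the empty star is the whole type, so the set inducing a
    part is first cut down to \<open>verts G\<close>.\<close>
  have "induced G U = induced G (verts G \<inter> U)" for U
    unfolding induced_def using eV by (simp, blast)
  then have "\<exists>U\<subseteq>verts G. part ?D t = induced G U" for t
    unfolding part by (meson Int_lower1)
  moreover have "(\<Union>t\<in>nodes ?D. verts (part ?D t)) = verts G"
  proof
    show "(\<Union>t\<in>nodes ?D. verts (part ?D t)) \<subseteq> verts G" unfolding verts_part by blast
    show "verts G \<subseteq> (\<Union>t\<in>nodes ?D. verts (part ?D t))"
    proof
      fix v assume v: "v \<in> verts G"
      have "{v} \<subseteq> A \<or> {v} \<subseteq> B" if "{A, B} \<in> N" for A B
        using is_sep[OF that] v is_osepD(1)[of G A B] unfolding is_sep_doubleton by blast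
      then have "\<exists>t. splitting_star N t \<and> {v} \<subseteq> verts (part ?D t)"
        using v by (intro part_containing) auto
      then show "v \<in> (\<Union>t\<in>nodes ?D. verts (part ?D t))" unfolding nodes by blast
    qed
  qed
  moreover have "(\<Union>t\<in>nodes ?D. edges (part ?D t)) = edges G"
  proof
    show "(\<Union>t\<in>nodes ?D. edges (part ?D t)) \<subseteq> edges G" unfolding part induced_def by auto
    show "edges G \<subseteq> (\<Union>t\<in>nodes ?D. edges (part ?D t))"
    proof
      fix e assume e: "e \<in> edges G"
      then obtain u v where uv: "u \<in> verts G" "v \<in> verts G" "e = {u, v}"
        using simple unfolding simple_graph_def by meson
      then have "adj G u v" using e by (simp add: adj_def)
      have "e \<subseteq> A \<or> e \<subseteq> B" if "{A, B} \<in> N" for A B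
      proof -
        have o: "is_osep G (A, B)" using is_sep[OF that] is_sep_doubleton by blast
        show ?thesis using is_osepD(1)[OF o] is_osepD(2,3)[OF o _ _ uv(2) \<open>adj G u v\<close>] uv by blast
      qed
      then have "\<exists>t. splitting_star N t \<and> e \<subseteq> verts (part ?D t)"
        using uv by (intro part_containing) auto
      then obtain t where t: "splitting_star N t" "e \<subseteq> verts (part ?D t)" by blast
      then have "e \<in> edges (part ?D t)" using e unfolding part by (auto simp: induced_def)
      then show "e \<in> (\<Union>t\<in>nodes ?D. edges (part ?D t))" using t(1) unfolding nodes by blast
    qed
  qed
  \<comment> \<open>A vertex missing from the part at \<open>t\<close> is excluded by some
    \<open>p\<close> in \<open>t\<close>. The orientations at both ends of the path omit
    \<open>p\<close>, so by \<open>path_no_flip\<close> the one at \<open>t\<close> would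
    too.\<close>
  moreover have "verts (part ?D (hd c)) \<inter> verts (part ?D (last c)) \<subseteq> verts (part ?D t)"
    if c: "is_path T c" and t: "t \<in> set c" for c t
  proof
    fix v assume v: "v \<in> verts (part ?D (hd c)) \<inter> verts (part ?D (last c))"
    have nd: "splitting_star N w" if "w \<in> set c" for w using c that unfolding is_path_def by auto
    have nds: "splitting_star N (hd c)" "splitting_star N (last c)"
      using nd c by (auto simp: is_path_def)
    have "v \<in> snd p" if p: "p \<in> t" for p
    proof (rule ccontr)
      assume n: "v \<notin> snd p"
      obtain u where u: "splitting_star N u" "prod.swap p \<in> u"
        using star_exists[of "prod.swap p"] splitting_starD(2)[OF nd[OF t] p] by auto
      have "p \<notin> orient (hd c)" "p \<notin> orient (last c)"
        using v n unfolding verts_part_orient[OF nds(1)] verts_part_orient[OF nds(2)] by blast+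
      then have "(p \<in> orient t) = (p \<in> orient (hd c))"
        using path_no_flip[of T c "\<lambda>w. p \<in> orient w" t t u, OF c _ t]
          edge_ends_distinct[OF nd[OF t] p u(2)] adj_T_flip[OF nd[OF t] p u] by blast
      then show False using star_subset_orient[OF nd[OF t] p] \<open>p \<notin> orient (hd c)\<close> by blast
    qed
    then show "v \<in> verts (part ?D t)" using v unfolding verts_part by blast
  qed
  ultimately show ?thesis
    unfolding tree_decomposition_def using links_ok_tree_of is_tree_T by blast
qed

text \<open>On the side of \<open>t\<close> remain exactly the nodes whose orientation contains
  \<open>p\<close>, and their parts lie in \<open>snd p\<close>. Conversely, a vertex of the
  separator lies in the part at \<open>t\<close>; any other vertex of \<open>snd p\<close> lies in
  some part, and its node must contain \<open>p\<close> in its orientation, since the inverse would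
  exclude the vertex.\<close>

lemma cut_side_tree_of:
  assumes t: "splitting_star N t" "p \<in> t" and u: "splitting_star N u" "prod.swap p \<in> u"
  shows "cut_side (tree_of G N) t u = snd p"
proof -
  define T' where "T' = T\<lparr>edges := edges T - {{t, u}}\<rparr>"
  have V': "verts T' = {\<sigma>. splitting_star N \<sigma>}" by (simp add: T'_def)
  have adj': "adj T' x y \<longleftrightarrow> adj T x y \<and> {x, y} \<noteq> {t, u}" for x y by (auto simp: T'_def adj_def)
  note flip = adj_T_flip[OF t u]
  have po: "p \<in> oriented" using splitting_starD(2) t by blast
  have pt: "p \<in> orient t" using star_subset_orient t by blast
  have pu: "p \<notin> orient u" using star_subset_orient[OF u] orient_swap[OF u(1) po] by blast
  have "component_of T' t = {w. splitting_star N w \<and> p \<in> orient w}"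
  proof (intro equalityI subsetI)
    fix w assume "w \<in> component_of T' t"
    then have "linked T' t w" "splitting_star N w" by (auto simp: component_of_def V')
    moreover have "w \<in> {w. p \<in> orient w}"
    proof (rule linked_closed_set[OF calculation(1)])
      fix x y assume "x \<in> {w. p \<in> orient w}" "adj T' x y"
      then show "y \<in> {w. p \<in> orient w}" using flip[of x y] unfolding adj' by auto
    qed (use pt in simp)
    ultimately show "w \<in> {w. splitting_star N w \<and> p \<in> orient w}" by blast
  next
    fix w assume w: "w \<in> {w. splitting_star N w \<and> p \<in> orient w}"
    then obtain c where c: "is_path T c" "hd c = t" "last c = w"
      using linked_T[OF t(1)] unfolding linked_def by blast
    \<comment> \<open>Both ends of the path orient \<open>p\<close> alike and \<open>u\<close> does
      not, so the path avoids \<open>u\<close> and with it the deleted edge.\<close>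
    have "u \<notin> set c"
      using path_no_flip[of T c "\<lambda>w. p \<in> orient w" u t u, OF c(1)] c w pt pu flip
        edge_ends_distinct[OF t u(2)] by blast
    then have "successively (adj T') c"
      using c(1) unfolding is_path_def by (auto simp: adj' doubleton_eq_iff elim!: successively_mono)
    then have "is_path T' c" using c(1) unfolding is_path_def V' by simp
    then show "w \<in> component_of T' t" using c w unfolding component_of_def linked_def V' by blast
  qed
  then have "cut_side (tree_of G N) t u =
      (\<Union>w\<in>{w. splitting_star N w \<and> p \<in> orient w}. verts (part (tree_of G N) w))"
    unfolding cut_side_def Let_def T'_def by simp
  also have "\<dots> = snd p"
  proof (intro equalityI subsetI)
    fix v assume "v \<in> (\<Union>w\<in>{w. splitting_star N w \<and> p \<in> orient w}. verts (part (tree_of G N) w))"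
    then show "v \<in> snd p" using verts_part_orient by blast
  next
    fix v assume v: "v \<in> snd p"
    have VG: "fst p \<union> snd p = verts G" using is_osepD(1)[of G "fst p" "snd p"] oriented_is_osep[OF po] by simp
    show "v \<in> (\<Union>w\<in>{w. splitting_star N w \<and> p \<in> orient w}. verts (part (tree_of G N) w))"
    proof (cases "v \<in> fst p")
      case True
      have "v \<in> snd r" if r: "r \<in> t" for r
      proof (cases "r = p")
        case False
        then have "r \<sqsubseteq> prod.swap p" using splitting_starD(1)[OF t(1) r t(2)] by blast
        then show ?thesis using True by (auto simp: osep_le_iff)
      qed (use v in simp)
      then have "v \<in> verts (part (tree_of G N) t)" using v VG unfolding verts_part by blast
      then show ?thesis using t(1) pt by blast
    next
      case False
      have "(\<Union>w\<in>nodes (tree_of G N). verts (part (tree_of G N) w)) = verts G"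
        using tree_decomposition_tree_of unfolding tree_decomposition_def by (elim conjE)
      moreover have "v \<in> verts G" using v VG by blast
      ultimately have "v \<in> (\<Union>w\<in>nodes (tree_of G N). verts (part (tree_of G N) w))" by (simp only:)
      moreover have "nodes (tree_of G N) = {\<sigma>. splitting_star N \<sigma>}" by (simp add: tree_of_def)
      ultimately obtain w where w: "splitting_star N w" "v \<in> verts (part (tree_of G N) w)" by blast
      have "p \<in> orient w"
      proof (rule ccontr)
        assume "p \<notin> orient w"
        then have "prod.swap p \<in> orient w" using orient_swap[OF w(1) po] by blast
        then have "v \<in> snd (prod.swap p)" using w(2) unfolding verts_part_orient[OF w(1)] by blast
        then show False using False by simp
      qed
      then show ?thesis using w by blast
    qed
  qed
  finally show ?thesis .
qed

lemma induced_seps_tree_of: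
  assumes "s \<in> N" shows "s \<in> induced_seps (tree_of G N)"
proof -
  obtain p where p: "s = unor p" "p \<in> oriented"
    using is_sep[OF assms] assms by (auto simp: is_sep_def oriented_def)
  obtain t where t: "splitting_star N t" "p \<in> t" using star_exists[OF p(2)] by blast
  obtain u where u: "splitting_star N u" "prod.swap p \<in> u" using star_exists[of "prod.swap p"] p(2) by auto
  have "cut_side (tree_of G N) t u = snd p" "cut_side (tree_of G N) u t = fst p"
    using cut_side_tree_of[OF t u] cut_side_tree_of[OF u, of t] t by simp_all
  then have "s = {cut_side (tree_of G N) t u, cut_side (tree_of G N) u t}"
    using p(1) by (auto simp: unor_def split: prod.splits)
  moreover have "joins (tree_of G N) s t u" using t u p joins_iff by blast
  moreover have "links (tree_of G N) = N" by (simp add: tree_of_def)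
  ultimately show ?thesis using assms unfolding induced_seps_def by blast
qed

end

section \<open>Tangles\<close>

lemma tangle_osep:
  assumes "tangle_of_order G n \<tau>" "(A, B) \<in> \<tau>"
  shows "is_osep G (A, B)" "finite (A \<inter> B)" "card (A \<inter> B) < n"
proof -
  have "is_sep G {A, B} \<and> sep_order {A, B} < enat n"
    using assms unfolding tangle_of_order_def orientation_of_def by (auto simp: unor_def)
  then show "is_osep G (A, B)" "finite (A \<inter> B)" "card (A \<inter> B) < n"
    by (auto simp: is_sep_doubleton sep_order_doubleton_less_iff)
qed

lemma tangle_orients:
  assumes "tangle_of_order G n \<tau>" "is_osep G (A, B)" "finite (A \<inter> B)" "card (A \<inter> B) < n"
  shows "(A, B) \<in> \<tau> \<or> (B, A) \<in> \<tau>"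
proof -
  have "{A, B} \<in> {s. is_sep G s \<and> sep_order s < enat n}"
    using assms by (simp add: is_sep_doubleton sep_order_doubleton_less_iff)
  then show ?thesis using assms(1) unfolding tangle_of_order_def orientation_of_def by blast
qed

text \<open>The tangle axiom in terms of adjacency. The three small sides may repeat, so covers by
  one or two sides are excluded as well.\<close>

lemma tangle_no_cover:
  assumes G: "simple_graph G" and \<tau>: "tangle_of_order G n \<tau>"
    and in\<tau>: "(A1, B1) \<in> \<tau>" "(A2, B2) \<in> \<tau>" "(A3, B3) \<in> \<tau>"
    and V: "verts G \<subseteq> A1 \<union> A2 \<union> A3"
    and E: "\<And>u v. adj G u v \<Longrightarrow> u \<in> A1 \<and> v \<in> A1 \<or> u \<in> A2 \<and> v \<in> A2 \<or> u \<in> A3 \<and> v \<in> A3"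
  shows False
proof -
  have "verts (induced G A1) \<union> verts (induced G A2) \<union> verts (induced G A3) = verts G"
    using V by auto
  moreover have "edges (induced G A1) \<union> edges (induced G A2) \<union> edges (induced G A3) = edges G"
  proof
    show "edges G \<subseteq> edges (induced G A1) \<union> edges (induced G A2) \<union> edges (induced G A3)"
    proof
      fix e assume e: "e \<in> edges G"
      then obtain u v where uv: "e = {u, v}" using G unfolding simple_graph_def by meson
      then have "adj G u v" using e by (simp add: adj_def)
      then show "e \<in> edges (induced G A1) \<union> edges (induced G A2) \<union> edges (induced G A3)"
        using E[of u v] e uv by (auto simp: induced_def)
    qed
  qed (auto simp: induced_def)
  moreover have "\<forall>(A1, B1)\<in>\<tau>. \<forall>(A2, B2)\<in>\<tau>. \<forall>(A3, B3)\<in>\<tau>.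
        \<not> (verts (induced G A1) \<union> verts (induced G A2) \<union> verts (induced G A3) = verts G \<and>
           edges (induced G A1) \<union> edges (induced G A2) \<union> edges (induced G A3) = edges G)"
    using \<tau> unfolding tangle_of_order_def by (elim conjE)
  ultimately show False using in\<tau> by fast
qed

lemma tangle_not_whole:
  assumes "simple_graph G" "tangle_of_order G n \<tau>" "(A, B) \<in> \<tau>"
  shows "A \<noteq> verts G"
  using tangle_no_cover[OF assms assms(3) assms(3)] simple_graph_adjD[OF assms(1)] by blast

lemma distinguishes_sym: "distinguishes s \<tau> \<tau>' \<longleftrightarrow> distinguishes s \<tau>' \<tau>"
  unfolding distinguishes_def by (metis insert_commute)

lemma distinguishesI:
  assumes "simple_graph G" "tangle_of_order G n \<tau>" "(A, B) \<in> \<tau>" "(B, A) \<in> \<tau>'"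
  shows "distinguishes {A, B} \<tau> \<tau>'"
proof -
  have "A \<noteq> B" using tangle_not_whole[OF assms(1-3)] is_osepD(1)[OF tangle_osep(1)[OF assms(2,3)]] by blast
  then show ?thesis using assms(3,4) unfolding distinguishes_def by blast
qed

text \<open>Otherwise each component \<open>K\<close> of \<open>G - X\<close> inside
  \<open>A\<close> has fewer than \<open>card X\<close> neighbours, so its separation is too small
  to distinguish the tangles. As \<open>A\<close> is small for \<open>\<tau>\<close>, so is
  \<open>K\<close> with its neighbours, and hence also for \<open>\<tau>'\<close>. Now
  \<open>\<tau>'\<close> absorbs these components into its small side \<open>B\<close> until all of
  \<open>G\<close> is small.\<close>

lemma efficient_distinguisher_tight_component:
  assumes G: "simple_graph G" "locally_finite G" "connected_graph G"
    and \<tau>: "tangle_of_order G n \<tau>" and \<tau>': "tangle_of_order G n' \<tau>'"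
    and AB: "(A, B) \<in> \<tau>" "(B, A) \<in> \<tau>'"
    and eff: "\<And>s. distinguishes s \<tau> \<tau>' \<Longrightarrow> enat (card (A \<inter> B)) \<le> sep_order s"
  shows "\<exists>K. tight_component G (A \<inter> B) K \<and> K \<subseteq> A"
proof (rule ccontr)
  assume none: "\<not> ?thesis"
  define X where "X = A \<inter> B"
  define \<K> where "\<K> = {K \<in> components (induced G (verts G - X)). K \<subseteq> A}"
  note o = tangle_osep[OF \<tau> AB(1)] and o' = tangle_osep[OF \<tau>' AB(2)]
  have VG: "A \<union> B = verts G" using is_osepD(1)[OF o(1)] .
  have Xn: "finite X" "card X < n" "card X < n'" using o o' by (auto simp: X_def Int_commute)
  have XV: "X \<subseteq> verts G" using VG by (auto simp: X_def)
  have X: "X \<noteq> {}"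
  proof
    assume "X = {}"
    then have d: "A \<inter> B = {}" by (simp add: X_def)
    have "A \<inter> verts G \<noteq> {}" using tangle_not_whole[OF G(1) \<tau>' AB(2)] VG by blast
    then have "verts G \<subseteq> A"
      by (rule connected_graph_closed_set[OF G(3)]) (use is_osepD(2)[OF o(1)] d in blast)
    then show False using tangle_not_whole[OF G(1) \<tau> AB(1)] VG by blast
  qed
  have K: "K \<noteq> {}" "K \<subseteq> A - X" "K \<subseteq> verts G" "nbhd G K \<subseteq> X" "nbhd G K \<noteq> X"
    "\<And>u v. u \<in> K \<Longrightarrow> adj G u v \<Longrightarrow> v \<in> K \<or> v \<in> nbhd G K" if "K \<in> \<K>" for K
  proof -
    have c: "K \<in> components (induced G (verts G - X))" "K \<subseteq> A" using that by (auto simp: \<K>_def)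
    show "K \<noteq> {}" "K \<subseteq> A - X" "K \<subseteq> verts G" using component_nonempty[OF c(1)] component_subset[OF c(1)] c(2) by auto
    show "nbhd G K \<subseteq> X"
    proof
      fix v assume "v \<in> nbhd G K"
      then obtain u where u: "v \<in> verts G" "v \<notin> K" "u \<in> K" "adj G u v" by (auto simp: nbhd_def)
      then show "v \<in> X"
        using component_adj_closed[OF c(1) u(3), of v] component_subset[OF c(1)] by auto
    qed
    show "nbhd G K \<noteq> X" using none c unfolding tight_component_def X_def by blast
    show "v \<in> K \<or> v \<in> nbhd G K" if "u \<in> K" "adj G u v" for u v
      using that simple_graph_adjD(2)[OF G(1) that(2)] unfolding nbhd_def by blast
  qed
  have small: "(K \<union> nbhd G K, verts G - K) \<in> \<tau>'" if KK: "K \<in> \<K>" for K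
  proof (rule ccontr)
    assume no: "(K \<union> nbhd G K, verts G - K) \<notin> \<tau>'"
    note k = K[OF KK]
    have NK: "nbhd G K \<subseteq> verts G - K" by (auto simp: nbhd_def)
    have os: "is_osep G (K \<union> nbhd G K, verts G - K)"
      using k(3) k(6) NK by (intro is_osepI) blast+
    have int: "(K \<union> nbhd G K) \<inter> (verts G - K) = nbhd G K" using NK by blast
    have lt: "card (nbhd G K) < card X" using k(4,5) Xn(1) by (simp add: psubset_card_mono psubset_eq)
    have fin: "finite (nbhd G K)" using k(4) Xn(1) finite_subset by blast
    have big: "(verts G - K, K \<union> nbhd G K) \<in> \<tau>'"
      using tangle_orients[OF \<tau>' os] no fin lt Xn(3) unfolding int by linarith
    have "(K \<union> nbhd G K, verts G - K) \<notin> \<tau>"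
    proof
      assume "(K \<union> nbhd G K, verts G - K) \<in> \<tau>"
      then have "distinguishes {K \<union> nbhd G K, verts G - K} \<tau> \<tau>'"
        using big by (rule distinguishesI[OF G(1) \<tau>])
      then have "enat (card X) \<le> sep_order {K \<union> nbhd G K, verts G - K}" using eff unfolding X_def by blast
      moreover have "sep_order {K \<union> nbhd G K, verts G - K} = enat (card (nbhd G K))"
        unfolding sep_order_doubleton_eq_iff int using fin by simp
      ultimately show False using lt by simp
    qed
    then have "(verts G - K, K \<union> nbhd G K) \<in> \<tau>"
      using tangle_orients[OF \<tau> os] fin lt Xn(2) unfolding int by linarith
    then show False
    proof (rule tangle_no_cover[OF G(1) \<tau> AB(1) AB(1)])
      show "verts G \<subseteq> A \<union> A \<union> (verts G - K)" using k(2) by blast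
      have KA: "v \<in> A" if "u \<in> K" "adj G u v" for u v
        using k(6)[OF that] k(2,4) unfolding X_def by blast
      fix u v assume uv: "adj G u v"
      then show "u \<in> A \<and> v \<in> A \<or> u \<in> A \<and> v \<in> A \<or> u \<in> verts G - K \<and> v \<in> verts G - K"
        using KA[of u v] KA[of v u] k(2) simple_graph_adjD(1,2)[OF G(1) uv] adj_sym[of G u v] by blast
    qed
  qed
  \<comment> \<open>The separator stays \<open>X\<close>, so \<open>\<tau>'\<close> orients each of
    these separations. The reverse direction is impossible: the rest of \<open>A\<close>, the old
    small side and \<open>K \<union> nbhd G K\<close> would cover \<open>G\<close>.\<close>
  have step: "(B \<union> \<Union>F, A - \<Union>F) \<in> \<tau>'" if "finite F" "F \<subseteq> \<K>" for F
    using that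
  proof (induction F rule: finite_induct)
    case empty
    then show ?case using AB(2) by simp
  next
    case (insert K F)
    have F: "(B \<union> \<Union>F, A - \<Union>F) \<in> \<tau>'" and KK: "K \<in> \<K>" using insert by auto
    note k = K[OF KK]
    have sub: "\<Union>(insert K F) \<subseteq> A - X" using insert.prems K(2) by blast
    have closed: "v \<in> \<Union>(insert K F) \<or> v \<in> X" if "u \<in> \<Union>(insert K F)" "adj G u v" for u v
    proof -
      obtain L where L: "L \<in> insert K F" "u \<in> L" using \<open>u \<in> \<Union>(insert K F)\<close> by blast
      then have "L \<in> \<K>" using insert.prems by blast
      then show ?thesis using K(6)[of L u v] K(4)[of L] L \<open>adj G u v\<close> by blast
    qed
    let ?U = "\<Union>(insert K F)"
    have os: "is_osep G (B \<union> ?U, A - ?U)"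
    proof -
      have "B \<union> ?U \<union> (A - ?U) = verts G" using VG sub by blast
      moreover have "\<not> adj G u v" if "u \<in> B \<union> ?U - (A - ?U)" "v \<in> A - ?U - (B \<union> ?U)" for u v
      proof
        assume uv: "adj G u v"
        have v: "v \<in> A" "v \<notin> B" "v \<notin> ?U" "v \<notin> X" using that(2) unfolding X_def by blast+
        show False
        proof (cases "u \<in> ?U")
          case True
          then show False using closed[OF True uv] v by blast
        next
          case False
          then have "u \<in> B" "u \<notin> A" using that(1) by blast+
          then show False using is_osepD(3)[OF o(1)] uv v(2) simple_graph_adjD(2)[OF G(1) uv] by blast
        qed
      qed
      ultimately show ?thesis by (rule is_osepI)
    qed
    have int: "(B \<union> ?U) \<inter> (A - ?U) = X" using sub unfolding X_def by blast
    have "(A - ?U, B \<union> ?U) \<notin> \<tau>'"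
    proof
      assume a: "(A - ?U, B \<union> ?U) \<in> \<tau>'"
      show False
      proof (rule tangle_no_cover[OF G(1) \<tau>' F small[OF KK] a])
        show "verts G \<subseteq> B \<union> \<Union>F \<union> (K \<union> nbhd G K) \<union> (A - ?U)" using VG by blast
        have main: "u \<in> B \<union> \<Union>F \<and> v \<in> B \<union> \<Union>F \<or> u \<in> K \<union> nbhd G K \<and> v \<in> K \<union> nbhd G K"
          if uv: "adj G u v" and u: "u \<notin> A - ?U" for u v
        proof -
          have V: "u \<in> verts G" "v \<in> verts G" using simple_graph_adjD[OF G(1) uv] by blast+
          consider "u \<in> K" | "u \<in> \<Union>F" "u \<notin> K" | "u \<in> B" "u \<notin> A" using u V VG by blast
          then show ?thesis
          proof cases
            case 1
            then show ?thesis using k(6)[OF 1 uv] by blast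
          next
            case 2
            then obtain L where L: "u \<in> L" "L \<in> F" by blast
            then have "L \<in> \<K>" using insert.prems by blast
            then have "v \<in> L \<or> v \<in> X" using K(6)[of L u v] K(4)[of L] L uv by blast
            then show ?thesis using L unfolding X_def by blast
          next
            case 3
            then show ?thesis using is_osepD(3)[OF o(1) 3 V(2) uv] by blast
          qed
        qed
        fix u v assume uv: "adj G u v"
        then have vu: "adj G v u" using adj_sym by metis
        show "u \<in> B \<union> \<Union>F \<and> v \<in> B \<union> \<Union>F \<or> u \<in> K \<union> nbhd G K \<and> v \<in> K \<union> nbhd G K \<or> u \<in> A - ?U \<and> v \<in> A - ?U"
        proof (cases "u \<in> A - ?U")
          case True
          then show ?thesis using main[OF vu] by (cases "v \<in> A - ?U") (simp, metis)
        next
          case False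
          then show ?thesis using main[OF uv] by metis
        qed
      qed
    qed
    then show ?case using tangle_orients[OF \<tau>' os] Xn unfolding int by blast
  qed
  \<comment> \<open>Distinct components give distinct separations with separator \<open>X\<close>,
    and there are finitely many of those.\<close>
  have "finite \<K>"
  proof (rule inj_on_finite[where f = "\<lambda>K. K \<union> X"])
    show "inj_on (\<lambda>K. K \<union> X) \<K>" using K(2) by (intro inj_onI) blast
    have "is_osep G (K \<union> X, verts G - K) \<and> (K \<union> X) \<inter> (verts G - K) = X" if "K \<in> \<K>" for K
    proof -
      have "\<not> adj G u v" if "u \<in> K \<union> X - (verts G - K)" "v \<in> verts G - K - (K \<union> X)" for u v
        using that K(4,6)[OF \<open>K \<in> \<K>\<close>] XV by blast
      moreover have "K \<union> X \<union> (verts G - K) = verts G" "(K \<union> X) \<inter> (verts G - K) = X"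
        using K(2,3)[OF that] XV by blast+
      ultimately show ?thesis using is_osepI[of "K \<union> X"] by blast
    qed
    then show "(\<lambda>K. K \<union> X) ` \<K> \<subseteq> {A. \<exists>B. is_osep G (A, B) \<and> A \<inter> B = X}" by blast
  qed (rule finite_seps_with_separator[OF G Xn(1) X])
  then have big: "(B \<union> \<Union>\<K>, A - \<Union>\<K>) \<in> \<tau>'" using step by blast
  have "a \<in> \<Union>\<K>" if a: "a \<in> A - B" for a
  proof -
    let ?H = "induced G (verts G - X)"
    have aH: "a \<in> verts ?H" using a VG by (auto simp: X_def)
    let ?K = "component_of ?H a"
    note c = in_some_component[OF aH]
    have "?K \<inter> (A \<inter> B) = {}" using component_subset[OF c(1)] by (auto simp: X_def)
    then have "?K \<subseteq> A" using component_one_side[OF o(1) c(1)] c(2) a by blast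
    then show ?thesis using c unfolding \<K>_def by blast
  qed
  then have "B \<union> \<Union>\<K> = verts G" using VG K(3) by blast
  then show False using tangle_not_whole[OF G(1) \<tau>' big] by contradiction
qed

text \<open>If neither of the other two distinguishes, the tangles agree on both. \<open>B1\<close>
  is small for \<open>\<tau>'\<close> and covers \<open>G\<close> together with \<open>B2\<close> or
  with \<open>B3\<close>, so the agreed small sides are \<open>A2\<close> and \<open>A3\<close>.
  With \<open>A1\<close> they cover \<open>G\<close>, against \<open>\<tau>\<close>.\<close>

lemma top_star_distinguishes:
  assumes G: "simple_graph G" and \<tau>: "tangle_of_order G n \<tau>" and \<tau>': "tangle_of_order G n' \<tau>'"
    and star: "top_star G (A1, B1) (A2, B2) (A3, B3)"
    and 1: "(A1, B1) \<in> \<tau>" "(B1, A1) \<in> \<tau>'"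
    and fin: "finite (A2 \<inter> B2)" "finite (A3 \<inter> B3)"
    and less: "card (A2 \<inter> B2) < n" "card (A2 \<inter> B2) < n'" "card (A3 \<inter> B3) < n" "card (A3 \<inter> B3) < n'"
  shows "distinguishes {A2, B2} \<tau> \<tau>' \<or> distinguishes {A3, B3} \<tau> \<tau>'"
proof (rule ccontr)
  assume no: "\<not> ?thesis"
  have o: "is_osep G (A1, B1)" "is_osep G (A2, B2)" "is_osep G (A3, B3)"
    and disj: "(A1 - B1) \<inter> (A2 - B2) = {}" "(A1 - B1) \<inter> (A3 - B3) = {}"
    and cover: "(A1 - B1) \<union> (A2 - B2) \<union> (A3 - B3) = verts G - (A1 \<inter> B1 \<union> A2 \<inter> B2 \<union> A3 \<inter> B3)"
    and X: "A1 \<inter> B1 \<subseteq> A2 \<inter> B2 \<union> A3 \<inter> B3" "A2 \<inter> B2 \<subseteq> A1 \<inter> B1 \<union> A3 \<inter> B3"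
      "A3 \<inter> B3 \<subseteq> A1 \<inter> B1 \<union> A2 \<inter> B2"
    using star unfolding top_star_def Let_def prod.case by - (elim conjE, assumption)+
  have VG: "A1 \<union> B1 = verts G" "A2 \<union> B2 = verts G" "A3 \<union> B3 = verts G" using o is_osepD(1) by blast+
  have A: "(A, B) \<in> \<tau>" if AB: "is_osep G (A, B)" "finite (A \<inter> B)" "card (A \<inter> B) < n" "card (A \<inter> B) < n'"
    and d: "(A1 - B1) \<inter> A = {}" and nd: "\<not> distinguishes {A, B} \<tau> \<tau>'" for A B
  proof -
    have "(B, A) \<notin> \<tau>'"
    proof
      assume "(B, A) \<in> \<tau>'"
      then show False
      proof (rule tangle_no_cover[OF G \<tau>' 1(2) 1(2)])
        have "A \<union> B = verts G" using is_osepD(1)[OF AB(1)] .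
        then show "verts G \<subseteq> B1 \<union> B1 \<union> B" using d VG(1) by blast
        have main: "u \<in> B \<and> v \<in> B" if uv: "adj G u v" and u: "u \<notin> B1" for u v
        proof -
          have V: "u \<in> verts G" "v \<in> verts G" using simple_graph_adjD[OF G uv] by blast+
          then have "u \<in> B" "u \<notin> A" using u d VG(1) is_osepD(1)[OF AB(1)] by blast+
          then show ?thesis using is_osepD(3)[OF AB(1) _ _ V(2) uv] by blast
        qed
        fix u v assume "adj G u v"
        then show "u \<in> B1 \<and> v \<in> B1 \<or> u \<in> B1 \<and> v \<in> B1 \<or> u \<in> B \<and> v \<in> B"
          using main[of u v] main[of v u] adj_sym[of G u v] by blast
      qed
    qed
    then have in': "(A, B) \<in> \<tau>'" using tangle_orients[OF \<tau>' AB(1,2,4)] by blast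
    have "(B, A) \<notin> \<tau>"
    proof
      assume "(B, A) \<in> \<tau>"
      then have "distinguishes {B, A} \<tau> \<tau>'" using in' by (rule distinguishesI[OF G \<tau>])
      then show False using nd by (simp add: insert_commute)
    qed
    then show ?thesis using tangle_orients[OF \<tau> AB(1,2,3)] by blast
  qed
  have "(A1 - B1) \<inter> A2 = {}" "(A1 - B1) \<inter> A3 = {}" using disj cover by blast+
  then have 2: "(A2, B2) \<in> \<tau>" and 3: "(A3, B3) \<in> \<tau>"
    using A[OF o(2) fin(1) less(1,2)] A[OF o(3) fin(2) less(3,4)] no by blast+
  show False
  proof (rule tangle_no_cover[OF G \<tau> 1(1) 2 3])
    show "verts G \<subseteq> A1 \<union> A2 \<union> A3" using cover by blast
    have main: "u \<in> A1 \<and> v \<in> A1 \<or> u \<in> A2 \<and> v \<in> A2 \<or> u \<in> A3 \<and> v \<in> A3"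
      if uv: "adj G u v" and u: "u \<notin> A1 \<inter> B1 \<union> A2 \<inter> B2 \<union> A3 \<inter> B3" for u v
    proof -
      have V: "u \<in> verts G" "v \<in> verts G" using simple_graph_adjD[OF G uv] by blast+
      then consider "u \<in> A1" "u \<notin> B1" | "u \<in> A2" "u \<notin> B2" | "u \<in> A3" "u \<notin> B3" using u cover by blast
      then show ?thesis
        by cases (use is_osepD(2)[OF o(1) _ _ V(2) uv] is_osepD(2)[OF o(2) _ _ V(2) uv]
            is_osepD(2)[OF o(3) _ _ V(2) uv] in blast)+
    qed
    fix u v assume uv: "adj G u v"
    show "u \<in> A1 \<and> v \<in> A1 \<or> u \<in> A2 \<and> v \<in> A2 \<or> u \<in> A3 \<and> v \<in> A3"
    proof (cases "u \<in> A1 \<inter> B1 \<union> A2 \<inter> B2 \<union> A3 \<inter> B3 \<and> v \<in> A1 \<inter> B1 \<union> A2 \<inter> B2 \<union> A3 \<inter> B3")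
      case True
      \<comment> \<open>Each of the two vertices lies in two of the three separators, so they share one.\<close>
      have two: "w \<in> A1 \<and> w \<in> A2 \<or> w \<in> A1 \<and> w \<in> A3 \<or> w \<in> A2 \<and> w \<in> A3"
        if "w \<in> A1 \<inter> B1 \<union> A2 \<inter> B2 \<union> A3 \<inter> B3" for w using that X by blast
      then show ?thesis using True two[of u] two[of v] by (elim conjE) metis
    next
      case False
      then show ?thesis using main[of u v] main[of v u] uv adj_sym[of G u v] by metis
    qed
  qed
qed

text \<open>As \<open>k\<close> is the least order of a distinguisher, efficiency amounts to
  distinguishing with order at most \<open>k\<close>. A constituent of order at most
  \<open>k\<close> therefore only has to distinguish, and \<open>top_star_distinguishes\<close>
  finds one that does.\<close>

lemma efficient_distinguishers_bottleneck:
  assumes G: "simple_graph G" "locally_finite G" "connected_graph G"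
    and \<tau>: "tangle_of_order G n \<tau>" and \<tau>': "tangle_of_order G n' \<tau>'"
    and s0: "distinguishes_efficiently s0 \<tau> \<tau>'" "sep_order s0 = enat k"
  shows "bottleneck G k {s. distinguishes_efficiently s \<tau> \<tau>'}"
proof -
  define \<beta> where "\<beta> = {s. distinguishes_efficiently s \<tau> \<tau>'}"
  have \<beta>_iff: "s \<in> \<beta> \<longleftrightarrow> distinguishes s \<tau> \<tau>' \<and> sep_order s \<le> enat k" for s
    using s0 order_trans[of "sep_order s" "sep_order s0"] order_antisym
    unfolding \<beta>_def distinguishes_efficiently_def by auto
  have eff: "enat k \<le> sep_order s" if "distinguishes s \<tau> \<tau>'" for s
    using s0 that unfolding distinguishes_efficiently_def by auto
  have elem: "is_sep G s \<and> tight G s \<and> sep_order s = enat k" if s: "s \<in> \<beta>" for s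
  proof -
    obtain A B where AB: "s = {A, B}" "(A, B) \<in> \<tau>" "(B, A) \<in> \<tau>'"
      using s unfolding \<beta>_iff distinguishes_def by blast
    have ord: "sep_order s = enat k" using s eff order_antisym unfolding \<beta>_iff by blast
    then have card: "card (A \<inter> B) = k" "card (B \<inter> A) = k" unfolding AB(1) sep_order_doubleton_eq_iff by (auto simp: Int_commute)
    have "\<exists>K. tight_component G (A \<inter> B) K \<and> K \<subseteq> A"
      using eff card by (intro efficient_distinguisher_tight_component[OF G \<tau> \<tau>' AB(2,3)]) simp
    moreover have "\<exists>L. tight_component G (B \<inter> A) L \<and> L \<subseteq> B"
      using eff card distinguishes_sym[of _ \<tau> \<tau>']
      by (intro efficient_distinguisher_tight_component[OF G \<tau>' \<tau> AB(3,2)]) simp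
    ultimately have "tight G s" unfolding AB(1) tight_doubleton by (simp add: Int_commute)
    moreover have "is_sep G s" using tangle_osep(1)[OF \<tau> AB(2)] AB(1) by (simp add: is_sep_doubleton)
    ultimately show ?thesis using ord by blast
  qed
  moreover have "unor p2 \<in> \<beta> \<or> unor p3 \<in> \<beta>"
    if star: "relevant_top_star G p1 p2 p3" and le: "\<forall>p\<in>{p1, p2, p3}. sep_order (unor p) \<le> enat k"
      and p1: "unor p1 \<in> \<beta>" for p1 p2 p3
  proof -
    obtain A1 B1 A2 B2 A3 B3 where p: "p1 = (A1, B1)" "p2 = (A2, B2)" "p3 = (A3, B3)"
      by (cases p1; cases p2; cases p3) blast
    have ts: "top_star G (A1, B1) (A2, B2) (A3, B3)"
      using star unfolding p relevant_top_star_def prod.case by blast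
    have fin: "finite (A2 \<inter> B2)" "card (A2 \<inter> B2) \<le> k" "finite (A3 \<inter> B3)" "card (A3 \<inter> B3) \<le> k"
      using le unfolding p by (auto simp: unor_def sep_order_doubleton_le_iff)
    have ord1: "card (A1 \<inter> B1) = k" "card (B1 \<inter> A1) = k"
      using elem[OF p1] unfolding p unor_def prod.case sep_order_doubleton_eq_iff by (auto simp: Int_commute)
    have "distinguishes {A1, B1} \<tau> \<tau>'" using p1 unfolding \<beta>_iff p unor_def by simp
    then consider "(A1, B1) \<in> \<tau>" "(B1, A1) \<in> \<tau>'" | "(A1, B1) \<in> \<tau>'" "(B1, A1) \<in> \<tau>"
      unfolding distinguishes_def doubleton_eq_iff by blast
    then have "distinguishes {A2, B2} \<tau> \<tau>' \<or> distinguishes {A3, B3} \<tau> \<tau>'"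
    proof cases
      case 1
      have "k < n" "k < n'" using tangle_osep(3)[OF \<tau> 1(1)] tangle_osep(3)[OF \<tau>' 1(2)] ord1 by auto
      then show ?thesis using fin by (intro top_star_distinguishes[OF G(1) \<tau> \<tau>' ts 1]) auto
    next
      case 2
      have "k < n" "k < n'" using tangle_osep(3)[OF \<tau>' 2(1)] tangle_osep(3)[OF \<tau> 2(2)] ord1 by auto
      then have "distinguishes {A2, B2} \<tau>' \<tau> \<or> distinguishes {A3, B3} \<tau>' \<tau>"
        using fin by (intro top_star_distinguishes[OF G(1) \<tau>' \<tau> ts 2]) auto
      then show ?thesis using distinguishes_sym by blast
    qed
    then show ?thesis using le unfolding \<beta>_iff p unor_def by auto
  qed
  moreover have "\<beta> \<noteq> {}" using s0(1) unfolding \<beta>_def by blast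
  ultimately show ?thesis unfolding bottleneck_def \<beta>_def[symmetric] by blast
qed

lemma efficient_distinguisher_exists:
  assumes "distinguishable_upto k \<tau> \<tau>'"
  obtains s j where "distinguishes_efficiently s \<tau> \<tau>'" "sep_order s = enat j" "j \<le> k"
proof -
  define M where "M = {s. distinguishes s \<tau> \<tau>'}"
  define m where "m = (LEAST m. m \<in> sep_order ` M)"
  obtain s0 where s0: "sep_order s0 \<le> enat k" "s0 \<in> M"
    using assms unfolding distinguishable_upto_def M_def by blast
  then have "sep_order s0 \<in> sep_order ` M" by blast
  then have "m \<in> sep_order ` M" unfolding m_def by (rule LeastI)
  then obtain s where s: "s \<in> M" "m = sep_order s" by blast
  have min: "m \<le> sep_order s'" if "s' \<in> M" for s' unfolding m_def using that by (intro Least_le) blast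
  then have "distinguishes_efficiently s \<tau> \<tau>'" using s unfolding distinguishes_efficiently_def M_def by blast
  moreover have "sep_order s \<le> enat k" using min[OF s0(2)] s0(1) s(2) by (metis order_trans)
  moreover then obtain j where "sep_order s = enat j" by (cases "sep_order s") auto
  ultimately show thesis using that by auto
qed

section \<open>The tree of tangles\<close>

lemma nested_seps_N_upto:
  assumes "simple_graph G" "locally_finite G" "connected_graph G"
  shows "nested_seps G (N_upto G k)"
proof
  show "simple_graph G" by (rule assms(1))
  show "is_sep G s" if "s \<in> N_upto G k" for s
    using N_upto_subset_tight_seps[of G k] that by (auto simp: tight_seps_def)
  show "A - B \<noteq> {}" if "{A, B} \<in> N_upto G k" for A B
    using N_upto_subset_tight_seps[of G k] that tight_sides_nonempty(1)[of G A B]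
    by (auto simp: tight_seps_def)
  show "nested s t" if "s \<in> N_upto G k" "t \<in> N_upto G k" for s t
    using N_upto_nested[OF assms] that by blast
  show "finite {s \<in> N_upto G k. \<exists>A B. s = {A, B} \<and> u \<in> A - B \<and> v \<in> B - A}" for u v
    by (rule finite_subset[OF _ finite_tight_seps_separating[OF assms, of k u v]])
      (use N_upto_subset_tight_seps[of G k] in blast)
qed

theorem theorem3p12:
  fixes G :: "'a graph" and k :: nat
  assumes "simple_graph G" and "locally_finite G" and "connected_graph G"
  shows "tree_of_tangles G k (tree_of G (N_upto G k))"
proof -
  interpret nested_seps G "N_upto G k" by (rule nested_seps_N_upto[OF assms])
  have "\<exists>s\<in>induced_seps (tree_of G (N_upto G k)). distinguishes_efficiently s \<tau> \<tau>'"
    if \<tau>: "is_tangle G \<tau>" and \<tau>': "is_tangle G \<tau>'" and dist: "distinguishable_upto k \<tau> \<tau>'" for \<tau> \<tau>'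
  proof -
    obtain n n' where n: "tangle_of_order G n \<tau>" "tangle_of_order G n' \<tau>'"
      using \<tau> \<tau>' unfolding is_tangle_def by blast
    obtain s0 j where s0: "distinguishes_efficiently s0 \<tau> \<tau>'" "sep_order s0 = enat j" "j \<le> k"
      using dist by (rule efficient_distinguisher_exists)
    \<comment> \<open>The separation found at level \<open>j\<close> may differ from
      \<open>s0\<close>; it is efficient because the bottleneck consists of all efficient
      distinguishers of this pair.\<close>
    obtain s where s: "distinguishes_efficiently s \<tau> \<tau>'" "s \<in> N_level G j"
      using N_level_meets_bottleneck[OF assms efficient_distinguishers_bottleneck[OF assms n s0(1,2)]] by blast
    have "s \<in> N_upto G k" using s(2) s0(3) unfolding N_upto_def by blast
    then show ?thesis using induced_seps_tree_of s(1) by blast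
  qed
  then show ?thesis using tree_decomposition_tree_of unfolding tree_of_tangles_def by blast
qed

end
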